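(* Let $K$ be a simplicial complex on $[m]$ such that every $j\in[m]$ belongs to at least one simplex of $K$. The integral cohomology ring of the real moment-angle complex $(D^1,S^0)^K$ is isomorphic to $\big(\mathcal{R}^*_{Y^K,\mathcal{P}},\cup\big)$, where $\mathcal{R}^*_{Y^K,\mathcal{P}}=\bigoplus_{J\subseteq[m]}H^*(Y^K,P_J)$ and $$H^*(Y^K,P_J)\otimes H^*(Y^K,P_{J'})\overset{\cup}{\longrightarrow}H^*(Y^K,P_{J\cup J'})$$ is the relative cup product for all $J,J'\subseteq[m]$.
   Context: $[m]=\{1,\dots,m\}$; a simplicial complex $K$ on $[m]$ is a collection of subsets of $[m]$ closed under taking subsets and containing $\varnothing$. $D^1=[-1,1]$, $S^0=\{\pm1\}$. The real moment-angle complex over $K$ is $(D^1,S^0)^K=\bigcup_{\sigma\in K}\prod_{j\in\sigma}D^1\times\prod_{j\in[m]\setminus\sigma}S^0\subseteq(D^1)^m$. Let $K'$ be the barycentric subdivision of $K$ (its simplices are the chains of nonempty simplices of $K$ ordered by inclusion). For a nonempty $\sigma\in K$, $F_\sigma\subseteq K'$ is the geometric realization of the poset $K_{\geq\sigma}=\{\tau\in K\mid\sigma\subseteq\tau\}$. $Y^K=u_0K'$ is the cone on $K'$ with apex $u_0$, and $\mathcal{P}=\{P_j=F_{\{j\}}\}_{j\in[m]}$, the $P_j$ being viewed as subcomplexes of the base $K'$ of the cone. For $J\subseteq[m]$, $P_J=\bigcup_{j\in J}P_j$, with $P_\varnothing=\varnothing$. $H^*$ is singular cohomology with integral coefficients.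 *)

theory Defs
  imports "HOL-Homology.Homology" "HOL-Algebra.QuotRing"
begin

section \<open>Singular cohomology with integral coefficients\<close>

text \<open>
  An integral cochain is a homomorphism from the free abelian group on the singular simplices to the
  integers; it is represented by its values on the generators, extended by 0 to functions that are
  not singular simplices of the space.
\<close>

type_synonym 'a cochain = "((nat \<Rightarrow> real) \<Rightarrow> 'a) \<Rightarrow> int"

text \<open>
  The argument \<open>\<A>\<close> is a set of subspaces on whose simplices the cochains vanish.
  For \<open>\<A> = {A}\<close> these are the cochains of the pair \<open>(X, A)\<close>; for \<open>\<A> = {A, B}\<close> they are
  the cochains on \<open>X\<close> vanishing on the sum of chain groups \<open>C(A) + C(B)\<close>, in which the cup product of
  a cochain of \<open>(X, A)\<close> with a cochain of \<open>(X, B)\<close> naturally lives.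
\<close>

definition cochains :: "nat \<Rightarrow> 'a topology \<Rightarrow> 'a set set \<Rightarrow> 'a cochain set" where
  "cochains p X \<A> =
     {u. (\<forall>f. \<not> singular_simplex p X f \<longrightarrow> u f = 0) \<and>
         (\<forall>A\<in>\<A>. \<forall>f. singular_simplex p (subtopology X A) f \<longrightarrow> u f = 0)}"

definition coboundary :: "nat \<Rightarrow> 'a topology \<Rightarrow> 'a cochain \<Rightarrow> 'a cochain" where
  "coboundary p X u =
     (\<lambda>f. if singular_simplex (Suc p) X f
          then \<Sum>k\<le>Suc p. (-1) ^ k * u (singular_face (Suc p) k f) else 0)"

definition cocycle_group :: "nat \<Rightarrow> 'a topology \<Rightarrow> 'a set set \<Rightarrow> 'a cochain monoid" where
  "cocycle_group p X \<A> =
     \<lparr>carrier = {u \<in> cochains p X \<A>. coboundary p X u = (\<lambda>_. 0)},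
      monoid.mult = (\<lambda>u v f. u f + v f),
      one = (\<lambda>_. 0)\<rparr>"

definition coboundaries :: "nat \<Rightarrow> 'a topology \<Rightarrow> 'a set set \<Rightarrow> 'a cochain set" where
  "coboundaries p X \<A> =
     (case p of 0 \<Rightarrow> {\<lambda>_. 0} | Suc q \<Rightarrow> coboundary q X ` cochains q X \<A>)"

definition cohomology_group :: "nat \<Rightarrow> 'a topology \<Rightarrow> 'a set set \<Rightarrow> 'a cochain set monoid" where
  "cohomology_group p X \<A> = cocycle_group p X \<A> Mod coboundaries p X \<A>"

definition cohomology_class ::
    "nat \<Rightarrow> 'a topology \<Rightarrow> 'a set set \<Rightarrow> 'a cochain \<Rightarrow> 'a cochain set" where
  "cohomology_class p X \<A> u = coboundaries p X \<A> #>\<^bsub>cocycle_group p X \<A>\<^esub> u"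

abbreviation rel_cohomology :: "nat \<Rightarrow> 'a topology \<Rightarrow> 'a set \<Rightarrow> 'a cochain set monoid" where
  "rel_cohomology p X A \<equiv> cohomology_group p X {A}"

text \<open>
  The restrictions of a singular simplex to the face spanned by its first \<open>p + 1\<close> vertices and to the
  face spanned by the vertices \<open>p, \<dots>, p + q\<close>.
\<close>

definition front_face :: "nat \<Rightarrow> ((nat \<Rightarrow> real) \<Rightarrow> 'a) \<Rightarrow> (nat \<Rightarrow> real) \<Rightarrow> 'a" where
  "front_face p f = restrict f (standard_simplex p)"

definition back_face :: "nat \<Rightarrow> nat \<Rightarrow> ((nat \<Rightarrow> real) \<Rightarrow> 'a) \<Rightarrow> (nat \<Rightarrow> real) \<Rightarrow> 'a" where
  "back_face p q f =
     restrict (\<lambda>x. f (\<lambda>i. if i < p then 0 else x (i - p))) (standard_simplex q)"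

definition cup_cochain ::
    "nat \<Rightarrow> nat \<Rightarrow> 'a topology \<Rightarrow> 'a cochain \<Rightarrow> 'a cochain \<Rightarrow> 'a cochain" where
  "cup_cochain p q X u v =
     (\<lambda>f. if singular_simplex (p + q) X f
          then u (front_face p f) * v (back_face p q f) else 0)"

text \<open>
  The relative cup product is the composite of the product into the cohomology of \<open>C(X) / (C(A) + C(B))\<close>
  with the inverse of the restriction map from the cohomology of \<open>(X, A \<union> B)\<close>. It is meaningful
  whenever the latter is bijective, e.g. when \<open>A\<close> and \<open>B\<close> are subcomplexes of a CW complex \<open>X\<close>.
\<close>

definition restrict_to_sum ::
    "nat \<Rightarrow> 'a topology \<Rightarrow> 'a set \<Rightarrow> 'a set \<Rightarrow> 'a cochain set \<Rightarrow> 'a cochain set" where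
  "restrict_to_sum n X A B z = (\<Union>u\<in>z. cohomology_class n X {A, B} u)"

definition cup_to_sum ::
    "nat \<Rightarrow> nat \<Rightarrow> 'a topology \<Rightarrow> 'a set \<Rightarrow> 'a set \<Rightarrow>
      'a cochain set \<Rightarrow> 'a cochain set \<Rightarrow> 'a cochain set" where
  "cup_to_sum p q X A B x y =
     (\<Union>u\<in>x. \<Union>v\<in>y. cohomology_class (p + q) X {A, B} (cup_cochain p q X u v))"

definition rel_cup ::
    "nat \<Rightarrow> nat \<Rightarrow> 'a topology \<Rightarrow> 'a set \<Rightarrow> 'a set \<Rightarrow>
      'a cochain set \<Rightarrow> 'a cochain set \<Rightarrow> 'a cochain set" where
  "rel_cup p q X A B x y =
     the_inv_into (carrier (rel_cohomology (p + q) X (A \<union> B))) (restrict_to_sum (p + q) X A B)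
       (cup_to_sum p q X A B x y)"

definition unit_class :: "'a topology \<Rightarrow> 'a cochain set" where
  "unit_class X = cohomology_class 0 X {{}} (\<lambda>f. if singular_simplex 0 X f then 1 else 0)"


section \<open>Graded rings\<close>

text \<open>
  The groups of the algebra and homology libraries are written multiplicatively; in the ring
  \<open>graded_ring G \<mu> e\<close> the multiplication of the group \<open>G p\<close> is the addition in degree \<open>p\<close>,
  \<open>\<mu> p q : G p \<times> G q \<rightarrow> G (p + q)\<close> is the product, and \<open>e \<in> G 0\<close> is the unit.
\<close>

definition graded_ring ::
    "(nat \<Rightarrow> 'h monoid) \<Rightarrow> (nat \<Rightarrow> nat \<Rightarrow> 'h \<Rightarrow> 'h \<Rightarrow> 'h) \<Rightarrow> 'h \<Rightarrow> (nat \<Rightarrow> 'h) ring" where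
  "graded_ring G \<mu> e =
     \<lparr>carrier = carrier (sum_group UNIV G),
      monoid.mult = (\<lambda>x y n. finprod (G n) (\<lambda>p. \<mu> p (n - p) (x p) (y (n - p))) {..n}),
      one = (\<lambda>p. if p = 0 then e else \<one>\<^bsub>G p\<^esub>),
      zero = \<one>\<^bsub>sum_group UNIV G\<^esub>,
      add = monoid.mult (sum_group UNIV G)\<rparr>"

definition homogeneous :: "(nat \<Rightarrow> 'h) ring \<Rightarrow> nat \<Rightarrow> (nat \<Rightarrow> 'h) set" where
  "homogeneous R p = {x \<in> carrier R. \<forall>q. q \<noteq> p \<longrightarrow> x q = \<zero>\<^bsub>R\<^esub> q}"

definition graded_ring_isomorphic :: "(nat \<Rightarrow> 'h) ring \<Rightarrow> (nat \<Rightarrow> 'k) ring \<Rightarrow> bool" where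
  "graded_ring_isomorphic R S \<longleftrightarrow>
     (\<exists>h \<in> ring_iso R S. \<forall>p. h ` homogeneous R p = homogeneous S p)"

definition cohomology_ring :: "'a topology \<Rightarrow> (nat \<Rightarrow> 'a cochain set) ring" where
  "cohomology_ring X =
     graded_ring (\<lambda>p. rel_cohomology p X {}) (\<lambda>p q. rel_cup p q X {} {}) (unit_class X)"

text \<open>
  The ring \<open>\<R>\<^sup>* = (\<Oplus>J \<subseteq> [m]. H\<^sup>*(Y, P\<^sub>J))\<close> for a family of subspaces \<open>P 1, \<dots>, P m\<close> of \<open>Y\<close>:
  in degree \<open>p\<close> it is the direct sum over \<open>J\<close> of the groups \<open>H\<^sup>p(Y, P\<^sub>J)\<close>, and the component at \<open>L\<close> of a
  product collects the relative cup products of all components at \<open>J, J'\<close> with \<open>J \<union> J' = L\<close>.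
\<close>

definition union_over :: "(nat \<Rightarrow> 'a set) \<Rightarrow> nat set \<Rightarrow> 'a set" where
  "union_over P J = (\<Union>j\<in>J. P j)"

definition R_group ::
    "'a topology \<Rightarrow> nat \<Rightarrow> (nat \<Rightarrow> 'a set) \<Rightarrow> nat \<Rightarrow> (nat set \<Rightarrow> 'a cochain set) monoid" where
  "R_group Y m P p = sum_group (Pow {1..m}) (\<lambda>J. rel_cohomology p Y (union_over P J))"

definition R_mult ::
    "'a topology \<Rightarrow> nat \<Rightarrow> (nat \<Rightarrow> 'a set) \<Rightarrow> nat \<Rightarrow> nat \<Rightarrow>
      (nat set \<Rightarrow> 'a cochain set) \<Rightarrow> (nat set \<Rightarrow> 'a cochain set) \<Rightarrow> (nat set \<Rightarrow> 'a cochain set)" where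
  "R_mult Y m P p q x y =
     (\<lambda>L\<in>Pow {1..m}.
        finprod (rel_cohomology (p + q) Y (union_over P L))
          (\<lambda>(J, J'). rel_cup p q Y (union_over P J) (union_over P J') (x J) (y J'))
          {(J, J'). J \<subseteq> {1..m} \<and> J' \<subseteq> {1..m} \<and> J \<union> J' = L})"

definition R_unit ::
    "'a topology \<Rightarrow> nat \<Rightarrow> (nat \<Rightarrow> 'a set) \<Rightarrow> (nat set \<Rightarrow> 'a cochain set)" where
  "R_unit Y m P =
     (\<lambda>J\<in>Pow {1..m}.
        if J = {} then unit_class Y else \<one>\<^bsub>rel_cohomology 0 Y (union_over P J)\<^esub>)"

definition R_ring ::
    "'a topology \<Rightarrow> nat \<Rightarrow> (nat \<Rightarrow> 'a set) \<Rightarrow> (nat \<Rightarrow> nat set \<Rightarrow> 'a cochain set) ring" where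
  "R_ring Y m P = graded_ring (R_group Y m P) (R_mult Y m P) (R_unit Y m P)"


section \<open>Simplicial complexes and real moment-angle complexes\<close>

definition simplicial_complex_on :: "nat \<Rightarrow> nat set set \<Rightarrow> bool" where
  "simplicial_complex_on m K \<longleftrightarrow>
     K \<subseteq> Pow {1..m} \<and> {} \<in> K \<and> (\<forall>\<sigma>\<in>K. \<forall>\<tau>. \<tau> \<subseteq> \<sigma> \<longrightarrow> \<tau> \<in> K)"

definition real_moment_angle :: "nat \<Rightarrow> nat set set \<Rightarrow> (nat \<Rightarrow> real) topology" where
  "real_moment_angle m K =
     subtopology (powertop_real {1..m})
       (\<Union>\<sigma>\<in>K. \<Pi>\<^sub>E j\<in>{1..m}. if j \<in> \<sigma> then {-1..1} else {-1, 1})"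

text \<open>
  Geometric realization of an abstract simplicial complex \<open>L\<close> (containing the empty simplex) by
  barycentric coordinates. It is only used for complexes with finitely many vertices, where the
  product topology on coordinates is the usual topology of the realization.
\<close>

definition realization :: "'v set set \<Rightarrow> ('v \<Rightarrow> real) set" where
  "realization L =
     {t. (\<forall>v. 0 \<le> t v) \<and> {v. t v \<noteq> 0} \<in> L \<and> sum t {v. t v \<noteq> 0} = 1}"

definition order_complex :: "'b set set \<Rightarrow> 'b set set set" where
  "order_complex Q = {c. finite c \<and> c \<subseteq> Q \<and> chain\<^sub>\<subseteq> c}"

definition barycentric_subdivision :: "nat set set \<Rightarrow> nat set set set" where
  "barycentric_subdivision K = order_complex (K - {{}})"

text \<open>
  The vertices of the cone on \<open>L\<close> are the apex \<open>None\<close> and the vertices \<open>Some v\<close> of its base.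
\<close>

definition cone_base :: "'v set set \<Rightarrow> 'v option set set" where
  "cone_base L = (\<lambda>c. Some ` c) ` L"

definition cone_complex :: "'v set set \<Rightarrow> 'v option set set" where
  "cone_complex L = cone_base L \<union> insert None ` cone_base L"

definition Y_space :: "nat set set \<Rightarrow> (nat set option \<Rightarrow> real) topology" where
  "Y_space K =
     subtopology (powertop_real UNIV) (realization (cone_complex (barycentric_subdivision K)))"

text \<open>\<open>F\<^sub>\<sigma>\<close>, as a subspace of the base of the cone.\<close>

definition F_face :: "nat set set \<Rightarrow> nat set \<Rightarrow> (nat set option \<Rightarrow> real) set" where
  "F_face K \<sigma> = realization (cone_base (order_complex {\<tau> \<in> K. \<sigma> \<subseteq> \<tau>}))"

definition P_panel :: "nat set set \<Rightarrow> nat \<Rightarrow> (nat set option \<Rightarrow> real) set" where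
  "P_panel K j = F_face K {j}"

end

theory Submission
  imports Defs
begin

text \<open>
  Both spaces are covered by the open stars of finitely many vertices. The cube vertices of
  \<open>(D\<^sup>1, S\<^sup>0)\<^sup>K\<close> are the sign vectors with zero set in \<open>K\<close>, those of \<open>Y\<close> the simplices of \<open>K\<close>, and in
  both cases the simplices are chains. Restricting a singular cochain to the affine simplices with
  ordered vertices respects coboundaries and cup products on the nose, and it is a quasi-isomorphism,
  also relative to unions of panels. On the level of such ordered simplicial cochains, a simplex of
  the cube complex is a chain \<open>c\<close> of \<open>K\<close> with a set \<open>N\<close> of negative coordinates, and
  \<open>(u\<^sub>J) \<mapsto> (\<lambda>(c, N). \<Sum>J. if J \<inter> N = {} then u\<^sub>J c else 0)\<close> is a multiplicative cochain map from
  \<open>\<Oplus>J. C\<^sup>*(Y, P\<^sub>J)\<close>, which is bijective by Moebius inversion over the subsets of the vertex set.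
\<close>

section \<open>Singular cochains and their cohomology\<close>

text \<open>Bijectivity rests on a compensation. A lifted chain determines \<open>N\<close> only up
  to the elements common to all members of \<open>c\<close>; if such an element lies in
  \<open>J\<close>, then \<open>c\<close> lies in P_J, where u_J vanishes. The same observation
  yields compatibility with coboundaries and products: when a face of a lifted list no longer sees a
  negative coordinate j of \<open>J\<close>, every member of that face contains j, so the face lies
  in P_J. The obstacle is the relative cup product, defined by inverting a restriction map whose
  bijectivity is an excision statement for closed panels without collars at hand. Chain groups are
  therefore treated as spans of sets of simplices. For these, excision is an identity of quotients,
  and it remains to know that affine simplices compute the homology of Y, of P_J, of P_J' and of
  their intersection; all four are star covers. Ordered simplices are lists with repetitions. A
  singular simplex is then approximated by the list of vertices chosen at its corners, with no
  degenerate cases, and its front and back faces become initial and final segments.\<close>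

text \<open>The basis type is arbitrary because chains of vertex lists are evaluated too. The
  constant function 1 gives the augmentation.\<close>

definition cochain_eval :: "('b \<Rightarrow> int) \<Rightarrow> ('b \<Rightarrow>\<^sub>0 int) \<Rightarrow> int" where
  "cochain_eval u c = (\<Sum>f\<in>Poly_Mapping.keys c. Poly_Mapping.lookup c f * u f)"

lemma cochain_eval_superset:
  assumes "finite A" "Poly_Mapping.keys c \<subseteq> A"
  shows "cochain_eval u c = (\<Sum>f\<in>A. Poly_Mapping.lookup c f * u f)"
  unfolding cochain_eval_def
  by (rule sum.mono_neutral_left) (use assms in \<open>auto simp: in_keys_iff\<close>)

lemma cochain_eval_0 [simp]: "cochain_eval u 0 = 0"
  by (simp add: cochain_eval_def)

lemma cochain_eval_of [simp]: "cochain_eval u (frag_of f) = u f"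
  by (simp add: cochain_eval_def)

lemma cochain_eval_add: "cochain_eval u (a + b) = cochain_eval u a + cochain_eval u b"
proof -
  let ?A = "Poly_Mapping.keys a \<union> Poly_Mapping.keys b"
  have "cochain_eval u (a + b) = (\<Sum>f\<in>?A. Poly_Mapping.lookup (a + b) f * u f)"
    by (rule cochain_eval_superset) (use keys_add [of a b] in auto)
  moreover have "cochain_eval u a = (\<Sum>f\<in>?A. Poly_Mapping.lookup a f * u f)"
    by (rule cochain_eval_superset) auto
  moreover have "cochain_eval u b = (\<Sum>f\<in>?A. Poly_Mapping.lookup b f * u f)"
    by (rule cochain_eval_superset) auto
  ultimately show ?thesis
    by (simp add: lookup_add algebra_simps sum.distrib)
qed

lemma cochain_eval_minus: "cochain_eval u (- a) = - cochain_eval u a"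
  using cochain_eval_add [of u a "- a"] by simp

lemma cochain_eval_diff: "cochain_eval u (a - b) = cochain_eval u a - cochain_eval u b"
  using cochain_eval_add [of u a "- b"] by (simp add: cochain_eval_minus)

lemma cochain_eval_cmul: "cochain_eval u (frag_cmul k a) = k * cochain_eval u a"
proof -
  have "cochain_eval u (frag_cmul k a)
      = (\<Sum>f\<in>Poly_Mapping.keys a. Poly_Mapping.lookup (frag_cmul k a) f * u f)"
    by (rule cochain_eval_superset) auto
  then show ?thesis
    by (simp add: cochain_eval_def sum_distrib_left mult.assoc)
qed

lemma cochain_eval_sum: "cochain_eval u (sum c A) = (\<Sum>i\<in>A. cochain_eval u (c i))"
  by (induction A rule: infinite_finite_induct) (auto simp: cochain_eval_add)

lemma cochain_eval_vanish:
  "(\<And>f. f \<in> Poly_Mapping.keys c \<Longrightarrow> u f = 0) \<Longrightarrow> cochain_eval u c = 0"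
  by (simp add: cochain_eval_def)

lemma cochain_eval_frag_extend:
  "cochain_eval u (frag_extend D c) = cochain_eval (\<lambda>f. cochain_eval u (D f)) c"
  by (simp add: frag_extend_def cochain_eval_sum cochain_eval_cmul cochain_eval_def [of _ c])

lemma cochain_eval_cong:
  "(\<And>f. f \<in> Poly_Mapping.keys c \<Longrightarrow> u f = v f) \<Longrightarrow> cochain_eval u c = cochain_eval v c"
  by (simp add: cochain_eval_def)

lemma coboundary_eq_eval:
  assumes "singular_simplex (Suc p) X f"
  shows "coboundary p X u f = cochain_eval u (chain_boundary (Suc p) (frag_of f))"
  using assms by (simp add: coboundary_def chain_boundary_of cochain_eval_sum cochain_eval_cmul del: sum.atMost_Suc)

text \<open>Adjointness of coboundary and boundary, through which facts about singular chains pass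
  to cochains.\<close>

lemma cochain_eval_coboundary:
  assumes "singular_chain (Suc p) X c"
  shows "cochain_eval (coboundary p X u) c = cochain_eval u (chain_boundary (Suc p) c)"
  using assms unfolding singular_chain_def
  by (induction rule: frag_induction)
     (auto simp: coboundary_eq_eval chain_boundary_diff cochain_eval_diff)

lemma coboundary_coboundary: "coboundary (Suc p) X (coboundary p X u) = (\<lambda>_. 0)"
proof
  fix f
  show "coboundary (Suc p) X (coboundary p X u) f = 0"
  proof (cases "singular_simplex (Suc (Suc p)) X f")
    case True
    then have c: "singular_chain (Suc (Suc p)) X (frag_of f)"
      by (simp add: singular_chain_of)
    have "coboundary (Suc p) X (coboundary p X u) f
        = cochain_eval (coboundary p X u) (chain_boundary (Suc (Suc p)) (frag_of f))"
      by (rule coboundary_eq_eval [OF True])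
    also have "\<dots> = cochain_eval u (chain_boundary (Suc p) (chain_boundary (Suc (Suc p)) (frag_of f)))"
      by (rule cochain_eval_coboundary) (rule singular_chain_boundary_alt [OF c])
    also have "\<dots> = 0"
      by (simp add: chain_boundary_boundary_alt [OF c])
    finally show ?thesis .
  qed (simp add: coboundary_def)
qed

lemma coboundary_add:
  "coboundary p X (\<lambda>f. u f + v f) = (\<lambda>f. coboundary p X u f + coboundary p X v f)"
  by (rule ext) (simp add: coboundary_def algebra_simps sum.distrib del: sum.atMost_Suc)

lemma coboundary_diff:
  "coboundary p X (\<lambda>f. u f - v f) = (\<lambda>f. coboundary p X u f - coboundary p X v f)"
  by (rule ext) (simp add: coboundary_def algebra_simps sum_subtractf del: sum.atMost_Suc)

lemma coboundary_zero [simp]: "coboundary p X (\<lambda>_. 0) = (\<lambda>_. 0)"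
  by (rule ext) (simp add: coboundary_def)

lemma coboundary_uminus: "coboundary p X (\<lambda>f. - u f) = (\<lambda>f. - coboundary p X u f)"
  using coboundary_diff [of p X "\<lambda>_. 0" u] by simp

lemma cochains_zero [simp]: "(\<lambda>_. 0) \<in> cochains p X \<A>"
  by (simp add: cochains_def)

lemma cochains_add: "u \<in> cochains p X \<A> \<Longrightarrow> v \<in> cochains p X \<A> \<Longrightarrow> (\<lambda>f. u f + v f) \<in> cochains p X \<A>"
  by (simp add: cochains_def)

lemma cochains_diff: "u \<in> cochains p X \<A> \<Longrightarrow> v \<in> cochains p X \<A> \<Longrightarrow> (\<lambda>f. u f - v f) \<in> cochains p X \<A>"
  by (simp add: cochains_def)

lemma cochains_uminus: "u \<in> cochains p X \<A> \<Longrightarrow> (\<lambda>f. - u f) \<in> cochains p X \<A>"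
  by (simp add: cochains_def)

lemma singular_face_Suc:
  "singular_simplex (Suc p) X f \<Longrightarrow> k \<le> Suc p \<Longrightarrow> singular_simplex p X (singular_face (Suc p) k f)"
  using singular_simplex_singular_face [of "Suc p" X f k] by simp

lemma coboundary_in_cochains:
  assumes "u \<in> cochains p X \<A>" shows "coboundary p X u \<in> cochains (Suc p) X \<A>"
  using assms singular_face_Suc [of p "subtopology X _"]
  by (simp add: cochains_def coboundary_def)

section \<open>Cocycles, coboundaries and cohomology classes\<close>

definition cocycles :: "nat \<Rightarrow> 'a topology \<Rightarrow> 'a set set \<Rightarrow> 'a cochain set" where
  "cocycles p X \<A> = {u \<in> cochains p X \<A>. coboundary p X u = (\<lambda>_. 0)}"

lemma carrier_cocycle_group [simp]: "carrier (cocycle_group p X \<A>) = cocycles p X \<A>"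
  and mult_cocycle_group [simp]: "u \<otimes>\<^bsub>cocycle_group p X \<A>\<^esub> v = (\<lambda>f. u f + v f)"
  and one_cocycle_group [simp]: "\<one>\<^bsub>cocycle_group p X \<A>\<^esub> = (\<lambda>_. 0)"
  by (simp_all add: cocycle_group_def cocycles_def)

lemma cocycles_zero [simp]: "(\<lambda>_. 0) \<in> cocycles p X \<A>"
  by (simp add: cocycles_def)

lemma cocycles_add: "u \<in> cocycles p X \<A> \<Longrightarrow> v \<in> cocycles p X \<A> \<Longrightarrow> (\<lambda>f. u f + v f) \<in> cocycles p X \<A>"
  by (simp add: cocycles_def cochains_add coboundary_add)

lemma cocycles_diff: "u \<in> cocycles p X \<A> \<Longrightarrow> v \<in> cocycles p X \<A> \<Longrightarrow> (\<lambda>f. u f - v f) \<in> cocycles p X \<A>"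
  by (simp add: cocycles_def cochains_diff coboundary_diff)

lemma cocycles_uminus: "u \<in> cocycles p X \<A> \<Longrightarrow> (\<lambda>f. - u f) \<in> cocycles p X \<A>"
  by (simp add: cocycles_def cochains_uminus coboundary_uminus)

lemma comm_group_cocycle_group: "comm_group (cocycle_group p X \<A>)"
proof (rule comm_groupI)
  fix u assume "u \<in> carrier (cocycle_group p X \<A>)"
  then show "\<exists>v\<in>carrier (cocycle_group p X \<A>). v \<otimes>\<^bsub>cocycle_group p X \<A>\<^esub> u = \<one>\<^bsub>cocycle_group p X \<A>\<^esub>"
    by (intro bexI [of _ "\<lambda>f. - u f"]) (auto simp: cocycles_uminus)
qed (auto simp: cocycles_add algebra_simps)

lemma coboundaries_subset_cocycles: "coboundaries p X \<A> \<subseteq> cocycles p X \<A>"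
  by (cases p) (auto simp: coboundaries_def cocycles_def coboundary_in_cochains coboundary_coboundary)

lemma coboundaries_zero [simp]: "(\<lambda>_. 0) \<in> coboundaries p X \<A>"
  by (cases p) (auto simp: coboundaries_def intro!: image_eqI [of _ _ "\<lambda>_. 0"])

lemma coboundaries_add:
  "u \<in> coboundaries p X \<A> \<Longrightarrow> v \<in> coboundaries p X \<A> \<Longrightarrow> (\<lambda>f. u f + v f) \<in> coboundaries p X \<A>"
  by (cases p) (auto simp: coboundaries_def cochains_add simp flip: coboundary_add)

lemma coboundaries_diff:
  "u \<in> coboundaries p X \<A> \<Longrightarrow> v \<in> coboundaries p X \<A> \<Longrightarrow> (\<lambda>f. u f - v f) \<in> coboundaries p X \<A>"
  by (cases p) (auto simp: coboundaries_def cochains_diff simp flip: coboundary_diff)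

lemma coboundaries_uminus: "u \<in> coboundaries p X \<A> \<Longrightarrow> (\<lambda>f. - u f) \<in> coboundaries p X \<A>"
  using coboundaries_diff [of "\<lambda>_. 0" p X \<A> u] by simp

lemma subgroup_coboundaries: "subgroup (coboundaries p X \<A>) (cocycle_group p X \<A>)"
proof -
  interpret comm_group "cocycle_group p X \<A>" by (rule comm_group_cocycle_group)
  show ?thesis
  proof (rule subgroupI)
    show "coboundaries p X \<A> \<noteq> {}"
      using coboundaries_zero by blast
  next
    fix u assume u: "u \<in> coboundaries p X \<A>"
    then have "u \<in> cocycles p X \<A>"
      using coboundaries_subset_cocycles by blast
    then have "inv\<^bsub>cocycle_group p X \<A>\<^esub> u = (\<lambda>f. - u f)"
      by (intro inv_equality) (auto simp: cocycles_uminus)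
    then show "inv\<^bsub>cocycle_group p X \<A>\<^esub> u \<in> coboundaries p X \<A>"
      using u by (simp add: coboundaries_uminus)
  qed (use coboundaries_subset_cocycles [of p X \<A>] in \<open>auto simp: coboundaries_add\<close>)
qed

lemma normal_coboundaries: "coboundaries p X \<A> \<lhd> cocycle_group p X \<A>"
  by (simp add: comm_group.subgroup_imp_normal comm_group_cocycle_group subgroup_coboundaries)

lemma comm_group_cohomology_group: "comm_group (cohomology_group p X \<A>)"
  unfolding cohomology_group_def
  by (rule comm_group.abelian_FactGroup [OF comm_group_cocycle_group subgroup_coboundaries])

lemma cohomology_class_eq_set:
  "cohomology_class p X \<A> u = {v. (\<lambda>f. v f - u f) \<in> coboundaries p X \<A>}"
proof -
  have "v \<in> cohomology_class p X \<A> u \<longleftrightarrow> (\<exists>b\<in>coboundaries p X \<A>. v = (\<lambda>f. b f + u f))" for v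
    by (simp add: cohomology_class_def r_coset_def)
  moreover have "(\<exists>b\<in>coboundaries p X \<A>. v = (\<lambda>f. b f + u f)) \<longleftrightarrow> (\<lambda>f. v f - u f) \<in> coboundaries p X \<A>" for v
  proof
    show "\<exists>b\<in>coboundaries p X \<A>. v = (\<lambda>f. b f + u f)" if "(\<lambda>f. v f - u f) \<in> coboundaries p X \<A>"
      by (rule bexI [OF _ that]) auto
  qed auto
  ultimately show ?thesis by auto
qed

text \<open>Holds for all functions, cocycles or not, so classes can be compared before their
  representatives are known to be cocycles.\<close>

lemma cohomology_class_eq_iff:
  "cohomology_class p X \<A> u = cohomology_class p X \<A> v \<longleftrightarrow> (\<lambda>f. u f - v f) \<in> coboundaries p X \<A>"
proof
  assume "cohomology_class p X \<A> u = cohomology_class p X \<A> v"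
  moreover have "u \<in> cohomology_class p X \<A> u"
    by (simp add: cohomology_class_eq_set)
  ultimately show "(\<lambda>f. u f - v f) \<in> coboundaries p X \<A>"
    by (simp add: cohomology_class_eq_set)
next
  assume uv: "(\<lambda>f. u f - v f) \<in> coboundaries p X \<A>"
  have "(\<lambda>f. w f - u f) \<in> coboundaries p X \<A> \<longleftrightarrow> (\<lambda>f. w f - v f) \<in> coboundaries p X \<A>" for w
    using coboundaries_add [OF _ uv, of "\<lambda>f. w f - u f"] coboundaries_diff [OF _ uv, of "\<lambda>f. w f - v f"]
    by auto
  then show "cohomology_class p X \<A> u = cohomology_class p X \<A> v"
    by (simp add: cohomology_class_eq_set)
qed

lemma carrier_cohomology_group:
  "carrier (cohomology_group p X \<A>) = cohomology_class p X \<A> ` cocycles p X \<A>"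
  by (auto simp: cohomology_group_def FactGroup_def RCOSETS_def cohomology_class_def)

lemma cohomology_class_in_carrier [simp]:
  "u \<in> cocycles p X \<A> \<Longrightarrow> cohomology_class p X \<A> u \<in> carrier (cohomology_group p X \<A>)"
  by (simp add: carrier_cohomology_group)

lemma mult_cohomology_class:
  assumes "u \<in> cocycles p X \<A>" "v \<in> cocycles p X \<A>"
  shows "cohomology_class p X \<A> u \<otimes>\<^bsub>cohomology_group p X \<A>\<^esub> cohomology_class p X \<A> v
       = cohomology_class p X \<A> (\<lambda>f. u f + v f)"
  using normal.rcos_sum [OF normal_coboundaries, of u p X \<A> v] assms
  by (simp add: cohomology_group_def FactGroup_def cohomology_class_def)

lemma one_cohomology_group: "\<one>\<^bsub>cohomology_group p X \<A>\<^esub> = cohomology_class p X \<A> (\<lambda>_. 0)"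
  by (simp add: cohomology_group_def FactGroup_def cohomology_class_eq_set)

lemma mem_cohomology_class:
  assumes "u \<in> cocycles p X \<A>" "v \<in> cohomology_class p X \<A> u"
  shows "v \<in> cocycles p X \<A>" "cohomology_class p X \<A> v = cohomology_class p X \<A> u"
proof -
  have b: "(\<lambda>f. v f - u f) \<in> coboundaries p X \<A>"
    using assms by (simp add: cohomology_class_eq_set)
  then show "cohomology_class p X \<A> v = cohomology_class p X \<A> u"
    by (simp add: cohomology_class_eq_iff)
  show "v \<in> cocycles p X \<A>"
    using cocycles_add [OF assms(1), of "\<lambda>f. v f - u f"] b coboundaries_subset_cocycles [of p X \<A>] by auto
qed

lemma self_mem_cohomology_class [simp]: "u \<in> cohomology_class p X \<A> u"
  by (simp add: cohomology_class_eq_set)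

lemma finprod_cohomology_class:
  assumes "\<And>i. i \<in> A \<Longrightarrow> u i \<in> cocycles p X \<A>"
  shows "finprod (cohomology_group p X \<A>) (\<lambda>i. cohomology_class p X \<A> (u i)) A
       = cohomology_class p X \<A> (\<lambda>f. \<Sum>i\<in>A. u i f)
     \<and> (\<lambda>f. \<Sum>i\<in>A. u i f) \<in> cocycles p X \<A>"
  using assms
proof (induction A rule: infinite_finite_induct)
  case (insert i A)
  interpret comm_group "cohomology_group p X \<A>" by (rule comm_group_cohomology_group)
  show ?case
    using insert by (simp add: Pi_iff mult_cohomology_class cocycles_add)
\<comment> \<open>For infinite \<open>A\<close> both sides take their default values, the neutral
  class and the zero function.\<close>
qed (auto simp: finprod_def one_cohomology_group)

section \<open>Faces and the Leibniz rule\<close>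

lemma front_inclusion: "x \<in> standard_simplex p \<Longrightarrow> x \<in> standard_simplex (p + q)"
  using standard_simplex_mono [of p "p + q"] by auto

lemma back_inclusion:
  assumes "x \<in> standard_simplex q"
  shows "(\<lambda>i. if i < p then 0 else x (i - p)) \<in> standard_simplex (p + q)"
proof -
  have "(\<Sum>i\<le>p+q. if i < p then 0 else x (i - p)) = (\<Sum>i\<in>{p..p+q}. x (i - p))"
    by (rule sum.mono_neutral_cong_right) auto
  also have "\<dots> = (\<Sum>i\<le>q. x i)"
    using sum.shift_bounds_cl_nat_ivl [of "\<lambda>i. x (i - p)" 0 p q]
    by (simp add: add.commute atMost_atLeast0)
  finally show ?thesis
    using assms by (auto simp: standard_simplex_def)
qed

lemma singular_simplex_front_face:
  assumes "singular_simplex (p + q) X f" shows "singular_simplex p X (front_face p f)"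
proof -
  have "continuous_map (subtopology (powertop_real UNIV) (standard_simplex p)) X f"
    by (rule continuous_map_from_subtopology_mono [of _ "standard_simplex (p+q)"])
       (use assms standard_simplex_mono [of p "p + q"] in \<open>auto simp: singular_simplex_def\<close>)
  then show ?thesis
    by (simp add: singular_simplex_def front_face_def)
qed

lemma singular_simplex_back_face:
  assumes "singular_simplex (p + q) X f" shows "singular_simplex q X (back_face p q f)"
proof -
  let ?s = "\<lambda>x::nat \<Rightarrow> real. \<lambda>i. if i < p then 0 else x (i - p)"
  have "continuous_map (subtopology (powertop_real UNIV) (standard_simplex q))
          (subtopology (powertop_real UNIV) (standard_simplex (p + q))) ?s"
    unfolding continuous_map_in_subtopology
  proof
    show "continuous_map (subtopology (powertop_real UNIV) (standard_simplex q)) (powertop_real UNIV) ?s"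
      unfolding continuous_map_componentwise_UNIV
    proof
      fix k
      show "continuous_map (subtopology (powertop_real UNIV) (standard_simplex q)) euclideanreal (\<lambda>x. ?s x k)"
        by (cases "k < p")
           (auto intro: continuous_map_from_subtopology continuous_map_product_projection)
    qed
    show "?s \<in> topspace (subtopology (powertop_real UNIV) (standard_simplex q)) \<rightarrow> standard_simplex (p + q)"
      using back_inclusion by auto
  qed
  then have "continuous_map (subtopology (powertop_real UNIV) (standard_simplex q)) X (f \<circ> ?s)"
    using assms by (auto simp: singular_simplex_def intro: continuous_map_compose)
  then show ?thesis
    by (simp add: singular_simplex_def back_face_def o_def)
qed

lemma cup_cochain_in_cochains:
  assumes "u \<in> cochains p X {A}" "v \<in> cochains q X {B}"
  shows "cup_cochain p q X u v \<in> cochains (p + q) X {A, B}"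
  using assms singular_simplex_front_face [of p q "subtopology X A"]
    singular_simplex_back_face [of p q "subtopology X B"]
  by (auto simp: cochains_def cup_cochain_def)

text \<open>The low and high identities overlap at \<open>k = Suc p\<close> for front faces and at
  \<open>k = p\<close> for back faces. The overlaps identify the extreme faces of the two parts,
  whose contributions cancel in the Leibniz rule.\<close>

lemma front_face_singular_face_low:
  assumes "k \<le> Suc p"
  shows "front_face p (singular_face (Suc (p + q)) k f) = singular_face (Suc p) k (front_face (Suc p) f)"
  using simplical_face_in_standard_simplex [of "Suc p" k] assms front_inclusion [of _ p q]
  by (auto simp: front_face_def singular_face_def fun_eq_iff restrict_def)

lemma front_face_singular_face_high:
  assumes "p < k"
  shows "front_face p (singular_face (Suc (p + q)) k f) = front_face p f"
proof -
  have "simplical_face k x = x" if "x \<in> standard_simplex p" for x :: "nat \<Rightarrow> real"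
    using that assms by (auto simp: standard_simplex_def simplical_face_def fun_eq_iff)
  then show ?thesis
    using front_inclusion [of _ p q] by (intro ext) (simp add: front_face_def singular_face_def restrict_def)
qed

lemma back_face_singular_face_low:
  assumes "k \<le> p"
  shows "back_face p q (singular_face (Suc (p + q)) k f) = back_face (Suc p) q f"
proof
  fix x :: "nat \<Rightarrow> real"
  have "simplical_face k (\<lambda>i. if i < p then 0 else x (i - p)) = (\<lambda>i. if i < Suc p then 0 else x (i - Suc p))"
    using assms by (auto simp: simplical_face_def fun_eq_iff)
  then show "back_face p q (singular_face (Suc (p + q)) k f) x = back_face (Suc p) q f x"
    using back_inclusion [of x q p] by (simp add: back_face_def singular_face_def)
qed

lemma back_face_singular_face_high:
  assumes "k \<le> Suc q"
  shows "back_face p q (singular_face (Suc (p + q)) (p + k) f) = singular_face (Suc q) k (back_face p (Suc q) f)"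
proof
  fix x :: "nat \<Rightarrow> real"
  have "simplical_face (p + k) (\<lambda>i. if i < p then 0 else x (i - p))
      = (\<lambda>i. if i < p then 0 else simplical_face k x (i - p))"
    by (auto simp: simplical_face_def fun_eq_iff)
  moreover have "simplical_face k x \<in> standard_simplex (Suc q)" if "x \<in> standard_simplex q"
    using simplical_face_in_standard_simplex [of "Suc q" k x] assms that by simp
  ultimately show "back_face p q (singular_face (Suc (p + q)) (p + k) f) x
      = singular_face (Suc q) k (back_face p (Suc q) f) x"
    using back_inclusion [of x q p] by (simp add: back_face_def singular_face_def)
qed

text \<open>The faces are split after \<open>k = p\<close>. The first block is the left summand
  without its last face \<open>Suc p\<close>, the second block is the right summand without its face
  0. Both missing terms are the product of \<open>u\<close> on the front \<open>p\<close>-face with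
  \<open>v\<close> on the back \<open>q\<close>-face starting at vertex \<open>Suc p\<close>, with
  opposite signs.\<close>

lemma coboundary_cup_cochain:
  "coboundary (p + q) X (cup_cochain p q X u v)
   = (\<lambda>f. cup_cochain (Suc p) q X (coboundary p X u) v f
          + (-1) ^ p * cup_cochain p (Suc q) X u (coboundary q X v) f)"
proof
  fix f
  show "coboundary (p + q) X (cup_cochain p q X u v) f
      = cup_cochain (Suc p) q X (coboundary p X u) v f
          + (-1) ^ p * cup_cochain p (Suc q) X u (coboundary q X v) f"
  proof (cases "singular_simplex (Suc (p + q)) X f")
    case f: True
    let ?b = "\<lambda>k. (-1) ^ k * (u (front_face p (singular_face (Suc (p+q)) k f)) *
                 v (back_face p q (singular_face (Suc (p+q)) k f)))"
    have ff: "singular_simplex (Suc p) X (front_face (Suc p) f)"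
      using singular_simplex_front_face [of "Suc p" q] f by simp
    have bf: "singular_simplex (Suc q) X (back_face p (Suc q) f)"
      using singular_simplex_back_face [of p "Suc q"] f by simp
    have "coboundary (p + q) X (cup_cochain p q X u v) f = (\<Sum>k\<le>Suc (p+q). ?b k)"
      using f singular_face_Suc [OF f]
      by (simp add: coboundary_def cup_cochain_def del: sum.atMost_Suc)
    also have "{..Suc (p+q)} = {..p} \<union> {p + 1..p + Suc q}"
      by auto
    also have "sum ?b \<dots> = sum ?b {..p} + sum ?b {p + 1..p + Suc q}"
      by (rule sum.union_disjoint) auto
    also have "sum ?b {..p} = (\<Sum>k\<le>p. (-1) ^ k * u (singular_face (Suc p) k (front_face (Suc p) f)))
                 * v (back_face (Suc p) q f)"
      by (simp add: sum_distrib_right front_face_singular_face_low back_face_singular_face_low mult.assoc)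
    also have "\<dots> = (coboundary p X u (front_face (Suc p) f) - (-1) ^ Suc p * u (front_face p f))
                 * v (back_face (Suc p) q f)"
    proof -
      have "singular_face (Suc p) (Suc p) (front_face (Suc p) f) = front_face p f"
        using front_face_singular_face_low [of "Suc p" p q f] front_face_singular_face_high [of p "Suc p" q f]
        by simp
      then show ?thesis
        using ff by (simp add: coboundary_def)
    qed
    also have "sum ?b {p + 1..p + Suc q} = (\<Sum>k\<in>{1..Suc q}. ?b (p + k))"
      using sum.shift_bounds_cl_nat_ivl [of ?b 1 p "Suc q"] by (simp add: add.commute)
    also have "\<dots> = (-1) ^ p * (u (front_face p f) *
        (\<Sum>k\<in>{1..Suc q}. (-1) ^ k * v (singular_face (Suc q) k (back_face p (Suc q) f))))"
      unfolding sum_distrib_left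
      by (rule sum.cong)
         (auto simp: front_face_singular_face_high back_face_singular_face_high power_add)
    also have "(\<Sum>k\<in>{1..Suc q}. (-1) ^ k * v (singular_face (Suc q) k (back_face p (Suc q) f)))
        = coboundary q X v (back_face p (Suc q) f) - v (back_face (Suc p) q f)"
    proof -
      have "singular_face (Suc q) 0 (back_face p (Suc q) f) = back_face (Suc p) q f"
        using back_face_singular_face_high [of 0 q p f] back_face_singular_face_low [of p p q f]
        by simp
      then show ?thesis
        using bf by (simp add: coboundary_def atMost_atLeast0 sum.atLeast_Suc_atMost del: sum.cl_ivl_Suc)
    qed
    finally show ?thesis
      using f by (simp add: cup_cochain_def algebra_simps)
  qed (simp add: coboundary_def cup_cochain_def)
qed

section \<open>Cup products of classes\<close>

lemma cup_cochain_diff_left: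
  "cup_cochain p q X (\<lambda>f. u f - u' f) v = (\<lambda>f. cup_cochain p q X u v f - cup_cochain p q X u' v f)"
  and cup_cochain_diff_right:
  "cup_cochain p q X u (\<lambda>f. v f - v' f) = (\<lambda>f. cup_cochain p q X u v f - cup_cochain p q X u v' f)"
  and cup_cochain_zero_left: "cup_cochain p q X (\<lambda>_. 0) v = (\<lambda>_. 0)"
  and cup_cochain_zero_right: "cup_cochain p q X u (\<lambda>_. 0) = (\<lambda>_. 0)"
  by (auto simp: cup_cochain_def fun_eq_iff algebra_simps)

lemma cup_cochain_cocycle:
  assumes "u \<in> cocycles p X {A}" "v \<in> cocycles q X {B}"
  shows "cup_cochain p q X u v \<in> cocycles (p + q) X {A, B}"
  using assms
  by (simp add: cocycles_def cup_cochain_in_cochains coboundary_cup_cochain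
      cup_cochain_zero_left cup_cochain_zero_right)

lemma cup_cochain_coboundary_left:
  assumes "b \<in> coboundaries p X {A}" "v \<in> cocycles q X {B}"
  shows "cup_cochain p q X b v \<in> coboundaries (p + q) X {A, B}"
proof (cases p)
  case 0
  with assms show ?thesis by (simp add: coboundaries_def [of 0] cup_cochain_zero_left)
next
  case (Suc p')
  then obtain a where a: "a \<in> cochains p' X {A}" "b = coboundary p' X a"
    using assms by (auto simp: coboundaries_def)
  have "v \<in> cochains q X {B}" "coboundary q X v = (\<lambda>_. 0)"
    using assms by (auto simp: cocycles_def)
  then have "cup_cochain p q X b v = coboundary (p' + q) X (cup_cochain p' q X a v)"
    "cup_cochain p' q X a v \<in> cochains (p' + q) X {A, B}"
    using a by (auto simp: coboundary_cup_cochain cup_cochain_zero_right Suc cup_cochain_in_cochains)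
  then show ?thesis
    by (auto simp: Suc coboundaries_def)
qed

lemma cup_cochain_coboundary_right:
  assumes "u \<in> cocycles p X {A}" "b \<in> coboundaries q X {B}"
  shows "cup_cochain p q X u b \<in> coboundaries (p + q) X {A, B}"
proof (cases q)
  case 0
  with assms show ?thesis by (simp add: coboundaries_def [of 0] cup_cochain_zero_right)
next
  case (Suc q')
  then obtain a where a: "a \<in> cochains q' X {B}" "b = coboundary q' X a"
    using assms by (auto simp: coboundaries_def)
  have u: "u \<in> cochains p X {A}" "coboundary p X u = (\<lambda>_. 0)"
    using assms by (auto simp: cocycles_def)
  \<comment> \<open>For a cocycle \<open>u\<close> the Leibniz rule leaves the sign (-1)^p in front
    of the product with the coboundary of \<open>a\<close>, so the primitive must carry the same
    sign.\<close>
  have s: "((-1) ^ p :: int) * ((-1) ^ p) = 1"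
    by (simp flip: power_add)
  have c: "cup_cochain p q' X u a \<in> cochains (p + q') X {A, B}"
    using u a by (simp add: cup_cochain_in_cochains)
  then have "(\<lambda>f. (-1) ^ p * cup_cochain p q' X u a f) \<in> cochains (p + q') X {A, B}"
    by (auto simp: cochains_def)
  moreover have "coboundary (p + q') X (\<lambda>f. (-1) ^ p * cup_cochain p q' X u a f)
     = (\<lambda>f. (-1) ^ p * coboundary (p + q') X (cup_cochain p q' X u a) f)"
    by (rule ext) (simp add: coboundary_def sum_distrib_left mult_ac del: sum.atMost_Suc)
  then have "coboundary (p + q') X (\<lambda>f. (-1) ^ p * cup_cochain p q' X u a f) = cup_cochain p q X u b"
    using s by (simp add: coboundary_cup_cochain u cup_cochain_zero_left a Suc flip: mult.assoc)
  ultimately show ?thesis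
    unfolding Suc coboundaries_def by (force intro: image_eqI)
qed

text \<open>Telescoping: u'v' - uv = (u' - u)v' + u(v' - v), and both summands are
  coboundaries.\<close>

lemma cup_cochain_class_cong:
  assumes "u \<in> cocycles p X {A}" "v \<in> cocycles q X {B}"
    and "u' \<in> cohomology_class p X {A} u" "v' \<in> cohomology_class q X {B} v"
  shows "cohomology_class (p + q) X {A, B} (cup_cochain p q X u' v')
       = cohomology_class (p + q) X {A, B} (cup_cochain p q X u v)"
proof -
  have v': "v' \<in> cocycles q X {B}"
    using assms mem_cohomology_class by blast
  have 1: "cup_cochain p q X (\<lambda>f. u' f - u f) v' \<in> coboundaries (p + q) X {A, B}"
    using assms(3) by (intro cup_cochain_coboundary_left v') (simp add: cohomology_class_eq_set)
  have 2: "cup_cochain p q X u (\<lambda>f. v' f - v f) \<in> coboundaries (p + q) X {A, B}"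
    using assms(4) by (intro cup_cochain_coboundary_right assms) (simp add: cohomology_class_eq_set)
  show ?thesis
    using coboundaries_add [OF 1 2]
    by (simp add: cohomology_class_eq_iff cup_cochain_diff_left cup_cochain_diff_right)
qed

text \<open>All members of the defining union coincide, and the index sets are nonempty.\<close>

lemma cup_to_sum_class:
  assumes "u \<in> cocycles p X {A}" "v \<in> cocycles q X {B}"
  shows "cup_to_sum p q X A B (cohomology_class p X {A} u) (cohomology_class q X {B} v)
       = cohomology_class (p + q) X {A, B} (cup_cochain p q X u v)"
proof -
  have "cup_to_sum p q X A B (cohomology_class p X {A} u) (cohomology_class q X {B} v)
     = (\<Union>u'\<in>cohomology_class p X {A} u. \<Union>v'\<in>cohomology_class q X {B} v.
          cohomology_class (p + q) X {A, B} (cup_cochain p q X u v))"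
    unfolding cup_to_sum_def
    by (intro SUP_cong refl cup_cochain_class_cong [OF assms])
  moreover have "cohomology_class p X {A} u \<noteq> {}" "cohomology_class q X {B} v \<noteq> {}"
    using self_mem_cohomology_class by blast+
  ultimately show ?thesis
    by simp
qed

section \<open>Passing from a union of subspaces to the sum of their chain groups\<close>

lemma cochains_sum_subset: "cochains p X {A \<union> B} \<subseteq> cochains p X {A, B}"
  using singular_simplex_mono [of p X A _ "A \<union> B"] singular_simplex_mono [of p X B _ "A \<union> B"]
  by (fastforce simp: cochains_def)

lemma coboundaries_sum_subset: "coboundaries p X {A \<union> B} \<subseteq> coboundaries p X {A, B}"
  using cochains_sum_subset [of _ X A B] by (cases p) (auto simp: coboundaries_def)

lemma cocycles_sum_subset: "cocycles p X {A \<union> B} \<subseteq> cocycles p X {A, B}"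
  using cochains_sum_subset [of _ X A B] by (auto simp: cocycles_def)

lemma restrict_to_sum_class:
  assumes "w \<in> cocycles n X {A \<union> B}"
  shows "restrict_to_sum n X A B (cohomology_class n X {A \<union> B} w) = cohomology_class n X {A, B} w"
proof -
  have "cohomology_class n X {A, B} w' = cohomology_class n X {A, B} w"
    if "w' \<in> cohomology_class n X {A \<union> B} w" for w'
    unfolding cohomology_class_eq_iff
    using that coboundaries_sum_subset [of n X A B] by (auto simp: cohomology_class_eq_set [of n X "{A \<union> B}"])
  then have "restrict_to_sum n X A B (cohomology_class n X {A \<union> B} w)
      = (\<Union>w'\<in>cohomology_class n X {A \<union> B} w. cohomology_class n X {A, B} w)"
    unfolding restrict_to_sum_def by (intro SUP_cong refl)
  moreover have "cohomology_class n X {A \<union> B} w \<noteq> {}"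
    using self_mem_cohomology_class by blast
  ultimately show ?thesis
    by simp
qed

section \<open>Families of singular simplices without relative homology\<close>

abbreviation spanned :: "('b \<Rightarrow>\<^sub>0 int) \<Rightarrow> 'b set \<Rightarrow> bool" where
  "spanned c E \<equiv> Poly_Mapping.keys c \<subseteq> E"

lemma spanned_add: "spanned a E \<Longrightarrow> spanned b E \<Longrightarrow> spanned (a + b) E"
  using keys_add [of a b] by blast

lemma spanned_diff: "spanned a E \<Longrightarrow> spanned b E \<Longrightarrow> spanned (a - b) E"
  using keys_diff [of a b] by blast

lemma spanned_sum: "(\<And>i. i \<in> I \<Longrightarrow> spanned (c i) E) \<Longrightarrow> spanned (sum c I) E"
  using keys_sum [of c I] by blast

lemma spanned_cmul: "spanned a E \<Longrightarrow> spanned (frag_cmul k a) E"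
  by auto

lemma spanned_frag_extend: "(\<And>f. f \<in> Poly_Mapping.keys c \<Longrightarrow> spanned (D f) E) \<Longrightarrow> spanned (frag_extend D c) E"
  using keys_frag_extend [of D c] by blast

lemma spanned_Un:
  assumes "spanned c (E \<union> F)"
  obtains a b where "spanned a E" "spanned b F" "c = a + b"
  by (rule frag_split [OF assms]) (use that in blast)

text \<open>Spans of sets of simplices replace pairs of spaces, so that C(A) + C(B) and the affine
  simplices can be handled exactly like the simplices of a subspace.\<close>

type_synonym 'a simplex_family = "nat \<Rightarrow> ((nat \<Rightarrow> real) \<Rightarrow> 'a) set"

definition face_closed :: "'a simplex_family \<Rightarrow> bool" where
  "face_closed E \<longleftrightarrow> (\<forall>p. \<forall>f\<in>E (Suc p). \<forall>k\<le>Suc p. singular_face (Suc p) k f \<in> E p)"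

lemma face_closedD: "face_closed E \<Longrightarrow> f \<in> E (Suc p) \<Longrightarrow> k \<le> Suc p \<Longrightarrow> singular_face (Suc p) k f \<in> E p"
  by (auto simp: face_closed_def)

lemma face_closed_Un: "face_closed E \<Longrightarrow> face_closed F \<Longrightarrow> face_closed (\<lambda>p. E p \<union> F p)"
  and face_closed_Int: "face_closed E \<Longrightarrow> face_closed F \<Longrightarrow> face_closed (\<lambda>p. E p \<inter> F p)"
  by (auto simp: face_closed_def)

lemma face_closed_singular: "face_closed (\<lambda>p. singular_simplex_set p X)"
  by (auto simp: face_closed_def singular_face_Suc)

lemma spanned_chain_boundary:
  assumes "face_closed E" "spanned c (E (Suc p))"
  shows "spanned (chain_boundary (Suc p) c) (E p)"
  unfolding chain_boundary_def
proof (simp del: sum.atMost_Suc, rule spanned_frag_extend)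
  fix f assume "f \<in> Poly_Mapping.keys c"
  then show "spanned (\<Sum>k\<le>Suc p. frag_cmul ((-1) ^ k) (frag_of (singular_face (Suc p) k f))) (E p)"
    using assms by (intro spanned_sum spanned_cmul) (auto simp: face_closed_def)
qed

text \<open>The quotient of the span of \<open>E\<close> by the span of \<open>F\<close> has no
  homology. The truncated \<open>p - 1\<close> is harmless at 0, where the boundary is 0.\<close>

definition rel_acyclic :: "'a simplex_family \<Rightarrow> 'a simplex_family \<Rightarrow> bool" where
  "rel_acyclic E F \<longleftrightarrow> (\<forall>p c. spanned c (E p) \<and> spanned (chain_boundary p c) (F (p - 1)) \<longrightarrow>
      (\<exists>w. spanned w (E (Suc p)) \<and> spanned (c - chain_boundary (Suc p) w) (F p)))"

lemma rel_acyclicD: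
  assumes "rel_acyclic E F" "spanned c (E p)" "spanned (chain_boundary p c) (F (p - 1))"
  obtains w where "spanned w (E (Suc p))" "spanned (c - chain_boundary (Suc p) w) (F p)"
proof -
  have "\<exists>w. spanned w (E (Suc p)) \<and> spanned (c - chain_boundary (Suc p) w) (F p)"
    using assms(1)[unfolded rel_acyclic_def, rule_format, OF conjI [OF assms(2,3)]] .
  with that show thesis by (elim exE conjE)
qed

text \<open>Triple \<open>G\<close>, \<open>F\<close>, \<open>E\<close>: a relative cycle is first
  pushed into \<open>F\<close> and then, being still a cycle modulo \<open>G\<close>, into
  \<open>G\<close>.\<close>

lemma rel_acyclic_trans:
  assumes "rel_acyclic E F" "rel_acyclic F G" "\<And>p. F p \<subseteq> E p"
    and "face_closed G" "\<And>p. E p \<subseteq> singular_simplex_set p X" "\<And>p. G p \<subseteq> F p"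
  shows "rel_acyclic E G"
  unfolding rel_acyclic_def
proof (intro allI impI, elim conjE)
  fix p c assume c: "spanned c (E p)" "spanned (chain_boundary p c) (G (p - 1))"
  obtain w where w: "spanned w (E (Suc p))" "spanned (c - chain_boundary (Suc p) w) (F p)"
    using rel_acyclicD [OF assms(1) c(1)] c(2) assms(6) by (metis order_trans)
  have "singular_chain (Suc p) X w"
    using w(1) assms(5) unfolding singular_chain_def by blast
  then have "chain_boundary p (c - chain_boundary (Suc p) w) = chain_boundary p c"
    by (simp add: chain_boundary_diff chain_boundary_boundary_alt)
  then obtain w' where w': "spanned w' (F (Suc p))"
    "spanned (c - chain_boundary (Suc p) w - chain_boundary (Suc p) w') (G p)"
    using rel_acyclicD [OF assms(2) w(2)] c(2) by metis
  show "\<exists>w. spanned w (E (Suc p)) \<and> spanned (c - chain_boundary (Suc p) w) (G p)"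
  proof (intro exI conjI)
    show "spanned (w + w') (E (Suc p))"
      by (intro spanned_add w order_trans [OF w'(1) assms(3)])
    show "spanned (c - chain_boundary (Suc p) (w + w')) (G p)"
      using w'(2) by (simp add: chain_boundary_add diff_diff_eq)
  qed
qed

text \<open>The other direction for a triple. The boundary of \<open>c\<close> is a cycle in
  \<open>F\<close>; acyclicity of (\<open>F\<close>, \<open>G\<close>) gives a chain
  \<open>w\<close> of \<open>F\<close> such that the boundary of \<open>c - w\<close> lies in
  \<open>G\<close>, and (\<open>E\<close>, \<open>G\<close>) disposes of
  \<open>c - w\<close>.\<close>

lemma rel_acyclic_middle:
  assumes "rel_acyclic E G" "rel_acyclic F G" "\<And>p. F p \<subseteq> E p"
    and "face_closed F" "\<And>p. E p \<subseteq> singular_simplex_set p X" "\<And>p. G p \<subseteq> F p"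
  shows "rel_acyclic E F"
  unfolding rel_acyclic_def
proof (intro allI impI, elim conjE)
  fix p c assume c: "spanned c (E p)" "spanned (chain_boundary p c) (F (p - 1))"
  have cX: "singular_chain p X c"
    using c(1) assms(5) unfolding singular_chain_def by blast
  obtain w where w: "spanned w (F p)" "spanned (chain_boundary p (c - w)) (G (p - 1))"
  proof (cases p)
    case 0
    show ?thesis
      by (rule that [of 0]) (auto simp: chain_boundary_def 0)
  next
    case (Suc q)
    have "chain_boundary q (chain_boundary (Suc q) c) = 0"
      using cX by (simp add: Suc chain_boundary_boundary_alt)
    then obtain w where w: "spanned w (F (Suc q))"
      "spanned (chain_boundary (Suc q) c - chain_boundary (Suc q) w) (G q)"
      using rel_acyclicD [OF assms(2), of "chain_boundary (Suc q) c" q] c(2) Suc by auto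
    then show ?thesis
      using that by (simp add: Suc chain_boundary_diff)
  qed
  have "spanned (c - w) (E p)"
    using c(1) w(1) assms(3) by (intro spanned_diff) blast+
  then obtain w' where w': "spanned w' (E (Suc p))" "spanned (c - w - chain_boundary (Suc p) w') (G p)"
    using rel_acyclicD [OF assms(1) _ w(2)] by metis
  then have "spanned (c - w - chain_boundary (Suc p) w' + w) (F p)"
    using w(1) assms(6) by (intro spanned_add) blast+
  then show "\<exists>w. spanned w (E (Suc p)) \<and> spanned (c - chain_boundary (Suc p) w) (F p)"
    using w'(1) by (auto simp: algebra_simps)
qed

text \<open>For spans of basis sets the quotient of \<open>E \<union> F\<close> by \<open>F\<close>
  is the quotient of \<open>E\<close> by \<open>E \<inter> F\<close>, so no subdivision is
  involved.\<close>

lemma rel_acyclic_excision: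
  assumes "rel_acyclic E (\<lambda>p. E p \<inter> F p)" "face_closed E" "face_closed F"
  shows "rel_acyclic (\<lambda>p. E p \<union> F p) F"
  unfolding rel_acyclic_def
proof (intro allI impI, elim conjE)
  fix p c assume c: "spanned c (E p \<union> F p)" "spanned (chain_boundary p c) (F (p - 1))"
  then obtain a b where ab: "spanned a (E p)" "spanned b (F p)" "c = a + b"
    by (elim spanned_Un)
  have "spanned (chain_boundary p a) (E (p - 1) \<inter> F (p - 1))"
  proof (cases p)
    case 0
    then show ?thesis by (simp add: chain_boundary_def)
  next
    case (Suc q)
    have "spanned (chain_boundary p c - chain_boundary p b) (F q)"
      using c(2) ab(2) spanned_chain_boundary [OF assms(3), of b q] Suc by (intro spanned_diff) auto
    then show ?thesis
      using spanned_chain_boundary [OF assms(2), of a q] ab Suc by (simp add: chain_boundary_add)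
  qed
  then obtain w where w: "spanned w (E (Suc p))" "spanned (a - chain_boundary (Suc p) w) (E p \<inter> F p)"
    using rel_acyclicD [OF assms(1) ab(1)] by metis
  then have "spanned (a - chain_boundary (Suc p) w + b) (F p)"
    using ab(2) by (intro spanned_add) auto
  then show "\<exists>w. spanned w (E (Suc p) \<union> F (Suc p)) \<and> spanned (c - chain_boundary (Suc p) w) (F p)"
    using w(1) ab(3) by (auto simp: algebra_simps)
qed

text \<open>Freeness of the chain groups turns vanishing homology into a contraction of the chain complex,
  built degree by degree on the basis of simplices.\<close>

lemma rel_acyclic_contraction:
  assumes acyc: "rel_acyclic E F" and E: "face_closed E" and F: "face_closed F"
    and FE: "\<And>p. F p \<subseteq> E p" and X: "\<And>p. E p \<subseteq> singular_simplex_set p X"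
  obtains D where "\<And>p f. f \<in> E p \<Longrightarrow> spanned (D p f) (E (Suc p))"
    and "\<And>p f. f \<in> F p \<Longrightarrow> D p f = 0"
    and "\<And>p f. f \<in> E p \<Longrightarrow> spanned (frag_of f - chain_boundary (Suc p) (D p f)
            - frag_extend (D (p - 1)) (chain_boundary p (frag_of f))) (F p)"
proof -
  define P where "P p D \<longleftrightarrow> (\<forall>f\<in>E p. spanned (D f) (E (Suc p))) \<and> (\<forall>f\<in>F p. D f = 0)"
    for p and D :: "((nat \<Rightarrow> real) \<Rightarrow> 'a) \<Rightarrow> 'a chain"
  define Q where "Q p D' D \<longleftrightarrow> (\<forall>f\<in>E p. spanned (frag_of f - chain_boundary (Suc p) (D f)
            - frag_extend D' (chain_boundary p (frag_of f))) (F p))"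
    for p and D' D :: "((nat \<Rightarrow> real) \<Rightarrow> 'a) \<Rightarrow> 'a chain"
  have extend: "\<exists>D. P p D \<and> Q p D' D"
    if cyc: "\<And>f. f \<in> E p \<Longrightarrow> spanned (chain_boundary p (frag_of f - frag_extend D' (chain_boundary p (frag_of f)))) (F (p - 1))"
      and span: "\<And>f. f \<in> E p \<Longrightarrow> spanned (frag_extend D' (chain_boundary p (frag_of f))) (E p)"
      and zero: "\<And>f. f \<in> F p \<Longrightarrow> frag_extend D' (chain_boundary p (frag_of f)) = 0"
    for p D'
  proof -
    have "\<exists>w. spanned w (E (Suc p)) \<and> (f \<in> F p \<longrightarrow> w = 0)
       \<and> spanned (frag_of f - chain_boundary (Suc p) w - frag_extend D' (chain_boundary p (frag_of f))) (F p)"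
      if f: "f \<in> E p" for f
    proof (cases "f \<in> F p")
      case True
      then show ?thesis
        by (intro exI [of _ 0]) (simp add: zero)
    next
      case False
      have "spanned (frag_of f - frag_extend D' (chain_boundary p (frag_of f))) (E p)"
        using f span by (intro spanned_diff) auto
      then obtain w where "spanned w (E (Suc p))"
        "spanned (frag_of f - frag_extend D' (chain_boundary p (frag_of f)) - chain_boundary (Suc p) w) (F p)"
        using rel_acyclicD [OF acyc _ cyc [OF f]] by metis
      with False show ?thesis
        by (auto simp: algebra_simps)
    qed
    then obtain D where "\<And>f. f \<in> E p \<Longrightarrow> spanned (D f) (E (Suc p)) \<and> (f \<in> F p \<longrightarrow> D f = 0)
       \<and> spanned (frag_of f - chain_boundary (Suc p) (D f) - frag_extend D' (chain_boundary p (frag_of f))) (F p)"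
      by metis
    then show ?thesis
      using FE [of p] by (intro exI [of _ D]) (auto simp: P_def Q_def)
  qed
  \<comment> \<open>The homotopy identity in degree \<open>p\<close>, kept as an existential in the
    invariant, is what makes the defect in degree \<open>Suc p\<close> a relative cycle.\<close>
  have step: "\<exists>D. P (Suc p) D \<and> Q (Suc p) D' D"
    if D': "P p D' \<and> (\<exists>D''. Q p D'' D')" for p D'
  proof -
    obtain D'' where Q: "Q p D'' D'" and P: "P p D'"
      using D' by blast
    have *: "spanned (c - chain_boundary (Suc p) (frag_extend D' c) - frag_extend D'' (chain_boundary p c)) (F p)"
      if "spanned c (E p)" for c
      using that
    proof (induction rule: frag_induction)
      case (diff a b)
      then show ?case
        using spanned_diff [OF diff]
        by (simp add: frag_extend_diff chain_boundary_diff algebra_simps)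
    qed (use Q in \<open>auto simp: Q_def\<close>)
    have "\<exists>D. P (Suc p) D \<and> Q (Suc p) D' D"
    proof (rule extend)
      fix f assume f: "f \<in> E (Suc p)"
      have b: "spanned (chain_boundary (Suc p) (frag_of f)) (E p)"
        by (rule spanned_chain_boundary [OF E]) (use f in auto)
      then show "spanned (frag_extend D' (chain_boundary (Suc p) (frag_of f))) (E (Suc p))"
        using P by (intro spanned_frag_extend) (auto simp: P_def)
      have "singular_chain (Suc p) X (frag_of f)"
        using f X by (auto simp: singular_chain_of)
      then have "chain_boundary p (chain_boundary (Suc p) (frag_of f)) = 0"
        by (rule chain_boundary_boundary_alt)
      with * [OF b] show "spanned (chain_boundary (Suc p) (frag_of f
          - frag_extend D' (chain_boundary (Suc p) (frag_of f)))) (F (Suc p - 1))"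
        by (simp add: chain_boundary_diff)
    next
      fix f assume f: "f \<in> F (Suc p)"
      have "spanned (chain_boundary (Suc p) (frag_of f)) (F p)"
        by (rule spanned_chain_boundary [OF F]) (use f in auto)
      then show "frag_extend D' (chain_boundary (Suc p) (frag_of f)) = 0"
        using P by (intro frag_extend_eq_0) (auto simp: P_def)
    qed
    then show ?thesis by blast
  qed
  \<comment> \<open>There is no map below degree 0; the zero map stands in for it, since the
    boundary vanishes there.\<close>
  have "\<exists>D. P 0 D \<and> Q 0 (\<lambda>_. 0) D"
    by (rule extend) (auto simp: chain_boundary_def)
  then have base: "\<exists>D. P 0 D \<and> (\<exists>D''. Q 0 D'' D)"
    by blast
  have "\<exists>D. \<forall>p. (P p (D p) \<and> (\<exists>D''. Q p D'' (D p))) \<and> Q (Suc p) (D p) (D (Suc p))"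
  proof (rule dependent_nat_choice)
    show "\<exists>D. P 0 D \<and> (\<exists>D''. Q 0 D'' D)"
      using base by blast
    fix D' p assume "P p D' \<and> (\<exists>D''. Q p D'' D')"
    then obtain D where "P (Suc p) D" "Q (Suc p) D' D"
      using step by blast
    then show "\<exists>D. (P (Suc p) D \<and> (\<exists>D''. Q (Suc p) D'' D)) \<and> Q (Suc p) D' D"
      by blast
  qed
  then obtain D where D: "\<And>p. P p (D p) \<and> (\<exists>D''. Q p D'' (D p))" "\<And>p. Q (Suc p) (D p) (D (Suc p))"
    by metis
  show thesis
  proof
    fix p f assume f: "f \<in> E p"
    show "spanned (D p f) (E (Suc p))"
      using D(1) f by (auto simp: P_def)
    show "spanned (frag_of f - chain_boundary (Suc p) (D p f)
            - frag_extend (D (p - 1)) (chain_boundary p (frag_of f))) (F p)"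
    proof (cases p)
      case 0
      then show ?thesis
        using D(1) [of 0] f by (auto simp: Q_def chain_boundary_def)
    next
      case (Suc q)
      then show ?thesis
        using D(2) [of q] f by (auto simp: Q_def)
    qed
  next
    show "D p f = 0" if "f \<in> F p" for p f
      using D(1) that by (auto simp: P_def)
  qed
qed

text \<open>Dual of the contraction \<open>D\<close>. Modulo \<open>F\<close>, a simplex f is the
  boundary of \<open>D\<close> f plus \<open>D\<close> applied to the boundary of f. A cocycle kills
  the first term and \<open>u\<close> kills \<open>F\<close>, so \<open>u\<close> is the coboundary
  of its composite with \<open>D\<close>. That composite vanishes on \<open>F\<close> because
  \<open>D\<close> does.\<close>

lemma cocycle_vanishing_on_acyclic:
  assumes acyc: "rel_acyclic (\<lambda>p. singular_simplex_set p X) F" and F: "face_closed F"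
    and FX: "\<And>p. F p \<subseteq> singular_simplex_set p X"
    and u: "u \<in> cochains p X {}" "coboundary p X u = (\<lambda>_. 0)" "\<And>f. f \<in> F p \<Longrightarrow> u f = 0"
  shows "(p = 0 \<and> u = (\<lambda>_. 0)) \<or>
    (\<exists>q v. p = Suc q \<and> v \<in> cochains q X {} \<and> (\<forall>f\<in>F q. v f = 0) \<and> coboundary q X v = u)"
proof -
  obtain D where D: "\<And>p f. f \<in> singular_simplex_set p X \<Longrightarrow> spanned (D p f) (singular_simplex_set (Suc p) X)"
    and D0: "\<And>p f. f \<in> F p \<Longrightarrow> D p f = 0"
    and DF: "\<And>p f. f \<in> singular_simplex_set p X \<Longrightarrow> spanned (frag_of f - chain_boundary (Suc p) (D p f)
            - frag_extend (D (p - 1)) (chain_boundary p (frag_of f))) (F p)"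
    by (rule rel_acyclic_contraction [OF acyc face_closed_singular F FX subset_refl]) (rule that)
  have eval: "u f = cochain_eval u (frag_extend (D (p - 1)) (chain_boundary p (frag_of f)))"
    if f: "singular_simplex p X f" for f
  proof -
    have "singular_chain (Suc p) X (D p f)"
      using D f by (simp add: singular_chain_def)
    then have "cochain_eval u (chain_boundary (Suc p) (D p f)) = 0"
      using cochain_eval_coboundary [of p X "D p f" u] u(2) by (simp add: cochain_eval_vanish)
    moreover have "cochain_eval u (frag_of f - chain_boundary (Suc p) (D p f)
            - frag_extend (D (p - 1)) (chain_boundary p (frag_of f))) = 0"
      using DF [of f p] f u(3) by (intro cochain_eval_vanish) auto
    ultimately show ?thesis
      by (simp add: cochain_eval_diff)
  qed
  have un: "u f = 0" if "\<not> singular_simplex p X f" for f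
    using u(1) that by (simp add: cochains_def)
  show ?thesis
  proof (cases p)
    case 0
    have "u f = 0" for f
      using eval [of f] un [of f] by (auto simp: 0 chain_boundary_def)
    then show ?thesis
      by (auto simp: 0)
  next
    case (Suc q)
    define v where "v f = (if singular_simplex q X f then cochain_eval u (D q f) else 0)" for f
    have "v \<in> cochains q X {}"
      by (simp add: cochains_def v_def)
    moreover have "\<forall>f\<in>F q. v f = 0"
      by (simp add: v_def D0)
    moreover have "coboundary q X v f = u f" for f
    proof (cases "singular_simplex (Suc q) X f")
      case True
      then have "singular_chain q X (chain_boundary (Suc q) (frag_of f))"
        by (simp add: singular_chain_boundary_alt singular_chain_of)
      then have "cochain_eval v (chain_boundary (Suc q) (frag_of f))
           = cochain_eval (\<lambda>g. cochain_eval u (D q g)) (chain_boundary (Suc q) (frag_of f))"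
        by (intro cochain_eval_cong) (auto simp: v_def singular_chain_def)
      then show ?thesis
        using True eval [of f]
        by (simp add: Suc coboundary_eq_eval cochain_eval_frag_extend)
    qed (use un [of f] in \<open>simp add: Suc coboundary_def\<close>)
    ultimately show ?thesis
      unfolding Suc by blast
  qed
qed

section \<open>Chains of vertex lists\<close>

definition drop_nth :: "nat \<Rightarrow> 'v list \<Rightarrow> 'v list" where
  "drop_nth k xs = take k xs @ drop (Suc k) xs"

lemma length_drop_nth [simp]: "k < length xs \<Longrightarrow> length (drop_nth k xs) = length xs - 1"
  by (simp add: drop_nth_def)

lemma nth_drop_nth:
  "k < length xs \<Longrightarrow> i < length xs - 1 \<Longrightarrow> drop_nth k xs ! i = (if i < k then xs ! i else xs ! Suc i)"
  by (simp add: drop_nth_def nth_append min_def)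

lemma set_drop_nth: "set (drop_nth k xs) \<subseteq> set xs"
  using set_take_subset [of k xs] set_drop_subset [of "Suc k" xs] by (auto simp: drop_nth_def)

lemma drop_nth_0 [simp]: "drop_nth 0 (a # xs) = xs"
  and drop_nth_Suc [simp]: "drop_nth (Suc k) (a # xs) = a # drop_nth k xs"
  by (simp_all add: drop_nth_def)

lemma map_drop_nth: "map f (drop_nth k xs) = drop_nth k (map f xs)"
  by (simp add: drop_nth_def take_map drop_map)

text \<open>The boundary is augmented: the empty list generates the chains of degree \<open>-1\<close>.\<close>

definition list_boundary :: "('v list \<Rightarrow>\<^sub>0 int) \<Rightarrow> 'v list \<Rightarrow>\<^sub>0 int" where
  "list_boundary = frag_extend (\<lambda>xs. \<Sum>k<length xs. frag_cmul ((-1) ^ k) (frag_of (drop_nth k xs)))"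

definition list_cone :: "'v \<Rightarrow> ('v list \<Rightarrow>\<^sub>0 int) \<Rightarrow> 'v list \<Rightarrow>\<^sub>0 int" where
  "list_cone a = frag_extend (\<lambda>xs. frag_of (a # xs))"

lemma list_boundary_of:
  "list_boundary (frag_of xs) = (\<Sum>k<length xs. frag_cmul ((-1) ^ k) (frag_of (drop_nth k xs)))"
  by (simp add: list_boundary_def)

lemma list_boundary_diff: "list_boundary (a - b) = list_boundary a - list_boundary b"
  by (simp add: list_boundary_def frag_extend_diff)

lemma list_boundary_add: "list_boundary (a + b) = list_boundary a + list_boundary b"
  by (simp add: list_boundary_def frag_extend_add)

lemma list_boundary_0 [simp]: "list_boundary 0 = 0"
  by (simp add: list_boundary_def)

lemma list_cone_diff: "list_cone v (a - b) = list_cone v a - list_cone v b"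
  by (simp add: list_cone_def frag_extend_diff)

lemma list_cone_0 [simp]: "list_cone v 0 = 0"
  by (simp add: list_cone_def)

text \<open>Thanks to the augmentation this includes \<open>xs = []\<close>: the boundary of a
  one-point list is \<open>[]\<close> and that of \<open>[]\<close> is 0.\<close>

lemma list_boundary_cone_of: "list_boundary (frag_of (a # xs)) = frag_of xs - list_cone a (list_boundary (frag_of xs))"
proof -
  have "list_cone a (list_boundary (frag_of xs))
      = (\<Sum>k<length xs. frag_cmul ((-1) ^ k) (frag_of (a # drop_nth k xs)))"
    by (simp add: list_cone_def list_boundary_of frag_extend_sum frag_extend_cmul o_def)
  then show ?thesis
    by (simp add: list_boundary_of sum.lessThan_Suc_shift del: sum.lessThan_Suc flip: sum_negf)
qed

lemma list_boundary_cone: "list_boundary (list_cone a c) = c - list_cone a (list_boundary c)"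
proof -
  have "spanned c UNIV" by simp
  then show ?thesis
  proof (induction rule: frag_induction)
    case (one xs)
    then show ?case
      using list_boundary_cone_of [of a xs] by (simp add: list_cone_def)
  qed (simp_all add: list_boundary_diff list_cone_diff)
qed

text \<open>By the cone formula, the double boundary of \<open>a # xs\<close> is the cone on the
  double boundary of \<open>xs\<close>.\<close>

lemma list_boundary_boundary: "list_boundary (list_boundary c) = 0"
proof -
  have *: "list_boundary (list_boundary (frag_of xs)) = 0" for xs :: "'a list"
  proof (induction xs)
    case Nil
    then show ?case by (simp add: list_boundary_of)
  next
    case (Cons a xs)
    then show ?case
      by (simp add: list_boundary_cone_of list_boundary_diff list_boundary_cone)
  qed
  have "spanned c UNIV" by simp
  then show ?thesis
    by (induction rule: frag_induction) (simp_all add: * list_boundary_diff)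
qed

lemma spanned_list_boundary:
  assumes "spanned c {xs. length xs = Suc n \<and> set xs \<in> L}" "\<And>\<tau> \<rho>. \<tau> \<in> L \<Longrightarrow> \<rho> \<subseteq> \<tau> \<Longrightarrow> \<rho> \<in> L"
  shows "spanned (list_boundary c) {xs. length xs = n \<and> set xs \<in> L}"
  unfolding list_boundary_def
proof (rule spanned_frag_extend, rule spanned_sum, rule spanned_cmul)
  fix xs k assume "xs \<in> Poly_Mapping.keys c" "k \<in> {..<length xs}"
  then show "spanned (frag_of (drop_nth k xs)) {xs. length xs = n \<and> set xs \<in> L}"
    using assms set_drop_nth [of k xs] by auto
qed

text \<open>Acyclic carriers: lists in \<open>M \<tau>\<close> can be coned off from \<open>apex \<tau>\<close>.\<close>

locale cone_carrier =
  fixes L :: "'v set set" and M :: "'v set \<Rightarrow> 'v set" and apex :: "'v set \<Rightarrow> 'v"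
  assumes down: "\<tau> \<in> L \<Longrightarrow> \<rho> \<subseteq> \<tau> \<Longrightarrow> \<rho> \<in> L"
    and M_refl: "\<tau> \<in> L \<Longrightarrow> \<tau> \<noteq> {} \<Longrightarrow> \<tau> \<subseteq> M \<tau>"
    and M_mono: "\<tau> \<in> L \<Longrightarrow> \<rho> \<subseteq> \<tau> \<Longrightarrow> \<rho> \<noteq> {} \<Longrightarrow> M \<rho> \<subseteq> M \<tau>"
    and apex_in: "\<tau> \<in> L \<Longrightarrow> \<tau> \<noteq> {} \<Longrightarrow> apex \<tau> \<in> M \<tau>"
    and apex_join: "\<tau> \<in> L \<Longrightarrow> \<tau> \<noteq> {} \<Longrightarrow> \<rho> \<in> L \<Longrightarrow> \<rho> \<subseteq> M \<tau> \<Longrightarrow> insert (apex \<tau>) \<rho> \<in> L"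
begin

text \<open>Acyclic carriers with explicit fillings: the defect
  \<open>xs - \<alpha> xs - D (boundary of xs)\<close> is a cycle carried by
  \<open>M (set xs)\<close>, so coning it from the apex bounds it. Only lists of length at most
  \<open>n\<close> are constrained, because \<open>\<alpha>\<close> will come from a number of
  subdivisions chosen for finitely many lists.\<close>

lemma carried_chain_map_homotopic:
  fixes \<alpha> :: "'v list \<Rightarrow> ('v list \<Rightarrow>\<^sub>0 int)"
  assumes \<alpha>_Nil: "\<alpha> [] = frag_of []"
    and \<alpha>_carried: "\<And>xs. xs \<noteq> [] \<Longrightarrow> length xs \<le> n \<Longrightarrow> set xs \<in> L
        \<Longrightarrow> spanned (\<alpha> xs) {ys. length ys = length xs \<and> set ys \<in> L \<and> set ys \<subseteq> M (set xs)}"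
    and \<alpha>_boundary: "\<And>xs. xs \<noteq> [] \<Longrightarrow> length xs \<le> n \<Longrightarrow> set xs \<in> L
        \<Longrightarrow> list_boundary (\<alpha> xs) = frag_extend \<alpha> (list_boundary (frag_of xs))"
    and z: "spanned z {xs. length xs = n \<and> set xs \<in> L}" "list_boundary z = 0"
  obtains y where "spanned y {xs. length xs = Suc n \<and> set xs \<in> L}"
    "list_boundary y = z - frag_extend \<alpha> z"
proof -
  \<comment> \<open>Indexed by list length. The start value 0 is right because
    \<open>\<alpha>\<close> fixes the empty list.\<close>
  define D where "D = rec_nat (\<lambda>xs. 0) (\<lambda>k D' xs. list_cone (apex (set xs))
      (frag_of xs - \<alpha> xs - frag_extend D' (list_boundary (frag_of xs))))"
  have D0: "D 0 = (\<lambda>xs. 0)"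
    and DSuc: "D (Suc k) = (\<lambda>xs. list_cone (apex (set xs))
      (frag_of xs - \<alpha> xs - frag_extend (D k) (list_boundary (frag_of xs))))" for k
    by (simp_all add: D_def)
  let ?L = "\<lambda>k. {xs. length xs = k \<and> set xs \<in> L}"
  have D: "(\<forall>xs\<in>?L k. spanned (D k xs) {ys. length ys = Suc k \<and> set ys \<in> L \<and> set ys \<subseteq> M (set xs)})
     \<and> (\<forall>c. spanned c (?L k) \<longrightarrow> list_boundary (frag_extend (D k) c)
           = c - frag_extend \<alpha> c - frag_extend (D (k - 1)) (list_boundary c))"
    if "k \<le> n" for k
    using that
  proof (induction k)
    case 0
    have "frag_extend \<alpha> c = c" if "spanned c (?L 0)" for c
      using that by (induction rule: frag_induction) (auto simp: \<alpha>_Nil frag_extend_diff)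
    then show ?case by (simp add: D0 frag_extend_eq_0)
  next
    case (Suc k)
    note IH = Suc.IH [OF Suc_leD [OF Suc.prems]]
    have main: "spanned (D (Suc k) xs) {ys. length ys = Suc (Suc k) \<and> set ys \<in> L \<and> set ys \<subseteq> M (set xs)}
      \<and> list_boundary (D (Suc k) xs) = frag_of xs - \<alpha> xs - frag_extend (D k) (list_boundary (frag_of xs))"
      if xs: "length xs = Suc k" "set xs \<in> L" for xs
    proof
      have ne: "xs \<noteq> []" "set xs \<noteq> {}" using xs by auto
      let ?S = "{ys. length ys = Suc k \<and> set ys \<in> L \<and> set ys \<subseteq> M (set xs)}"
      let ?I = "frag_of xs - \<alpha> xs - frag_extend (D k) (list_boundary (frag_of xs))"
      have B: "spanned (list_boundary (frag_of xs)) (?L k)"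
        by (rule spanned_list_boundary) (use xs down in auto)
      have "spanned (D k ys) ?S" if "ys \<in> Poly_Mapping.keys (list_boundary (frag_of xs))" for ys
      \<comment> \<open>Carriers are monotone only for nonempty faces; the empty face occurs just
        for \<open>k = 0\<close>, where the homotopy is 0.\<close>
      proof (cases k)
        case 0
        then show ?thesis by (simp add: D0)
      next
        case (Suc k')
        have "Poly_Mapping.keys (list_boundary (frag_of xs)) \<subseteq> {ys. set ys \<subseteq> set xs}"
          unfolding list_boundary_of
          by (intro spanned_sum spanned_cmul) (use set_drop_nth [of _ xs] in \<open>simp add: subset_iff\<close>)
        then have ys: "length ys = k" "set ys \<in> L" "set ys \<subseteq> set xs"
          using B that by auto
        then have "M (set ys) \<subseteq> M (set xs)"
          using xs Suc by (intro M_mono) auto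
        then show ?thesis
          using IH ys by fastforce
      qed
      then have "spanned ?I ?S"
        using xs Suc.prems \<alpha>_carried [OF ne(1)] M_refl [OF xs(2) ne(2)]
        by (intro spanned_diff spanned_frag_extend) auto
      then show "spanned (D (Suc k) xs) {ys. length ys = Suc (Suc k) \<and> set ys \<in> L \<and> set ys \<subseteq> M (set xs)}"
        unfolding DSuc list_cone_def using apex_in [OF xs(2) ne(2)] apex_join [OF xs(2) ne(2)]
        by (intro spanned_frag_extend) auto
      have "list_boundary ?I = 0"
        using IH B Suc.prems xs
        by (simp add: list_boundary_diff \<alpha>_boundary [OF ne(1)] list_boundary_boundary)
      then show "list_boundary (D (Suc k) xs) = ?I"
        by (simp add: DSuc list_boundary_cone)
    qed
    have "list_boundary (frag_extend (D (Suc k)) c)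
           = c - frag_extend \<alpha> c - frag_extend (D k) (list_boundary c)" if "spanned c (?L (Suc k))" for c
      using that
    proof (induction rule: frag_induction)
      case (one xs)
      then show ?case using main [of xs] by simp
    qed (simp_all add: frag_extend_diff list_boundary_diff)
    with main show ?case by simp
  qed
  show thesis
  proof
    show "spanned (frag_extend (D n) z) {xs. length xs = Suc n \<and> set xs \<in> L}"
      using z D [of n] by (intro spanned_frag_extend) fastforce
    show "list_boundary (frag_extend (D n) z) = z - frag_extend \<alpha> z"
      using z D [of n] by simp
  qed
qed

end

section \<open>Acyclic carriers for singular simplices\<close>

text \<open>The contraction makes \<open>c\<close> homologous to its image under a constant map. In
  positive degree that image bounds by the homology of a point; in degree 0 it is the augmentation
  of \<open>c\<close> times a simplex, hence 0.\<close>

lemma contractible_cycle_is_boundary: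
  assumes hom: "homotopic_with (\<lambda>_. True) X X id (\<lambda>_. a)" and a: "a \<in> topspace X"
    and c: "singular_chain p X c" "chain_boundary p c = 0"
    and aug: "p = 0 \<Longrightarrow> cochain_eval (\<lambda>_. 1) c = 0"
  obtains w where "singular_chain (Suc p) X w" "chain_boundary (Suc p) w = c"
proof -
  have cyc: "singular_relcycle p X {} c"
    using c by (simp add: singular_cycle)
  have "homotopic_with (\<lambda>h. h \<in> {} \<rightarrow> {}) X X id (\<lambda>_. a)"
    using hom by simp
  from homotopic_imp_homologous_rel_chain_maps [OF this cyc]
  have 1: "homologous_rel p X {} (chain_map p id c) (chain_map p (\<lambda>_. a) c)" .
  have "singular_relboundary p X {} (chain_map p (\<lambda>_. a) c)"
  proof (cases "p = 0")
    case True
    have "chain_map p (\<lambda>_. a) c = frag_cmul (cochain_eval (\<lambda>_. 1) c) (frag_of (\<lambda>x\<in>standard_simplex p. a))"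
    proof -
      have "spanned c UNIV" by simp
      then show ?thesis
        by (induction rule: frag_induction)
           (auto simp: chain_map_diff cochain_eval_diff frag_cmul_diff_distrib simplex_map_def o_def restrict_def)
    qed
    with aug True show ?thesis by simp
  next
    case False
    have "singular_relcycle p (subtopology X {a}) {} (chain_map p (\<lambda>_. a) c)"
      by (rule singular_relcycle_chain_map [OF cyc]) (use a in \<open>auto simp: continuous_map_in_subtopology\<close>)
    moreover have "topspace (subtopology X {a}) = {a}"
      using a by auto
    ultimately have "singular_relboundary p (subtopology X {a}) {} (chain_map p (\<lambda>_. a) c)"
      using singular_boundary_eq_cycle_singleton [of "subtopology X {a}" a p] False by auto
    then show ?thesis
      using singular_boundary_mono [of "{a}" "topspace X" p X] a by simp
  qed
  moreover have "chain_map p id c = c"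
    by (rule chain_map_id_gen [OF c(1)]) auto
  ultimately have "singular_relboundary p X {} c"
    using 1 singular_relboundary_add [of p X "{}" "c - chain_map p (\<lambda>_. a) c" "chain_map p (\<lambda>_. a) c"]
    by (simp add: homologous_rel_def)
  then show thesis
    using that by (auto simp: singular_boundary)
qed

lemma eval_one_boundary: "cochain_eval (\<lambda>_. 1) (chain_boundary (Suc 0) c) = 0"
proof -
  have "spanned c UNIV" by simp
  then show ?thesis
    by (induction rule: frag_induction)
       (auto simp: chain_boundary_of cochain_eval_add cochain_eval_minus cochain_eval_cmul chain_boundary_diff cochain_eval_diff)
qed

lemma eval_one_frag_extend: "cochain_eval (\<lambda>_. 1) (frag_extend (\<lambda>x. frag_of (h x)) c) = cochain_eval (\<lambda>_. 1) c"
  by (simp add: cochain_eval_frag_extend)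

text \<open>Acyclic carriers for singular simplices: \<open>f\<close> and \<open>\<psi> p f\<close>
  lie in the same acyclic subspace \<open>Z p f\<close>, so a homotopy from the identity to
  \<open>\<psi>\<close> can be chosen simplex by simplex.\<close>

lemma carried_simplex_map_homologous:
  fixes E :: "'a simplex_family" and \<psi> :: "nat \<Rightarrow> ((nat \<Rightarrow> real) \<Rightarrow> 'a) \<Rightarrow> (nat \<Rightarrow> real) \<Rightarrow> 'a"
  assumes E: "face_closed E" and EX: "\<And>p. E p \<subseteq> singular_simplex_set p X"
    and f_in: "\<And>p f. f \<in> E p \<Longrightarrow> singular_simplex p (subtopology X (Z p f)) f"
    and \<psi>_in: "\<And>p f. f \<in> E p \<Longrightarrow> singular_simplex p (subtopology X (Z p f)) (\<psi> p f)"
    and \<psi>_face: "\<And>p f k. f \<in> E (Suc p) \<Longrightarrow> k \<le> Suc p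
        \<Longrightarrow> \<psi> p (singular_face (Suc p) k f) = singular_face (Suc p) k (\<psi> (Suc p) f)"
    and Z_face: "\<And>p f k. f \<in> E (Suc p) \<Longrightarrow> k \<le> Suc p \<Longrightarrow> Z p (singular_face (Suc p) k f) \<subseteq> Z (Suc p) f"
    and Z_acyclic: "\<And>p f c. f \<in> E p \<Longrightarrow> singular_chain p (subtopology X (Z p f)) c \<Longrightarrow> chain_boundary p c = 0
        \<Longrightarrow> (p = 0 \<Longrightarrow> cochain_eval (\<lambda>_. 1) c = 0)
        \<Longrightarrow> \<exists>w. singular_chain (Suc p) (subtopology X (Z p f)) w \<and> chain_boundary (Suc p) w = c"
    and c: "spanned c (E p)" "chain_boundary p c = 0"
  obtains w where "singular_chain (Suc p) X w" "chain_boundary (Suc p) w = c - frag_extend (\<lambda>f. frag_of (\<psi> p f)) c"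
proof -
  let ?\<psi> = "\<lambda>p. frag_extend (\<lambda>f. frag_of (\<psi> p f))"
  define pick where "pick p D' f = (SOME w. singular_chain (Suc p) (subtopology X (Z p f)) w \<and>
      chain_boundary (Suc p) w = frag_of f - frag_of (\<psi> p f) - frag_extend D' (chain_boundary p (frag_of f)))"
    for p and D' :: "((nat \<Rightarrow> real) \<Rightarrow> 'a) \<Rightarrow> 'a chain" and f
  \<comment> \<open>The recursion chooses blindly. That fillings exist is shown afterwards by
    induction, since it depends on the carriers and boundaries of the previous stage.\<close>
  define D where "D = rec_nat (pick 0 (\<lambda>_. 0)) (\<lambda>k D'. pick (Suc k) D')"
  have D_0: "D 0 = pick 0 (\<lambda>_. 0)" and D_Suc: "D (Suc k) = pick (Suc k) (D k)" for k
    by (simp_all add: D_def)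
  have \<psi>_boundary: "?\<psi> p (chain_boundary (Suc p) b) = chain_boundary (Suc p) (?\<psi> (Suc p) b)"
    if "spanned b (E (Suc p))" for p b
    using that
  proof (induction rule: frag_induction)
    case (one f)
    then show ?case
      by (simp add: chain_boundary_of frag_extend_sum frag_extend_cmul \<psi>_face o_def del: sum.atMost_Suc)
  qed (simp_all add: chain_boundary_diff frag_extend_diff)
  have lin: "chain_boundary (Suc p) (frag_extend (D p) b) = b - ?\<psi> p b - frag_extend (D (p - 1)) (chain_boundary p b)"
    if "\<And>f. f \<in> E p \<Longrightarrow> chain_boundary (Suc p) (D p f)
        = frag_of f - frag_of (\<psi> p f) - frag_extend (D (p - 1)) (chain_boundary p (frag_of f))"
      and "spanned b (E p)" for p b
    using that(2) by (induction rule: frag_induction) (simp_all add: that(1) chain_boundary_diff frag_extend_diff)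
  have D: "\<forall>f\<in>E p. singular_chain (Suc p) (subtopology X (Z p f)) (D p f) \<and> chain_boundary (Suc p) (D p f)
        = frag_of f - frag_of (\<psi> p f) - frag_extend (D (p - 1)) (chain_boundary p (frag_of f))" for p
  proof (induction p)
    case 0
    show ?case
    proof
      fix f assume f: "f \<in> E 0"
      \<comment> \<open>Both 0-simplices have augmentation 1, so their difference meets the
        condition in degree 0.\<close>
      have "\<exists>w. singular_chain (Suc 0) (subtopology X (Z 0 f)) w \<and> chain_boundary (Suc 0) w = frag_of f - frag_of (\<psi> 0 f)"
      proof (rule Z_acyclic [OF f])
        show "singular_chain 0 (subtopology X (Z 0 f)) (frag_of f - frag_of (\<psi> 0 f))"
          by (intro singular_chain_diff) (use f_in \<psi>_in f in \<open>auto simp: singular_chain_of\<close>)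
      qed (auto simp: chain_boundary_def cochain_eval_diff)
      from someI_ex [OF this]
      show "singular_chain (Suc 0) (subtopology X (Z 0 f)) (D 0 f) \<and> chain_boundary (Suc 0) (D 0 f)
        = frag_of f - frag_of (\<psi> 0 f) - frag_extend (D (0 - 1)) (chain_boundary 0 (frag_of f))"
        unfolding D_0 pick_def by (simp add: chain_boundary_def)
    qed
  next
    case (Suc p)
    show ?case
    proof
      fix f assume f: "f \<in> E (Suc p)"
      let ?b = "chain_boundary (Suc p) (frag_of f)"
      have b: "spanned ?b (E p)"
        by (rule spanned_chain_boundary [OF E]) (use f in auto)
      have bZ: "singular_chain (Suc p) (subtopology X (Z (Suc p) f)) (frag_extend (D p) ?b)"
      proof (rule singular_chain_extend)
        fix g assume "g \<in> Poly_Mapping.keys ?b"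
        moreover have "spanned ?b ((\<lambda>k. singular_face (Suc p) k f) ` {..Suc p})"
          unfolding chain_boundary_of by (simp del: sum.atMost_Suc, intro spanned_sum spanned_cmul) auto
        ultimately obtain k where k: "k \<le> Suc p" "g = singular_face (Suc p) k f"
          by auto
        then have "singular_chain (Suc p) (subtopology X (Z p g)) (D p g)"
          using Suc.IH face_closedD [OF E f] by blast
        then show "singular_chain (Suc p) (subtopology X (Z (Suc p) f)) (D p g)"
          by (rule singular_chain_mono) (use Z_face f k in auto)
      qed
      have fX: "singular_chain (Suc p) X (frag_of f)"
        using f EX by (auto simp: singular_chain_of)
      let ?r = "frag_of f - frag_of (\<psi> (Suc p) f) - frag_extend (D p) ?b"
      have "\<exists>w. singular_chain (Suc (Suc p)) (subtopology X (Z (Suc p) f)) w \<and> chain_boundary (Suc (Suc p)) w = ?r"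
      proof (rule Z_acyclic [OF f])
        show "singular_chain (Suc p) (subtopology X (Z (Suc p) f)) ?r"
          by (intro singular_chain_diff bZ) (use f_in \<psi>_in f in \<open>auto simp: singular_chain_of\<close>)
        have "chain_boundary (Suc p) (frag_extend (D p) ?b)
            = ?b - ?\<psi> p ?b - frag_extend (D (p - 1)) (chain_boundary p ?b)"
          by (rule lin [OF _ b]) (use Suc.IH in blast)
        moreover have "chain_boundary p ?b = 0"
          by (rule chain_boundary_boundary_alt [OF fX])
        moreover have "?\<psi> p ?b = chain_boundary (Suc p) (frag_of (\<psi> (Suc p) f))"
          using \<psi>_boundary [of "frag_of f" p] f by simp
        ultimately show "chain_boundary (Suc p) ?r = 0"
          by (simp add: chain_boundary_diff)
      qed simp
      from someI_ex [OF this]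
      show "singular_chain (Suc (Suc p)) (subtopology X (Z (Suc p) f)) (D (Suc p) f) \<and>
          chain_boundary (Suc (Suc p)) (D (Suc p) f)
        = frag_of f - frag_of (\<psi> (Suc p) f) - frag_extend (D (Suc p - 1)) (chain_boundary (Suc p) (frag_of f))"
        unfolding D_Suc pick_def by simp
    qed
  qed
  show thesis
  proof
    show "singular_chain (Suc p) X (frag_extend (D p) c)"
    proof (rule singular_chain_extend)
      fix f assume "f \<in> Poly_Mapping.keys c"
      then have "singular_chain (Suc p) (subtopology X (Z p f)) (D p f)"
        using D c(1) by blast
      then show "singular_chain (Suc p) X (D p f)"
        by (simp add: singular_chain_subtopology)
    qed
    show "chain_boundary (Suc p) (frag_extend (D p) c) = c - ?\<psi> p c"
      using lin [OF _ c(1)] D c(2) by simp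
  qed
qed

section \<open>Affine simplices\<close>

definition affine_simplex :: "'i set \<Rightarrow> ('v \<Rightarrow> 'i \<Rightarrow> real) \<Rightarrow> nat \<Rightarrow> 'v list \<Rightarrow> (nat \<Rightarrow> real) \<Rightarrow> 'i \<Rightarrow> real" where
  "affine_simplex I pt p xs = (\<lambda>x\<in>standard_simplex p. \<lambda>j\<in>I. \<Sum>i\<le>p. x i * pt (xs ! i) j)"

definition affine_family :: "'i set \<Rightarrow> ('v \<Rightarrow> 'i \<Rightarrow> real) \<Rightarrow> 'v set set \<Rightarrow> ('i \<Rightarrow> real) simplex_family" where
  "affine_family I pt L p = affine_simplex I pt p ` {xs. length xs = Suc p \<and> set xs \<in> L}"

lemma singular_simplex_affine: "singular_simplex p (powertop_real I) (affine_simplex I pt p xs)"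
proof -
  have "continuous_map (subtopology (powertop_real UNIV) (standard_simplex p)) (powertop_real I)
          (\<lambda>x. \<lambda>j\<in>I. \<Sum>i\<le>p. x i * pt (xs ! i) j)"
    unfolding continuous_map_componentwise
    by (auto intro!: continuous_map_sum continuous_map_real_mult_right continuous_map_from_subtopology
        continuous_map_product_projection)
  then show ?thesis
    by (simp add: singular_simplex_def affine_simplex_def)
qed

lemma singular_face_affine:
  assumes "length xs = Suc (Suc p)" "k \<le> Suc p"
  shows "singular_face (Suc p) k (affine_simplex I pt (Suc p) xs) = affine_simplex I pt p (drop_nth k xs)"
proof
  fix x :: "nat \<Rightarrow> real"
  show "singular_face (Suc p) k (affine_simplex I pt (Suc p) xs) x = affine_simplex I pt p (drop_nth k xs) x"
  proof (cases "x \<in> standard_simplex p")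
    case True
    have "(\<Sum>i\<le>Suc p. simplical_face k x i * pt (xs ! i) j) = (\<Sum>i\<le>p. x i * pt (drop_nth k xs ! i) j)" for j
    proof -
      \<comment> \<open>The shape \<open>Suc (i - Suc 0)\<close> matches
        \<open>sum.zero_middle\<close>, which deletes the zero summand at \<open>k\<close>.\<close>
      have "(\<Sum>i\<le>Suc p. simplical_face k x i * pt (xs ! i) j)
         = (\<Sum>i\<le>Suc p. if i < k then x i * pt (xs ! i) j else if i = k then 0 else x (i - Suc 0) * pt (xs ! Suc (i - Suc 0)) j)"
        by (rule sum.cong) (auto simp: simplical_face_def)
      also have "\<dots> = (\<Sum>i\<le>Suc p - Suc 0. if i < k then x i * pt (xs ! i) j else x i * pt (xs ! Suc i) j)"
        by (rule sum.zero_middle) (use assms in auto)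
      also have "\<dots> = (\<Sum>i\<le>p. x i * pt (drop_nth k xs ! i) j)"
        by (rule sum.cong) (use assms in \<open>auto simp: nth_drop_nth\<close>)
      finally show ?thesis .
    qed
    then show ?thesis
      using True simplical_face_in_standard_simplex [of "Suc p" k x] assms
      by (simp add: singular_face_def affine_simplex_def del: sum.atMost_Suc)
  qed (simp add: singular_face_def affine_simplex_def)
qed

lemma front_face_affine:
  assumes "length xs = Suc (p + q)"
  shows "front_face p (affine_simplex I pt (p + q) xs) = affine_simplex I pt p (take (Suc p) xs)"
proof
  fix x :: "nat \<Rightarrow> real"
  have "(\<Sum>i\<le>p+q. x i * pt (xs ! i) j) = (\<Sum>i\<le>p. x i * pt (take (Suc p) xs ! i) j)"
    if "x \<in> standard_simplex p" for j
    by (rule sum.mono_neutral_cong_right) (use that in \<open>auto simp: standard_simplex_def\<close>)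
  then show "front_face p (affine_simplex I pt (p + q) xs) x = affine_simplex I pt p (take (Suc p) xs) x"
    by (auto simp: front_face_def affine_simplex_def front_inclusion)
qed

lemma back_face_affine:
  assumes "length xs = Suc (p + q)"
  shows "back_face p q (affine_simplex I pt (p + q) xs) = affine_simplex I pt q (drop p xs)"
proof
  fix x :: "nat \<Rightarrow> real"
  have "(\<Sum>i\<le>p+q. (if i < p then 0 else x (i - p)) * pt (xs ! i) j) = (\<Sum>i\<le>q. x i * pt (drop p xs ! i) j)" for j
  proof -
    have "(\<Sum>i\<le>p+q. (if i < p then 0 else x (i - p)) * pt (xs ! i) j) = (\<Sum>i\<in>{0+p..q+p}. x (i - p) * pt (xs ! i) j)"
      by (rule sum.mono_neutral_cong_right) auto
    also have "\<dots> = (\<Sum>i\<le>q. x i * pt (drop p xs ! i) j)"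
      unfolding sum.shift_bounds_cl_nat_ivl using assms by (simp add: atMost_atLeast0 add.commute)
    finally show ?thesis .
  qed
  then show "back_face p q (affine_simplex I pt (p + q) xs) x = affine_simplex I pt q (drop p xs) x"
    by (auto simp: back_face_def affine_simplex_def back_inclusion)
qed

lemma affine_simplex_vertex:
  assumes "i \<le> p"
  shows "affine_simplex I pt p xs (\<lambda>j. if j = i then 1 else 0) = (\<lambda>j\<in>I. pt (xs ! i) j)"
proof -
  have "(\<Sum>k\<le>p. (if k = i then 1 else 0) * pt (xs ! k) j) = pt (xs ! i) j" for j
    using assms by (simp add: if_distrib [of "\<lambda>c. c * _"] cong: if_cong)
  then show ?thesis
    using assms by (simp add: affine_simplex_def)
qed

text \<open>The values at the corners are the points of the listed vertices, so the list can be read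
  off from the map.\<close>

lemma affine_simplex_inj:
  assumes inj: "\<And>u v. u \<in> V \<Longrightarrow> v \<in> V \<Longrightarrow> (\<And>j. j \<in> I \<Longrightarrow> pt u j = pt v j) \<Longrightarrow> u = v"
  shows "inj_on (affine_simplex I pt p) {xs. length xs = Suc p \<and> set xs \<subseteq> V}"
proof (rule inj_onI, clarsimp)
  fix xs ys assume xs: "length xs = Suc p" "set xs \<subseteq> V" and ys: "length ys = Suc p" "set ys \<subseteq> V"
    and eq: "affine_simplex I pt p xs = affine_simplex I pt p ys"
  have "xs ! i = ys ! i" if "i \<le> p" for i
  proof (rule inj)
    show "pt (xs ! i) j = pt (ys ! i) j" if "j \<in> I" for j
    proof -
      have "(\<lambda>j\<in>I. pt (xs ! i) j) = (\<lambda>j\<in>I. pt (ys ! i) j)"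
        unfolding affine_simplex_vertex [OF \<open>i \<le> p\<close>, symmetric] eq ..
      from fun_cong [OF this, of j] that show ?thesis
        by simp
    qed
  qed (use xs ys that in \<open>auto simp: subset_iff\<close>)
  then show "xs = ys"
    using xs(1) ys(1) by (simp add: list_eq_iff_nth_eq less_Suc_eq_le)
qed

lemma face_closed_affine_family:
  assumes "\<And>\<tau> \<rho>. \<tau> \<in> L \<Longrightarrow> \<rho> \<subseteq> \<tau> \<Longrightarrow> \<rho> \<in> L"
  shows "face_closed (affine_family I pt L)"
  unfolding face_closed_def
proof (intro allI ballI impI)
  fix p f k assume "f \<in> affine_family I pt L (Suc p)" and k: "k \<le> Suc p"
  then obtain xs where xs: "length xs = Suc (Suc p)" "set xs \<in> L" "f = affine_simplex I pt (Suc p) xs"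
    by (auto simp: affine_family_def)
  have "set (drop_nth k xs) \<in> L"
    by (rule assms [OF xs(2) set_drop_nth])
  then show "singular_face (Suc p) k f \<in> affine_family I pt L p"
    using xs k by (simp add: singular_face_affine affine_family_def)
qed

text \<open>The total is only bounded by 1: in \<open>join_of\<close> the missing weight goes to the
  extra point \<open>x\<close>, while \<open>hull_of\<close> demands equality. Summing over the
  ambient \<open>V\<close> keeps the formulas independent of \<open>\<tau>\<close>.\<close>

definition weights :: "'v set \<Rightarrow> 'v set \<Rightarrow> ('v \<Rightarrow> real) set" where
  "weights V \<tau> = {w. (\<forall>v. 0 \<le> w v) \<and> (\<forall>v. v \<notin> \<tau> \<longrightarrow> w v = 0) \<and> sum w V \<le> 1}"

definition hull_of :: "'i set \<Rightarrow> 'v set \<Rightarrow> ('v \<Rightarrow> 'i \<Rightarrow> real) \<Rightarrow> 'v set \<Rightarrow> ('i \<Rightarrow> real) set" where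
  "hull_of I V pt \<tau> = {\<lambda>j\<in>I. \<Sum>v\<in>V. w v * pt v j | w. w \<in> weights V \<tau> \<and> sum w V = 1}"

definition join_of :: "'i set \<Rightarrow> 'v set \<Rightarrow> ('v \<Rightarrow> 'i \<Rightarrow> real) \<Rightarrow> ('i \<Rightarrow> real) \<Rightarrow> 'v set \<Rightarrow> ('i \<Rightarrow> real) set" where
  "join_of I V pt x \<tau> = {\<lambda>j\<in>I. (1 - sum w V) * x j + (\<Sum>v\<in>V. w v * pt v j) | w. w \<in> weights V \<tau>}"

lemma hull_subset_join: "hull_of I V pt \<tau> \<subseteq> join_of I V pt x \<tau>"
proof
  fix y assume "y \<in> hull_of I V pt \<tau>"
  then obtain w where "w \<in> weights V \<tau>" "sum w V = 1" "y = (\<lambda>j\<in>I. \<Sum>v\<in>V. w v * pt v j)"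
    by (auto simp: hull_of_def)
  then show "y \<in> join_of I V pt x \<tau>"
    unfolding join_of_def by (intro CollectI exI [of _ w]) simp
qed

lemma affine_simplex_in_hull:
  assumes "length xs = Suc p" "set xs \<subseteq> V" "finite V" "x \<in> standard_simplex p"
  shows "affine_simplex I pt p xs x \<in> hull_of I V pt (set xs)"
proof -
  \<comment> \<open>A vertex may occur several times in the list; its weight collects the
    coordinates of all its positions.\<close>
  define w where "w v = (\<Sum>i\<le>p. if xs ! i = v then x i else 0)" for v
  have x: "\<And>i. 0 \<le> x i" "(\<Sum>i\<le>p. x i) = 1"
    using assms(4) by (auto simp: standard_simplex_def)
  have in_V: "xs ! i \<in> V" "xs ! i \<in> set xs" if "i \<le> p" for i
    using assms that by auto
  have *: "(\<Sum>v\<in>V. w v * h v) = (\<Sum>i\<le>p. x i * h (xs ! i))" for h :: "'a \<Rightarrow> real"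
  proof -
    have "(\<Sum>v\<in>V. w v * h v) = (\<Sum>i\<le>p. \<Sum>v\<in>V. (if xs ! i = v then x i else 0) * h v)"
      by (simp add: w_def sum_distrib_right sum.swap [of _ V])
    also have "\<dots> = (\<Sum>i\<le>p. x i * h (xs ! i))"
      by (rule sum.cong) (use in_V assms(3) in \<open>auto simp: if_distrib [of "\<lambda>c. c * _"] cong: if_cong\<close>)
    finally show ?thesis .
  qed
  have "sum w V = 1"
    using * [of "\<lambda>_. 1"] x by simp
  moreover have "w \<in> weights V (set xs)"
    unfolding weights_def using in_V x calculation
    by (auto simp: w_def intro!: sum_nonneg sum.neutral)
  ultimately show ?thesis
    using * assms(4) unfolding hull_of_def affine_simplex_def
    by (intro CollectI exI [of _ w]) simp
qed

section \<open>Spaces covered by stars of vertices\<close>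

text \<open>
  \<open>g v\<close> plays the part of the barycentric coordinate at \<open>v\<close>: its positivity set is the open star of \<open>v\<close>.
  No homeomorphism of \<open>S\<close> with a realization of \<open>L\<close> is needed.
\<close>

locale star_cover = cone_carrier L M apex
  for L :: "'v set set" and M :: "'v set \<Rightarrow> 'v set" and apex :: "'v set \<Rightarrow> 'v" +
  fixes I :: "'i set" and S :: "('i \<Rightarrow> real) set" and V :: "'v set"
    and pt :: "'v \<Rightarrow> 'i \<Rightarrow> real" and g :: "'v \<Rightarrow> ('i \<Rightarrow> real) \<Rightarrow> real"
  assumes S_ext: "S \<subseteq> extensional I"
    and finite_V: "finite V"
    and L_V: "\<tau> \<in> L \<Longrightarrow> \<tau> \<subseteq> V"
    and hull_S: "\<tau> \<in> L \<Longrightarrow> hull_of I V pt \<tau> \<subseteq> S"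
    and pt_inj: "u \<in> V \<Longrightarrow> v \<in> V \<Longrightarrow> (\<And>j. j \<in> I \<Longrightarrow> pt u j = pt v j) \<Longrightarrow> u = v"
    and g_cont: "v \<in> V \<Longrightarrow> continuous_map (subtopology (powertop_real I) S) euclideanreal (g v)"
    and g_pos: "x \<in> S \<Longrightarrow> \<exists>v\<in>V. 0 < g v x"
    and star_L: "x \<in> S \<Longrightarrow> \<tau> \<subseteq> V \<Longrightarrow> \<tau> \<noteq> {} \<Longrightarrow> (\<And>v. v \<in> \<tau> \<Longrightarrow> 0 < g v x) \<Longrightarrow> \<tau> \<in> L"
    and star_S: "x \<in> S \<Longrightarrow> \<tau> \<subseteq> V \<Longrightarrow> \<tau> \<noteq> {} \<Longrightarrow> (\<And>v. v \<in> \<tau> \<Longrightarrow> 0 < g v x) \<Longrightarrow> join_of I V pt x \<tau> \<subseteq> S"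
    and star_carried: "\<tau> \<in> L \<Longrightarrow> \<tau> \<noteq> {} \<Longrightarrow> x \<in> hull_of I V pt \<tau> \<Longrightarrow> v \<in> V \<Longrightarrow> 0 < g v x \<Longrightarrow> v \<in> M \<tau>"
begin

abbreviation X where "X \<equiv> subtopology (powertop_real I) S"

lemma topspace_X: "topspace X = S"
  using S_ext by (auto simp: extensional_def PiE_iff)

abbreviation aff where "aff \<equiv> affine_simplex I pt"

abbreviation lists where "lists p \<equiv> {xs. length xs = Suc p \<and> set xs \<in> L}"

lemma aff_singular_hull:
  assumes "xs \<in> lists p"
  shows "singular_simplex p (subtopology X (hull_of I V pt (set xs))) (aff p xs)"
proof -
  have "aff p xs ` standard_simplex p \<subseteq> hull_of I V pt (set xs)"
    using assms L_V finite_V by (auto intro!: affine_simplex_in_hull)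
  moreover have "hull_of I V pt (set xs) \<subseteq> S"
    using assms by (auto intro: hull_S [THEN subsetD])
  ultimately show ?thesis
    by (auto simp: singular_simplex_subtopology singular_simplex_affine)
qed

lemma aff_singular: "xs \<in> lists p \<Longrightarrow> singular_simplex p X (aff p xs)"
  using aff_singular_hull [of xs p] by (simp add: singular_simplex_subtopology)

lemma affine_family_singular: "affine_family I pt L p \<subseteq> singular_simplex_set p X"
  using aff_singular by (auto simp: affine_family_def)

text \<open>The vertex map of a simplicial approximation: a vertex with maximal coordinate, ties
  being broken by choice.\<close>

definition best :: "('i \<Rightarrow> real) \<Rightarrow> 'v" where
  "best x = (SOME v. v \<in> V \<and> (\<forall>w\<in>V. g w x \<le> g v x))"

lemma best:
  assumes "x \<in> S"
  shows "best x \<in> V" "\<And>w. w \<in> V \<Longrightarrow> g w x \<le> g (best x) x" "0 < g (best x) x"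
proof -
  have "\<exists>v. v \<in> V \<and> (\<forall>w\<in>V. g w x \<le> g v x)"
  proof -
    let ?G = "(\<lambda>v. g v x) ` V"
    have G: "finite ?G" "?G \<noteq> {}"
      using finite_V g_pos [OF assms] by auto
    obtain v where "v \<in> V" "Max ?G = g v x"
      using Max_in [OF G] by (rule imageE)
    then show ?thesis
      using Max_ge [OF G(1)] by auto
  qed
  from someI_ex [OF this]
  show *: "best x \<in> V" "\<And>w. w \<in> V \<Longrightarrow> g w x \<le> g (best x) x"
    by (auto simp: best_def)
  show "0 < g (best x) x"
    using * g_pos [OF assms] by (meson less_le_trans)
qed

definition vertices :: "nat \<Rightarrow> ((nat \<Rightarrow> real) \<Rightarrow> 'i \<Rightarrow> real) \<Rightarrow> 'v list" where
  "vertices p f = map (\<lambda>i. best (f (\<lambda>j. if j = i then 1 else 0))) [0..<Suc p]"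

lemma length_vertices [simp]: "length (vertices p f) = Suc p"
  by (simp add: vertices_def)

lemma nth_vertices: "i \<le> p \<Longrightarrow> vertices p f ! i = best (f (\<lambda>j. if j = i then 1 else 0))"
  unfolding vertices_def by (subst nth_map) (auto simp del: upt_Suc)

text \<open>The list depends on the corners of \<open>f\<close> alone, and the corners of a face are
  corners of \<open>f\<close>. So the approximation commutes with faces strictly.\<close>

lemma vertices_face:
  assumes "k \<le> Suc p"
  shows "vertices p (singular_face (Suc p) k f) = drop_nth k (vertices (Suc p) f)"
proof (rule nth_equalityI)
  fix i assume "i < length (vertices p (singular_face (Suc p) k f))"
  then have i: "i \<le> p" by simp
  have "simplical_face k (\<lambda>j. if j = i then 1 else 0) = (\<lambda>j. if j = (if i < k then i else Suc i) then 1 else 0 :: real)"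
    by (auto simp: simplical_face_def fun_eq_iff)
  then have "vertices p (singular_face (Suc p) k f) ! i = best (f (\<lambda>j. if j = (if i < k then i else Suc i) then 1 else 0))"
    using i by (simp add: nth_vertices singular_face_def)
  then show "vertices p (singular_face (Suc p) k f) ! i = drop_nth k (vertices (Suc p) f) ! i"
    using i assms by (simp add: nth_drop_nth nth_vertices)
qed (use assms in simp)

text \<open>For such a simplex \<open>f\<close> the list \<open>vertices p f\<close> spans a simplex of \<open>L\<close> whose star contains the image of \<open>f\<close>.\<close>

definition small :: "('i \<Rightarrow> real) simplex_family" where
  "small p = {f. singular_simplex p X f \<and> (\<forall>x\<in>standard_simplex p. \<forall>y\<in>standard_simplex p. 0 < g (best (f y)) (f x))}"

lemma face_closed_small: "face_closed small"
  unfolding face_closed_def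
proof (intro allI ballI impI)
  fix p f k assume f: "f \<in> small (Suc p)" "k \<le> Suc p"
  then have "simplical_face k x \<in> standard_simplex (Suc p)" if "x \<in> standard_simplex p" for x
    using simplical_face_in_standard_simplex [of "Suc p" k x] that by simp
  then show "singular_face (Suc p) k f \<in> small p"
    using f singular_face_Suc by (auto simp: small_def) (auto simp: singular_face_def)
qed

lemma singular_simplex_in_S: "singular_simplex p X f \<Longrightarrow> x \<in> standard_simplex p \<Longrightarrow> f x \<in> S"
  by (auto simp: singular_simplex_subtopology)

lemma small_vertices:
  assumes "f \<in> small p"
  shows "set (vertices p f) \<subseteq> V" "set (vertices p f) \<noteq> {}"
    "x \<in> standard_simplex p \<Longrightarrow> v \<in> set (vertices p f) \<Longrightarrow> 0 < g v (f x)"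
  using assms best(1) singular_simplex_in_S [of p f]
  by (auto simp: vertices_def small_def simp del: upt_Suc)

lemma vertices_in_L: "f \<in> small p \<Longrightarrow> set (vertices p f) \<in> L"
  using small_vertices [of f p] nonempty_standard_simplex [of p] singular_simplex_in_S [of p f]
  by (auto simp: small_def intro!: star_L)

text \<open>The open set \<open>W A\<close> consists of points where all vertices of
  \<open>A\<close> have positive coordinate and none outside \<open>A\<close> is maximal. If
  \<open>f\<close> maps into \<open>W A\<close>, each vertex chosen by \<open>best\<close> on its
  image lies in \<open>A\<close> and is thus positive on the whole image. A point lies in
  \<open>W A\<close> for \<open>A\<close> its set of maximal vertices.\<close>

lemma exists_small_cover:
  obtains \<C> where "\<And>U. U \<in> \<C> \<Longrightarrow> openin X U" "topspace X \<subseteq> \<Union>\<C>"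
    "\<And>p f. singular_simplex p X f \<Longrightarrow> \<exists>U\<in>\<C>. f \<in> standard_simplex p \<rightarrow> U \<Longrightarrow> f \<in> small p"
proof
  define W where "W A = {x \<in> topspace X. (\<forall>v\<in>A. 0 < g v x) \<and> (\<forall>v\<in>V - A. \<exists>w\<in>V. g v x < g w x)}" for A
  show "openin X U" if U: "U \<in> W ` Pow V" for U
  proof -
    obtain A where A: "A \<subseteq> V" "U = W A"
      using U by auto
    have pos: "openin X {x \<in> topspace X. 0 < g v x}" if "v \<in> V" for v
      using openin_continuous_map_preimage [OF g_cont [OF that], of "{0<..}"] by simp
    have less: "openin X {x \<in> topspace X. g v x < g w x}" if "v \<in> V" "w \<in> V" for v w
      using openin_continuous_map_preimage [OF continuous_map_diff [OF g_cont [OF that(2)] g_cont [OF that(1)]], of "{0<..}"]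
      by simp
    define P where "P v = {x \<in> topspace X. 0 < g v x}" for v
    define Q where "Q v = (\<Union>w\<in>V. {x \<in> topspace X. g v x < g w x})" for v
    let ?\<U> = "P ` A \<union> Q ` (V - A)"
    have "openin X (Q v)" if "v \<in> V" for v
      unfolding Q_def by (rule openin_Union) (use less [OF that] in blast)
    then have op: "openin X T" if "T \<in> ?\<U>" for T
      using that pos A(1) unfolding P_def by blast
    have fin: "finite ?\<U>"
      using A(1) finite_V finite_subset by blast
    have "openin X (\<Inter>(insert (topspace X) ?\<U>))"
      by (rule openin_Inter) (use op fin openin_topspace in blast)+
    moreover have "W A = \<Inter>(insert (topspace X) ?\<U>)"
      unfolding W_def P_def Q_def by blast
    ultimately show ?thesis
      using A(2) by simp
  qed
  show "topspace X \<subseteq> \<Union>(W ` Pow V)"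
  proof
    fix x assume x: "x \<in> topspace X"
    let ?A = "{v \<in> V. \<forall>w\<in>V. g w x \<le> g v x}"
    have "x \<in> W ?A"
      using x best [of x] unfolding W_def topspace_X by (auto simp: not_le)
    moreover have "W ?A \<in> W ` Pow V"
      by (rule imageI) auto
    ultimately show "x \<in> \<Union>(W ` Pow V)"
      by (rule UnionI [rotated])
  qed
  fix p f assume f: "singular_simplex p X f" and "\<exists>U\<in>W ` Pow V. f \<in> standard_simplex p \<rightarrow> U"
  then obtain A where A: "\<And>x. x \<in> standard_simplex p \<Longrightarrow> f x \<in> W A"
    by auto
  have "0 < g (best (f y)) (f x)" if "x \<in> standard_simplex p" "y \<in> standard_simplex p" for x y
  proof -
    have y: "f y \<in> S" "f y \<in> W A" and "f x \<in> W A"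
      using singular_simplex_in_S [OF f] A that by blast+
    have "best (f y) \<in> A"
    proof (rule ccontr)
      assume "best (f y) \<notin> A"
      then obtain w where "w \<in> V" "g (best (f y)) (f y) < g w (f y)"
        using y(2) best(1) [OF y(1)] unfolding W_def by blast
      then show False
        using best(2) [OF y(1)] by (simp add: not_le [symmetric])
    qed
    with \<open>f x \<in> W A\<close> show ?thesis
      unfolding W_def by blast
  qed
  then show "f \<in> small p"
    using f by (simp add: small_def)
qed

section \<open>Contractible carriers of small simplices\<close>

lemma join_of_self: "x \<in> S \<Longrightarrow> x \<in> join_of I V pt x \<tau>"
  using S_ext unfolding join_of_def
  by (intro CollectI exI [of _ "\<lambda>_. 0"]) (auto simp: weights_def fun_eq_iff extensional_def subset_iff)

text \<open>Large enough to contain the image of \<open>f\<close> (weights 0) and the affine simplex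
  on its vertices (total weight 1), yet contractible along segments to a listed vertex.\<close>

definition carrier_of :: "nat \<Rightarrow> ((nat \<Rightarrow> real) \<Rightarrow> 'i \<Rightarrow> real) \<Rightarrow> ('i \<Rightarrow> real) set" where
  "carrier_of p f = (\<Union>x\<in>standard_simplex p. join_of I V pt (f x) (set (vertices p f)))"

lemma carrier_of_subset: "f \<in> small p \<Longrightarrow> carrier_of p f \<subseteq> S"
  unfolding carrier_of_def
  by (intro UN_least star_S small_vertices) (auto simp: small_def intro: singular_simplex_in_S)

lemma carrier_of_contractible:
  assumes f: "f \<in> small p"
  obtains a where "a \<in> topspace (subtopology X (carrier_of p f))"
    "homotopic_with (\<lambda>_. True) (subtopology X (carrier_of p f)) (subtopology X (carrier_of p f)) id (\<lambda>_. a)"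
proof -
  let ?Z = "carrier_of p f"
  let ?XZ = "subtopology X ?Z"
  have ZS: "?Z \<subseteq> S"
    by (rule carrier_of_subset [OF f])
  obtain v where v: "v \<in> set (vertices p f)"
    using small_vertices(2) [OF f] by (metis ex_in_conv)
  then have vV: "v \<in> V"
    using small_vertices(1) [OF f] by blast
  define a where "a = (\<lambda>j\<in>I. pt v j)"
  define h where "h = (\<lambda>(t, y). \<lambda>j\<in>I. (1 - t) * y j + t * pt v j)"
  have h_in: "h (t, y) \<in> ?Z" if t: "0 \<le> t" "t \<le> 1" and "y \<in> ?Z" for t y
  proof -
    obtain x w where x: "x \<in> standard_simplex p" and w: "w \<in> weights V (set (vertices p f))"
      and y: "y = (\<lambda>j\<in>I. (1 - sum w V) * f x j + (\<Sum>v\<in>V. w v * pt v j))"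
      using \<open>y \<in> ?Z\<close> by (auto simp: carrier_of_def join_of_def)
    \<comment> \<open>On the segment from \<open>y\<close> to the vertex \<open>v\<close> the point
      \<open>f x\<close> stays fixed; only the weights move, linearly towards the unit weight at
      \<open>v\<close>.\<close>
    define w' where "w' u = (1 - t) * w u + (if u = v then t else 0)" for u
    have sum_w': "(\<Sum>u\<in>V. w' u * c u) = (1 - t) * (\<Sum>u\<in>V. w u * c u) + t * c v" for c
    proof -
      have "(\<Sum>u\<in>V. w' u * c u) = (\<Sum>u\<in>V. (1 - t) * (w u * c u) + (if u = v then t * c u else 0))"
        by (rule sum.cong) (auto simp: w'_def algebra_simps)
      then show ?thesis
        using vV finite_V by (simp add: sum.distrib sum_distrib_left)
    qed
    have s: "sum w' V = (1 - t) * sum w V + t"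
      using sum_w' [of "\<lambda>_. 1"] by simp
    have "(1 - t) * sum w V \<le> (1 - t) * 1"
      using w t by (intro mult_left_mono) (auto simp: weights_def)
    then have "w' \<in> weights V (set (vertices p f))"
      using w t v s by (auto simp: weights_def w'_def)
    moreover have "h (t, y) = (\<lambda>j\<in>I. (1 - sum w' V) * f x j + (\<Sum>v\<in>V. w' v * pt v j))"
      unfolding s sum_w' by (auto simp: h_def y fun_eq_iff algebra_simps)
    ultimately show ?thesis
      using x by (auto simp: carrier_of_def join_of_def)
  qed
  have cont: "continuous_map (prod_topology (top_of_set {0..1::real}) ?XZ) ?XZ h"
  proof -
    have "continuous_map (prod_topology (top_of_set {0..1::real}) ?XZ) (powertop_real I) h"
      unfolding continuous_map_componentwise
    proof (intro conjI ballI)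
      show "h ` topspace (prod_topology (top_of_set {0..1::real}) ?XZ) \<subseteq> extensional I"
        by (auto simp: h_def)
    next
      fix j assume j: "j \<in> I"
      have fst: "continuous_map (prod_topology (top_of_set {0..1::real}) ?XZ) euclideanreal fst"
        using continuous_map_into_fulltopology [OF continuous_map_fst] by blast
      have "continuous_map ?XZ euclideanreal (\<lambda>y. y j)"
        using j by (intro continuous_map_from_subtopology continuous_map_product_projection)
      then have "continuous_map (prod_topology (top_of_set {0..1::real}) ?XZ) euclideanreal (\<lambda>z. snd z j)"
        using continuous_map_compose [OF continuous_map_snd] by (fastforce simp: o_def)
      then have "continuous_map (prod_topology (top_of_set {0..1::real}) ?XZ) euclideanreal
          (\<lambda>z. (1 - fst z) * snd z j + fst z * pt v j)"
        using fst by (intro continuous_intros) auto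
      then show "continuous_map (prod_topology (top_of_set {0..1::real}) ?XZ) euclideanreal (\<lambda>z. h z j)"
        using j by (simp add: h_def case_prod_unfold)
    qed
    then show ?thesis
      using h_in ZS by (auto simp: continuous_map_in_subtopology)
  qed
  obtain x where "x \<in> standard_simplex p"
    using nonempty_standard_simplex by blast
  then have "f x \<in> ?Z"
    using f join_of_self by (auto simp: small_def carrier_of_def intro: singular_simplex_in_S)
  moreover have "h (1, f x) = a"
    by (auto simp: h_def a_def)
  ultimately have "a \<in> ?Z"
    using h_in [of 1 "f x"] by simp
  then have "a \<in> topspace ?XZ"
    using ZS topspace_X by auto
  moreover have "h (0, y) = y" if "y \<in> ?Z" for y
    using that ZS S_ext by (force simp: h_def fun_eq_iff extensional_def)
  moreover have "h (1, y) = a" for y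
    by (auto simp: h_def a_def)
  ultimately have "homotopic_with (\<lambda>_. True) ?XZ ?XZ id (\<lambda>_. a)"
    using cont by (subst homotopic_with) (auto intro!: exI [of _ h])
  with \<open>a \<in> topspace ?XZ\<close> that show thesis
    by blast
qed

end

section \<open>Affine simplices compute the homology\<close>

lemma singular_chain_iterated_subdivision:
  "singular_chain p X c \<Longrightarrow> singular_chain p X ((singular_subdivision p ^^ n) c)"
  by (induction n) (simp_all add: singular_chain_singular_subdivision)

lemma chain_boundary_iterated_subdivision:
  assumes "singular_chain (Suc p) X c"
  shows "chain_boundary (Suc p) ((singular_subdivision (Suc p) ^^ n) c)
       = (singular_subdivision p ^^ n) (chain_boundary (Suc p) c)"
  using chain_boundary_singular_subdivision [OF singular_chain_iterated_subdivision [OF assms]]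
  by (induction n) simp_all

lemma iterated_subdivision_0:
  assumes "singular_chain 0 X c" shows "(singular_subdivision 0 ^^ n) c = c"
proof (induction n)
  case (Suc n)
  then show ?case using singular_subdivision_zero [OF assms] by simp
qed simp

context star_cover
begin

definition vertex_chain :: "nat \<Rightarrow> ('i \<Rightarrow> real) chain \<Rightarrow> ('v list \<Rightarrow>\<^sub>0 int)" where
  "vertex_chain p = frag_extend (\<lambda>f. frag_of (vertices p f))"

definition aff_chain :: "nat \<Rightarrow> ('v list \<Rightarrow>\<^sub>0 int) \<Rightarrow> ('i \<Rightarrow> real) chain" where
  "aff_chain p = frag_extend (\<lambda>xs. frag_of (aff p xs))"

lemma vertex_chain_diff: "vertex_chain p (a - b) = vertex_chain p a - vertex_chain p b"
  by (simp add: vertex_chain_def frag_extend_diff)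

lemma aff_chain_diff: "aff_chain p (a - b) = aff_chain p a - aff_chain p b"
  by (simp add: aff_chain_def frag_extend_diff)

lemma vertex_chain_boundary:
  "list_boundary (vertex_chain (Suc p) c) = vertex_chain p (chain_boundary (Suc p) c)"
proof -
  have "spanned c UNIV" by simp
  then show ?thesis
  proof (induction rule: frag_induction)
    case (one f)
    then show ?case
      by (simp add: vertex_chain_def list_boundary_of chain_boundary_of frag_extend_sum frag_extend_cmul
          vertices_face o_def lessThan_Suc_atMost del: sum.lessThan_Suc sum.atMost_Suc)
  qed (simp_all add: vertex_chain_diff list_boundary_diff chain_boundary_diff, simp add: vertex_chain_def)
qed

lemma aff_chain_boundary:
  assumes "spanned z {xs. length xs = Suc (Suc p)}"
  shows "chain_boundary (Suc p) (aff_chain (Suc p) z) = aff_chain p (list_boundary z)"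
  using assms
proof (induction rule: frag_induction)
  case (one xs)
  then show ?case
    by (simp add: aff_chain_def list_boundary_of chain_boundary_of frag_extend_sum frag_extend_cmul
        singular_face_affine o_def lessThan_Suc_atMost del: sum.lessThan_Suc sum.atMost_Suc)
qed (simp_all add: aff_chain_diff list_boundary_diff chain_boundary_diff, simp add: aff_chain_def)

lemma vertex_chain_small: "spanned c (small p) \<Longrightarrow> spanned (vertex_chain p c) (lists p)"
  unfolding vertex_chain_def using vertices_in_L by (intro spanned_frag_extend) auto

lemma aff_chain_spanned: "spanned z (lists p) \<Longrightarrow> spanned (aff_chain p z) (affine_family I pt L p)"
  unfolding aff_chain_def affine_family_def by (intro spanned_frag_extend) auto

lemma aff_inj: "inj_on (aff p) (lists p)"
  by (rule inj_on_subset [OF affine_simplex_inj [of V]]) (use pt_inj L_V in auto)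

lemma aff_chain_eq_0:
  assumes "spanned z (lists p)" "aff_chain p z = 0" shows "z = 0"
proof -
  have "frag_extend (\<lambda>f. frag_of (inv_into (lists p) (aff p) f)) (aff_chain p z) = z"
    using assms(1) unfolding aff_chain_def
  proof (induction rule: frag_induction)
    case (one xs)
    then show ?case using inv_into_f_f [OF aff_inj one] by simp
  qed (simp_all add: frag_extend_diff)
  with assms(2) show ?thesis by simp
qed

lemma aff_chain_surj:
  assumes "spanned c (affine_family I pt L p)"
  obtains z where "spanned z (lists p)" "aff_chain p z = c"
proof
  let ?z = "frag_extend (\<lambda>f. frag_of (inv_into (lists p) (aff p) f)) c"
  have inv: "inv_into (lists p) (aff p) f \<in> lists p" "aff p (inv_into (lists p) (aff p) f) = f"
    if "f \<in> affine_family I pt L p" for f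
    using that unfolding affine_family_def by (rule inv_into_into, rule f_inv_into_f)
  show "spanned ?z (lists p)"
    using assms inv(1) by (intro spanned_frag_extend) auto
  show "aff_chain p ?z = c"
    using assms unfolding aff_chain_def
    by (induction rule: frag_induction) (use inv(2) in \<open>simp_all add: frag_extend_diff\<close>)
qed

text \<open>Smallness of all later subdivisions allows several thresholds to be replaced by their
  maximum.\<close>

lemma eventually_small:
  assumes "singular_chain p X c"
  obtains n where "\<And>m. n \<le> m \<Longrightarrow> spanned ((singular_subdivision p ^^ m) c) (small p)"
proof -
  obtain \<C> where \<C>: "\<And>U. U \<in> \<C> \<Longrightarrow> openin X U" "topspace X \<subseteq> \<Union>\<C>"
    "\<And>p f. singular_simplex p X f \<Longrightarrow> \<exists>U\<in>\<C>. f \<in> standard_simplex p \<rightarrow> U \<Longrightarrow> f \<in> small p"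
    by (rule exists_small_cover) (rule that)
  obtain n where n: "\<And>m f. n \<le> m \<Longrightarrow> f \<in> Poly_Mapping.keys ((singular_subdivision p ^^ m) c)
      \<Longrightarrow> \<exists>U\<in>\<C>. f \<in> standard_simplex p \<rightarrow> U"
    using sufficient_iterated_singular_subdivision_exists [OF \<C>(1,2) assms] by metis
  have "f \<in> small p" if "n \<le> m" "f \<in> Poly_Mapping.keys ((singular_subdivision p ^^ m) c)" for m f
    using \<C>(3) n [OF that] that(2) singular_chain_iterated_subdivision [OF assms, of m]
    by (auto simp: singular_chain_def)
  then show thesis
    using that by blast
qed

text \<open>Injectivity: subdivision followed by the vertex map is carried by cones on list chains.\<close>

lemma list_cycle_bounds:
  assumes z: "spanned z (lists q)" "list_boundary z = 0"
    and c: "singular_chain (Suc q) X c" "chain_boundary (Suc q) c = aff_chain q z"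
  obtains y where "spanned y (lists (Suc q))" "list_boundary y = z"
proof -
  \<comment> \<open>The relevant lists are finite in number, so one count \<open>N\<close> of
    subdivisions serves all of them as well as \<open>c\<close>.\<close>
  define A where "A = {xs. xs \<noteq> [] \<and> length xs \<le> Suc q \<and> set xs \<in> L}"
  have "A \<subseteq> {xs. set xs \<subseteq> V \<and> length xs \<le> Suc q}"
    using L_V by (auto simp: A_def)
  then have "finite A"
    using finite_lists_length_le [OF finite_V] finite_subset by blast
  have "\<exists>n. \<forall>m\<ge>n. spanned ((singular_subdivision (length xs - 1) ^^ m) (frag_of (aff (length xs - 1) xs))) (small (length xs - 1))"
    if "xs \<in> A" for xs
  proof -
    have "singular_chain (length xs - 1) X (frag_of (aff (length xs - 1) xs))"
      using that aff_singular [of xs "length xs - 1"] by (auto simp: A_def singular_chain_of)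
    then show ?thesis
      using eventually_small by metis
  qed
  then obtain n where n: "\<And>xs m. xs \<in> A \<Longrightarrow> n xs \<le> m \<Longrightarrow>
      spanned ((singular_subdivision (length xs - 1) ^^ m) (frag_of (aff (length xs - 1) xs))) (small (length xs - 1))"
    by metis
  obtain n0 where n0: "\<And>m. n0 \<le> m \<Longrightarrow> spanned ((singular_subdivision (Suc q) ^^ m) c) (small (Suc q))"
    using eventually_small [OF c(1)] by metis
  define N where "N = Max (insert n0 (n ` A))"
  have N0: "n0 \<le> N" and N: "\<And>xs. xs \<in> A \<Longrightarrow> n xs \<le> N"
    using \<open>finite A\<close> by (auto simp: N_def)
  let ?Sd = "\<lambda>p. singular_subdivision p ^^ N"
  \<comment> \<open>Subdivide \<open>N\<close> times, then approximate by vertices. The value at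
    \<open>[]\<close> makes the map augmentation preserving.\<close>
  define \<alpha> where "\<alpha> xs = (if xs = [] then frag_of [] else
      vertex_chain (length xs - 1) (?Sd (length xs - 1) (frag_of (aff (length xs - 1) xs))))" for xs
  have \<alpha>_eq: "\<alpha> xs = vertex_chain p (?Sd p (frag_of (aff p xs)))" if "length xs = Suc p" for p xs
    using that by (auto simp: \<alpha>_def)
  have \<alpha>_chain: "frag_extend \<alpha> b = vertex_chain p (?Sd p (aff_chain p b))" if "spanned b (lists p)" for b p
    using that
  proof (induction rule: frag_induction)
    case zero
    then show ?case by (simp add: vertex_chain_def aff_chain_def)
  next
    case (one xs)
    then show ?case by (simp add: \<alpha>_eq aff_chain_def)
  next
    case (diff a b)
    then show ?case
      by (simp add: frag_extend_diff aff_chain_diff singular_subdivision_power_diff vertex_chain_diff)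
  qed
  have small: "spanned (?Sd p (frag_of (aff p xs))) (small p)" if "length xs = Suc p" "p \<le> q" "set xs \<in> L" for p xs
  proof -
    have "xs \<in> A"
      using that by (cases xs) (auto simp: A_def)
    then show ?thesis
      using n [of xs N] N [of xs] that by simp
  qed
  obtain y where y: "spanned y {xs. length xs = Suc (Suc q) \<and> set xs \<in> L}"
    "list_boundary y = z - frag_extend \<alpha> z"
  proof (rule carried_chain_map_homotopic [of \<alpha> "Suc q" z])
    fix xs :: "'v list" assume xs: "xs \<noteq> []" "length xs \<le> Suc q" "set xs \<in> L"
    then obtain p where p: "length xs = Suc p" "p \<le> q"
      by (cases xs) auto
    then have xsp: "xs \<in> lists p"
      using xs by simp
    show "spanned (\<alpha> xs) {ys. length ys = length xs \<and> set ys \<in> L \<and> set ys \<subseteq> M (set xs)}"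
      unfolding \<alpha>_eq [OF p(1)] vertex_chain_def
    proof (rule spanned_frag_extend)
      fix f assume f: "f \<in> Poly_Mapping.keys (?Sd p (frag_of (aff p xs)))"
      then have fs: "f \<in> small p"
        using small p xs by blast
      have "singular_chain p (subtopology X (hull_of I V pt (set xs))) (?Sd p (frag_of (aff p xs)))"
        by (rule singular_chain_iterated_subdivision) (simp add: singular_chain_of aff_singular_hull [OF xsp])
      then have hull: "f x \<in> hull_of I V pt (set xs)" if "x \<in> standard_simplex p" for x
        using f that by (simp add: singular_chain_subtopology image_subset_iff)
      obtain x where x: "x \<in> standard_simplex p"
        using nonempty_standard_simplex by blast
      have "v \<in> M (set xs)" if "v \<in> set (vertices p f)" for v
      proof (rule star_carried [OF xs(3) _ hull [OF x]])
        show "v \<in> V" "0 < g v (f x)"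
          using small_vertices [OF fs] x that by auto
      qed (use xs in simp)
      then show "spanned (frag_of (vertices p f)) {ys. length ys = length xs \<and> set ys \<in> L \<and> set ys \<subseteq> M (set xs)}"
        using vertices_in_L [OF fs] p(1) by auto
    qed
    show "list_boundary (\<alpha> xs) = frag_extend \<alpha> (list_boundary (frag_of xs))"
    proof (cases p)
      \<comment> \<open>Subdivision does nothing in degree 0, so \<open>\<alpha> xs\<close> is a
        single one-vertex list with boundary \<open>[]\<close>.\<close>
      case 0
      have "singular_chain 0 X (frag_of (aff 0 xs))"
        using aff_singular [of xs 0] xsp 0 by (simp add: singular_chain_of)
      then have "\<alpha> xs = frag_of (vertices 0 (aff 0 xs))"
        using \<alpha>_eq [OF p(1)] 0 by (simp add: iterated_subdivision_0 vertex_chain_def)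
      then show ?thesis
        using p(1) 0 by (simp add: list_boundary_of drop_nth_def \<alpha>_def)
    next
      case (Suc r)
      have sc: "singular_chain (Suc r) X (frag_of (aff (Suc r) xs))"
        using aff_singular [of xs "Suc r"] xsp Suc by (simp add: singular_chain_of)
      have bd: "chain_boundary (Suc r) (frag_of (aff (Suc r) xs)) = aff_chain r (list_boundary (frag_of xs))"
        using aff_chain_boundary [of "frag_of xs" r] p(1) Suc by (simp add: aff_chain_def)
      have "spanned (list_boundary (frag_of xs)) (lists r)"
        by (rule spanned_list_boundary) (use p(1) Suc xs down in auto)
      then show ?thesis
        using \<alpha>_eq [OF p(1)] Suc sc bd
        by (simp add: vertex_chain_boundary chain_boundary_iterated_subdivision \<alpha>_chain)
    qed
  qed (use z in \<open>auto simp: \<alpha>_def\<close>)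
  \<comment> \<open>The image of \<open>c\<close> under the same process bounds the image of
    \<open>z\<close> under \<open>\<alpha>\<close>; together with the homotopy it bounds
    \<open>z\<close> itself.\<close>
  let ?y = "vertex_chain (Suc q) (?Sd (Suc q) c)"
  have "list_boundary ?y = frag_extend \<alpha> z"
    using z c by (simp add: vertex_chain_boundary chain_boundary_iterated_subdivision \<alpha>_chain)
  moreover have "spanned ?y (lists (Suc q))"
    by (rule vertex_chain_small) (rule n0 [OF N0])
  ultimately show thesis
    using y by (intro that [of "y + ?y"] spanned_add) (simp_all add: list_boundary_add)
qed

text \<open>A small simplex and its affine approximation share the contractible carrier
  \<open>carrier_of\<close>.\<close>

lemma small_cycle_homologous:
  assumes "spanned c (small p)" "chain_boundary p c = 0"
  obtains w where "singular_chain (Suc p) X w" "chain_boundary (Suc p) w = c - aff_chain p (vertex_chain p c)"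
proof -
  have small_X: "small p \<subseteq> singular_simplex_set p X" for p
    by (auto simp: small_def)
  obtain w where w: "singular_chain (Suc p) X w"
    "chain_boundary (Suc p) w = c - frag_extend (\<lambda>f. frag_of (aff p (vertices p f))) c"
  proof (rule carried_simplex_map_homologous [of small X carrier_of "\<lambda>p f. aff p (vertices p f)" c p])
    show "face_closed small"
      by (rule face_closed_small)
    show "small p \<subseteq> singular_simplex_set p X" for p
      by (rule small_X)
    show "spanned c (small p)" "chain_boundary p c = 0"
      by fact+
  next
    fix p f assume f: "f \<in> small p"
    then have fX: "singular_simplex p X f"
      by (simp add: small_def)
    have "f x \<in> carrier_of p f" if "x \<in> standard_simplex p" for x
      using join_of_self [OF singular_simplex_in_S [OF fX that]] that by (auto simp: carrier_of_def)
    then show "singular_simplex p (subtopology X (carrier_of p f)) f"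
      using fX by (auto simp: singular_simplex_subtopology)
    have L: "vertices p f \<in> lists p"
      using vertices_in_L [OF f] by simp
    obtain x where "x \<in> standard_simplex p"
      using nonempty_standard_simplex by blast
    then have "hull_of I V pt (set (vertices p f)) \<subseteq> carrier_of p f"
      using hull_subset_join by (fastforce simp: carrier_of_def)
    then show "singular_simplex p (subtopology X (carrier_of p f)) (aff p (vertices p f))"
      by (rule singular_simplex_mono [OF aff_singular_hull [OF L]])
    show "\<exists>w. singular_chain (Suc p) (subtopology X (carrier_of p f)) w \<and> chain_boundary (Suc p) w = c"
      if c: "singular_chain p (subtopology X (carrier_of p f)) c" "chain_boundary p c = 0"
        and aug: "p = 0 \<Longrightarrow> cochain_eval (\<lambda>_. 1) c = 0" for c
    proof -
      obtain a where a: "a \<in> topspace (subtopology X (carrier_of p f))"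
        "homotopic_with (\<lambda>_. True) (subtopology X (carrier_of p f)) (subtopology X (carrier_of p f)) id (\<lambda>_. a)"
        using carrier_of_contractible [OF f] by blast
      obtain w where "singular_chain (Suc p) (subtopology X (carrier_of p f)) w" "chain_boundary (Suc p) w = c"
        by (rule contractible_cycle_is_boundary [OF a(2,1) c aug])
      then show ?thesis by blast
    qed
  next
    fix p f k assume f: "f \<in> small (Suc p)" and k: "k \<le> Suc p"
    show "aff p (vertices p (singular_face (Suc p) k f)) = singular_face (Suc p) k (aff (Suc p) (vertices (Suc p) f))"
      using k by (simp add: vertices_face singular_face_affine)
    show "carrier_of p (singular_face (Suc p) k f) \<subseteq> carrier_of (Suc p) f"
    proof
      fix y assume "y \<in> carrier_of p (singular_face (Suc p) k f)"
      then obtain x where x: "x \<in> standard_simplex p"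
        and y: "y \<in> join_of I V pt (singular_face (Suc p) k f x) (set (vertices p (singular_face (Suc p) k f)))"
        by (auto simp: carrier_of_def)
      have "weights V \<rho> \<subseteq> weights V \<tau>" if "\<rho> \<subseteq> \<tau>" for \<rho> \<tau> :: "'v set"
        using that by (auto simp: weights_def)
      then have "join_of I V pt x \<rho> \<subseteq> join_of I V pt x \<tau>" if "\<rho> \<subseteq> \<tau>" for \<rho> \<tau> x
        using that unfolding join_of_def by blast
      moreover have "set (vertices p (singular_face (Suc p) k f)) \<subseteq> set (vertices (Suc p) f)"
        using k set_drop_nth by (simp add: vertices_face)
      ultimately have "y \<in> join_of I V pt (f (simplical_face k x)) (set (vertices (Suc p) f))"
        using y x by (auto simp: singular_face_def)
      moreover have "simplical_face k x \<in> standard_simplex (Suc p)"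
        using simplical_face_in_standard_simplex [of "Suc p" k x] x k by simp
      ultimately show "y \<in> carrier_of (Suc p) f"
        by (auto simp: carrier_of_def)
    qed
  qed
  have "frag_extend (\<lambda>f. frag_of (aff p (vertices p f))) c = aff_chain p (vertex_chain p c)"
    unfolding aff_chain_def vertex_chain_def
    using frag_extend_compose [of "\<lambda>xs. frag_of (aff p xs)" "vertices p" c] by (simp add: o_def)
  then show thesis
    using w that by simp
qed

text \<open>The boundary of \<open>c\<close> is affine and bounds in \<open>X\<close>, hence bounds
  an affine chain. Subtracting that chain leaves an absolute cycle, which is homologous to a
  subdivision and then to an affine cycle.\<close>

theorem rel_acyclic_affine: "rel_acyclic (\<lambda>p. singular_simplex_set p X) (affine_family I pt L)"
  unfolding rel_acyclic_def
proof (intro allI impI, elim conjE)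
  fix p c assume "spanned c (singular_simplex_set p X)"
    and cT: "spanned (chain_boundary p c) (affine_family I pt L (p - 1))"
  then have cX: "singular_chain p X c"
    by (simp add: singular_chain_def)
  obtain y where y: "spanned y (lists p)" "chain_boundary p (c - aff_chain p y) = 0"
  proof (cases p)
    case 0
    show ?thesis
      by (rule that [of 0]) (simp_all add: 0 chain_boundary_def)
  next
    case (Suc q)
    then obtain z where z: "spanned z (lists q)" "aff_chain q z = chain_boundary (Suc q) c"
      using aff_chain_surj [of "chain_boundary (Suc q) c" q] cT by auto
    have "list_boundary z = 0"
    \<comment> \<open>The list chain must be a cycle for the augmented boundary. For
      \<open>q = 0\<close> this is the vanishing augmentation of a boundary; otherwise injectivity
      of \<open>aff_chain\<close> transfers the singular identity.\<close>
    proof (cases q)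
      case 0
      have "cochain_eval (\<lambda>_. 1) z = 0"
        using eval_one_boundary [of c] eval_one_frag_extend [of "aff 0" z] z(2) 0
        by (simp add: aff_chain_def)
      moreover have "list_boundary z = frag_cmul (cochain_eval (\<lambda>_. 1) z) (frag_of [])"
        using z(1) 0
      proof (induction rule: frag_induction)
        case (one xs)
        then show ?case by (simp add: list_boundary_of drop_nth_def 0)
      qed (simp_all add: list_boundary_diff cochain_eval_diff frag_cmul_diff_distrib)
      ultimately show ?thesis by simp
    next
      case (Suc r)
      have "aff_chain r (list_boundary z) = chain_boundary (Suc r) (aff_chain (Suc r) z)"
        by (rule aff_chain_boundary [symmetric]) (use z Suc in auto)
      also have "\<dots> = 0"
        using z(2) cX \<open>p = Suc q\<close> Suc by (simp add: chain_boundary_boundary_alt)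
      finally show ?thesis
        by (rule aff_chain_eq_0 [rotated]) (rule spanned_list_boundary, use z(1) Suc down in auto)
    qed
    moreover have "singular_chain (Suc q) X c"
      using cX Suc by simp
    ultimately obtain y where "spanned y (lists (Suc q))" "list_boundary y = z"
      by (rule list_cycle_bounds [OF z(1) _ _ z(2) [symmetric]])
    moreover from this(1) have "chain_boundary (Suc q) (aff_chain (Suc q) y) = aff_chain q (list_boundary y)"
      by (intro aff_chain_boundary) auto
    ultimately show ?thesis
      using that [of y] z(2) Suc by (simp add: chain_boundary_diff)
  qed
  let ?b = "c - aff_chain p y"
  have bX: "singular_chain p X ?b"
    using cX aff_chain_spanned [OF y(1)] affine_family_singular [of p]
    by (intro singular_chain_diff) (auto simp: singular_chain_def)
  then have "singular_relcycle p X {} ?b"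
    using y by (simp add: singular_cycle)
  obtain n where n: "\<And>m. n \<le> m \<Longrightarrow> spanned ((singular_subdivision p ^^ m) ?b) (small p)"
    using eventually_small [OF bX] by metis
  define b' where "b' = (singular_subdivision p ^^ n) ?b"
  have "homologous_rel p X {} ((singular_subdivision p ^^ k) ?b) ?b \<and> singular_relcycle p X {} ((singular_subdivision p ^^ k) ?b)" for k
  proof (induction k)
    case 0
    then show ?case using \<open>singular_relcycle p X {} ?b\<close> by simp
  next
    case (Suc k)
    let ?k = "(singular_subdivision p ^^ k) ?b"
    have 1: "homologous_rel p X {} (singular_subdivision p ?k) ?k"
      using Suc.IH by (intro homologous_rel_singular_subdivision) blast
    have "homologous_rel p X {} (singular_subdivision p ?k) ?b"
      by (rule homologous_rel_trans [OF _ 1]) (use Suc.IH in blast)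
    moreover have "singular_relcycle p X {} (singular_subdivision p ?k)"
      using homologous_rel_singular_relcycle [OF 1] Suc.IH by blast
    ultimately show ?case
      by simp
  qed
  then have b': "homologous_rel p X {} b' ?b" "chain_boundary p b' = 0"
    by (auto simp: b'_def singular_cycle)
  then obtain w1 where w1: "singular_chain (Suc p) X w1" "chain_boundary (Suc p) w1 = b' - ?b"
    by (auto simp: homologous_rel_def singular_boundary)
  have bs: "spanned b' (small p)"
    using n by (simp add: b'_def)
  obtain w2 where w2: "singular_chain (Suc p) X w2" "chain_boundary (Suc p) w2 = b' - aff_chain p (vertex_chain p b')"
    by (rule small_cycle_homologous [OF bs b'(2)])
  have "c - chain_boundary (Suc p) (w2 - w1) = aff_chain p y + aff_chain p (vertex_chain p b')"
    using w1 w2 by (simp add: chain_boundary_diff algebra_simps)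
  moreover have "spanned \<dots> (affine_family I pt L p)"
    using y(1) vertex_chain_small [OF bs] by (intro spanned_add aff_chain_spanned)
  ultimately show "\<exists>w. spanned w (singular_simplex_set (Suc p) X) \<and>
      spanned (c - chain_boundary (Suc p) w) (affine_family I pt L p)"
    using singular_chain_diff [OF w2(1) w1(1)] unfolding singular_chain_def by metis
qed

end

section \<open>Comparison with cochains on vertex lists\<close>

text \<open>Mayer-Vietoris with \<open>T\<close> the affine simplices and \<open>G\<close>,
  \<open>H\<close> the simplices of two subspaces. Adding \<open>G\<close> and then \<open>H\<close>
  to \<open>T\<close> changes no homology, by two excisions; the second needs \<open>H\<close>
  relative to its overlap with \<open>G \<union> T\<close>, where the hypothesis on
  \<open>G \<inter> H\<close> enters. Since \<open>E\<close> and the enlarged family both compare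
  with \<open>T\<close>, they compare with each other.\<close>

lemma rel_acyclic_pair:
  assumes ET: "rel_acyclic E T" and GT: "rel_acyclic G (\<lambda>p. G p \<inter> T p)"
    and HT: "rel_acyclic H (\<lambda>p. H p \<inter> T p)" and GHT: "rel_acyclic (\<lambda>p. G p \<inter> H p) (\<lambda>p. G p \<inter> H p \<inter> T p)"
    and closed: "face_closed T" "face_closed G" "face_closed H"
    and sub: "\<And>p. T p \<subseteq> E p" "\<And>p. G p \<subseteq> E p" "\<And>p. H p \<subseteq> E p"
    and X: "\<And>p. E p \<subseteq> singular_simplex_set p X"
  shows "rel_acyclic E (\<lambda>p. T p \<union> (G p \<union> H p))"
proof -
  have subX: "T p \<subseteq> singular_simplex_set p X" "G p \<subseteq> singular_simplex_set p X" "H p \<subseteq> singular_simplex_set p X" for p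
    using sub [of p] X [of p] by blast+
  have 1: "rel_acyclic (\<lambda>p. G p \<union> T p) T"
    by (rule rel_acyclic_excision [OF GT]) (rule closed)+
  have "rel_acyclic (\<lambda>p. G p \<inter> H p) (\<lambda>p. (G p \<inter> H p) \<inter> (H p \<inter> T p))"
    using GHT by (simp add: Int_ac)
  then have 2: "rel_acyclic (\<lambda>p. (G p \<inter> H p) \<union> (H p \<inter> T p)) (\<lambda>p. H p \<inter> T p)"
    by (rule rel_acyclic_excision) (intro face_closed_Int closed)+
  have 3: "rel_acyclic H (\<lambda>p. (G p \<inter> H p) \<union> (H p \<inter> T p))"
    by (rule rel_acyclic_middle [OF HT 2, where X = X])
       (use subX in \<open>auto intro!: face_closed_Un face_closed_Int closed\<close>)
  have "(\<lambda>p. (G p \<inter> H p) \<union> (H p \<inter> T p)) = (\<lambda>p. H p \<inter> (G p \<union> T p))"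
    by auto
  with 3 have 4: "rel_acyclic (\<lambda>p. H p \<union> (G p \<union> T p)) (\<lambda>p. G p \<union> T p)"
    by (intro rel_acyclic_excision face_closed_Un closed) simp
  have 5: "rel_acyclic (\<lambda>p. H p \<union> (G p \<union> T p)) T"
    by (rule rel_acyclic_trans [OF 4 1, where X = X]) (use subX closed in auto)
  have "rel_acyclic E (\<lambda>p. H p \<union> (G p \<union> T p))"
    by (rule rel_acyclic_middle [OF ET 5, where X = X])
       (use sub X in \<open>auto intro!: face_closed_Un closed\<close>)
  moreover have "(\<lambda>p. H p \<union> (G p \<union> T p)) = (\<lambda>p. T p \<union> (G p \<union> H p))"
    by auto
  ultimately show ?thesis by simp
qed

section \<open>Cochains on vertex lists and the restriction of singular cochains to them\<close>

type_synonym 'v list_cochain = "'v list \<Rightarrow> int"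

definition list_cochains :: "nat \<Rightarrow> 'v set set \<Rightarrow> 'v set set \<Rightarrow> 'v list_cochain set" where
  "list_cochains p L B = {a. \<forall>xs. \<not> (length xs = Suc p \<and> set xs \<in> L \<and> set xs \<notin> B) \<longrightarrow> a xs = 0}"

definition list_coboundary :: "nat \<Rightarrow> 'v set set \<Rightarrow> 'v list_cochain \<Rightarrow> 'v list_cochain" where
  "list_coboundary p L a = (\<lambda>xs. if length xs = Suc (Suc p) \<and> set xs \<in> L
     then \<Sum>k\<le>Suc p. (-1) ^ k * a (drop_nth k xs) else 0)"

definition list_coboundaries :: "nat \<Rightarrow> 'v set set \<Rightarrow> 'v set set \<Rightarrow> 'v list_cochain set" where
  "list_coboundaries p L B = (case p of 0 \<Rightarrow> {\<lambda>_. 0} | Suc q \<Rightarrow> list_coboundary q L ` list_cochains q L B)"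

definition on_lists :: "'i set \<Rightarrow> ('v \<Rightarrow> 'i \<Rightarrow> real) \<Rightarrow> 'v set set \<Rightarrow> nat \<Rightarrow> ('i \<Rightarrow> real) cochain \<Rightarrow> 'v list_cochain" where
  "on_lists I pt L p u = (\<lambda>xs. if length xs = Suc p \<and> set xs \<in> L then u (affine_simplex I pt p xs) else 0)"

lemma on_lists_diff: "on_lists I pt L p (\<lambda>f. u f - v f) = (\<lambda>xs. on_lists I pt L p u xs - on_lists I pt L p v xs)"
  and on_lists_add: "on_lists I pt L p (\<lambda>f. u f + v f) = (\<lambda>xs. on_lists I pt L p u xs + on_lists I pt L p v xs)"
  and on_lists_zero: "on_lists I pt L p (\<lambda>_. 0) = (\<lambda>_. 0)"
  and on_lists_sum: "on_lists I pt L p (\<lambda>f. \<Sum>i\<in>A. w i f) = (\<lambda>xs. \<Sum>i\<in>A. on_lists I pt L p (w i) xs)"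
  by (auto simp: on_lists_def fun_eq_iff)

lemma list_coboundary_sum:
  "list_coboundary p L (\<lambda>xs. \<Sum>i\<in>A. a i xs) = (\<lambda>xs. \<Sum>i\<in>A. list_coboundary p L (a i) xs)"
proof
  fix xs
  have "(\<Sum>k\<le>Suc p. (-1) ^ k * (\<Sum>i\<in>A. a i (drop_nth k xs)))
      = (\<Sum>i\<in>A. \<Sum>k\<le>Suc p. (-1) ^ k * a i (drop_nth k xs))"
    unfolding sum_distrib_left by (rule sum.swap)
  then show "list_coboundary p L (\<lambda>xs. \<Sum>i\<in>A. a i xs) xs = (\<Sum>i\<in>A. list_coboundary p L (a i) xs)"
    by (auto simp: list_coboundary_def simp del: sum.atMost_Suc)
qed

text \<open>Instances with \<open>\<A> = {A \<union> B}\<close> and \<open>\<A> = {A, B}\<close>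
  share the same \<open>L\<close> and \<open>B\<close>, so both cochain complexes are compared with
  one complex of list cochains. The acyclicity assumption concerns the simplices on which the kernel
  of the restriction must vanish.\<close>

locale list_comparison =
  fixes I :: "'i set" and pt :: "'v \<Rightarrow> 'i \<Rightarrow> real" and L B :: "'v set set"
    and X :: "('i \<Rightarrow> real) topology" and \<A> :: "('i \<Rightarrow> real) set set"
  assumes down: "\<tau> \<in> L \<Longrightarrow> \<rho> \<subseteq> \<tau> \<Longrightarrow> \<rho> \<in> L"
    and inj: "inj_on (affine_simplex I pt p) {xs. length xs = Suc p \<and> set xs \<in> L}"
    and affine_singular: "length xs = Suc p \<Longrightarrow> set xs \<in> L \<Longrightarrow> singular_simplex p X (affine_simplex I pt p xs)"
    and affine_in: "length xs = Suc p \<Longrightarrow> set xs \<in> L \<Longrightarrow>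
      (\<exists>A\<in>\<A>. singular_simplex p (subtopology X A) (affine_simplex I pt p xs)) \<longleftrightarrow> set xs \<in> B"
    and acyclic: "rel_acyclic (\<lambda>p. singular_simplex_set p X)
      (\<lambda>p. affine_family I pt L p \<union> {f. \<exists>A\<in>\<A>. singular_simplex p (subtopology X A) f})"
begin

abbreviation res where "res \<equiv> on_lists I pt L"

lemma res_in_cochains: "u \<in> cochains p X \<A> \<Longrightarrow> res p u \<in> list_cochains p L B"
  using affine_in [of _ p] by (auto simp: cochains_def list_cochains_def on_lists_def)

lemma res_coboundary: "res (Suc p) (coboundary p X u) = list_coboundary p L (res p u)"
proof
  fix xs
  show "res (Suc p) (coboundary p X u) xs = list_coboundary p L (res p u) xs"
  proof (cases "length xs = Suc (Suc p) \<and> set xs \<in> L")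
    case True
    have "set (drop_nth k xs) \<in> L" for k
      by (rule down [OF _ set_drop_nth]) (use True in simp)
    then show ?thesis
      using True affine_singular [of xs "Suc p"]
      by (auto simp: on_lists_def list_coboundary_def coboundary_def singular_face_affine simp del: sum.atMost_Suc)
  qed (auto simp: on_lists_def list_coboundary_def)
qed

lemma res_lift:
  assumes "a \<in> list_cochains p L B"
  obtains u where "u \<in> cochains p X \<A>" "res p u = a"
proof
  let ?D = "{xs. length xs = Suc p \<and> set xs \<in> L}"
  define u where "u f = (if f \<in> affine_simplex I pt p ` ?D then a (inv_into ?D (affine_simplex I pt p) f) else 0)" for f
  have u: "u (affine_simplex I pt p xs) = a xs" if "xs \<in> ?D" for xs
    using that inv_into_f_f [OF inj that] by (auto simp: u_def)
  show "u \<in> cochains p X \<A>"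
    unfolding cochains_def
  proof (intro CollectI conjI allI impI ballI)
    fix f assume "\<not> singular_simplex p X f"
    then show "u f = 0"
      using affine_singular by (auto simp: u_def)
  next
    fix A f assume A: "A \<in> \<A>" "singular_simplex p (subtopology X A) f"
    show "u f = 0"
    proof (cases "f \<in> affine_simplex I pt p ` ?D")
      case True
      then obtain xs where xs: "xs \<in> ?D" "f = affine_simplex I pt p xs"
        by blast
      then have "set xs \<in> B"
        using affine_in [of xs p] A by blast
      then have "a xs = 0"
        using assms by (simp add: list_cochains_def)
      then show ?thesis
        using u xs by simp
    qed (simp add: u_def)
  qed
  show "res p u = a"
    using assms u by (auto simp: on_lists_def list_cochains_def fun_eq_iff)
qed

text \<open>The kernel of the restriction consists of the cochains vanishing on the affine simplices
  and on those of \<open>\<A>\<close>. This is its acyclicity.\<close>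

lemma kernel_cocycle:
  assumes "u \<in> cochains p X \<A>" "coboundary p X u = (\<lambda>_. 0)" "res p u = (\<lambda>_. 0)"
  shows "p = 0 \<and> u = (\<lambda>_. 0) \<or>
    (\<exists>q v. p = Suc q \<and> v \<in> cochains q X \<A> \<and> res q v = (\<lambda>_. 0) \<and> coboundary q X v = u)"
proof -
  let ?F = "\<lambda>p. affine_family I pt L p \<union> {f. \<exists>A\<in>\<A>. singular_simplex p (subtopology X A) f}"
  have "face_closed (\<lambda>p. {f. \<exists>A\<in>\<A>. singular_simplex p (subtopology X A) f})"
    unfolding face_closed_def using singular_face_Suc by blast
  then have F: "face_closed ?F"
    using down by (intro face_closed_Un face_closed_affine_family)
  have FX: "?F p \<subseteq> singular_simplex_set p X" for p
    using affine_singular by (auto simp: affine_family_def singular_simplex_subtopology)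
  have u0: "u f = 0" if f: "f \<in> ?F p" for f
  proof (cases "f \<in> affine_family I pt L p")
    case True
    then obtain xs where "length xs = Suc p" "set xs \<in> L" "f = affine_simplex I pt p xs"
      by (auto simp: affine_family_def)
    then show ?thesis
      using fun_cong [OF assms(3), of xs] by (simp add: on_lists_def)
  qed (use f assms(1) in \<open>auto simp: cochains_def\<close>)
  have "u \<in> cochains p X {}"
    using assms(1) by (simp add: cochains_def)
  from cocycle_vanishing_on_acyclic [OF acyclic F FX this assms(2) u0]
  consider "p = 0" "u = (\<lambda>_. 0)" |
    q v where "p = Suc q" "v \<in> cochains q X {}" "\<forall>f\<in>?F q. v f = 0" "coboundary q X v = u"
    by blast
  then show ?thesis
  proof cases
    case 2
    have "v \<in> cochains q X \<A>"
      using 2(2,3) by (auto simp: cochains_def)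
    moreover have "res q v = (\<lambda>_. 0)"
      using 2(3) by (auto simp: on_lists_def affine_family_def)
    ultimately show ?thesis
      using 2 by blast
  qed simp
qed

text \<open>The coboundary of an arbitrary lift is a cocycle in the kernel; subtracting a primitive
  from the kernel repairs the lift without changing its restriction.\<close>

lemma cocycle_lift:
  assumes "a \<in> list_cochains p L B" "list_coboundary p L a = (\<lambda>_. 0)"
  obtains u where "u \<in> cocycles p X \<A>" "res p u = a"
proof -
  obtain u where u: "u \<in> cochains p X \<A>" "res p u = a"
    using res_lift [OF assms(1)] .
  have "res (Suc p) (coboundary p X u) = (\<lambda>_. 0)"
    by (simp add: res_coboundary u assms)
  then obtain v where v: "v \<in> cochains p X \<A>" "res p v = (\<lambda>_. 0)" "coboundary p X v = coboundary p X u"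
    using kernel_cocycle [OF coboundary_in_cochains [OF u(1)] coboundary_coboundary] by auto
  show thesis
  proof (rule that)
    show "(\<lambda>f. u f - v f) \<in> cocycles p X \<A>"
      using u v by (simp add: cocycles_def cochains_diff coboundary_diff)
    show "res p (\<lambda>f. u f - v f) = a"
      using u v by (simp add: on_lists_diff)
  qed
qed

text \<open>Lifting the primitive of the restriction leaves a cocycle in the kernel, which is again
  a coboundary.\<close>

lemma coboundary_if_res_coboundary:
  assumes u: "u \<in> cocycles p X \<A>" and "res p u \<in> list_coboundaries p L B"
  shows "u \<in> coboundaries p X \<A>"
proof -
  have uc: "u \<in> cochains p X \<A>" "coboundary p X u = (\<lambda>_. 0)"
    using u by (auto simp: cocycles_def)
  show ?thesis
  proof (cases p)
    case 0
    then show ?thesis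
      using kernel_cocycle [OF uc] assms(2) by (auto simp: list_coboundaries_def)
  next
    case (Suc q)
    then obtain a where a: "a \<in> list_cochains q L B" "res p u = list_coboundary q L a"
      using assms(2) by (auto simp: list_coboundaries_def)
    obtain w where w: "w \<in> cochains q X \<A>" "res q w = a"
      using res_lift [OF a(1)] .
    let ?d = "\<lambda>f. u f - coboundary q X w f"
    have "res (Suc q) ?d = (\<lambda>_. 0)"
      using a(2) w by (simp add: on_lists_diff res_coboundary Suc)
    moreover have "?d \<in> cochains (Suc q) X \<A>" "coboundary (Suc q) X ?d = (\<lambda>_. 0)"
      using uc w Suc by (auto simp: cochains_diff coboundary_in_cochains coboundary_diff coboundary_coboundary)
    ultimately obtain v where v: "v \<in> cochains q X \<A>" "coboundary q X v = ?d"
      using kernel_cocycle by blast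
    have "u = coboundary q X (\<lambda>f. v f + w f)"
      by (simp add: coboundary_add v(2))
    moreover have "(\<lambda>f. v f + w f) \<in> cochains q X \<A>"
      by (intro cochains_add v w)
    ultimately show ?thesis
      by (auto simp: coboundaries_def Suc)
  qed
qed

lemma res_coboundaries: "u \<in> coboundaries p X \<A> \<Longrightarrow> res p u \<in> list_coboundaries p L B"
  by (cases p) (auto simp: coboundaries_def list_coboundaries_def res_coboundary res_in_cochains on_lists_zero)

lemma res_eq_imp_class_eq:
  assumes "u \<in> cocycles p X \<A>" "v \<in> cocycles p X \<A>" "res p u = res p v"
  shows "cohomology_class p X \<A> u = cohomology_class p X \<A> v"
  unfolding cohomology_class_eq_iff
proof (rule coboundary_if_res_coboundary)
  have "(\<lambda>_. 0) \<in> list_coboundaries p L B"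
    using res_coboundaries [of "\<lambda>_. 0"] by (simp add: on_lists_zero)
  then show "res p (\<lambda>f. u f - v f) \<in> list_coboundaries p L B"
    using assms by (simp add: on_lists_diff)
qed (use assms in \<open>simp add: cocycles_diff\<close>)

lemma res_cup:
  "res (p + q) (cup_cochain p q X u v) = (\<lambda>xs. if length xs = Suc (p + q) \<and> set xs \<in> L
     then res p u (take (Suc p) xs) * res q v (drop p xs) else 0)"
proof
  fix xs
  show "res (p + q) (cup_cochain p q X u v) xs = (if length xs = Suc (p + q) \<and> set xs \<in> L
     then res p u (take (Suc p) xs) * res q v (drop p xs) else 0)"
  proof (cases "length xs = Suc (p + q) \<and> set xs \<in> L")
    case True
    have "set (take (Suc p) xs) \<in> L"
      by (rule down [OF _ set_take_subset]) (use True in simp)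
    moreover have "set (drop p xs) \<in> L"
      by (rule down [OF _ set_drop_subset]) (use True in simp)
    ultimately show ?thesis
      using True affine_singular [of xs "p + q"]
      by (auto simp: on_lists_def cup_cochain_def front_face_affine back_face_affine)
  qed (auto simp: on_lists_def)
qed

end

text \<open>Cochains relative to \<open>A \<union> B\<close> and relative to the sum have the same
  list cochains. Hence restriction between them is injective on classes, and any cocycle
  \<open>w\<close> of the pair with the list values of the product is its preimage.\<close>

lemma rel_cup_class:
  assumes union: "list_comparison I pt L LB X {A \<union> B}" and pair: "list_comparison I pt L LB X {A, B}"
    and u: "u \<in> cocycles p X {A}" and v: "v \<in> cocycles q X {B}" and w: "w \<in> cocycles (p + q) X {A \<union> B}"
    and eq: "on_lists I pt L (p + q) w = on_lists I pt L (p + q) (cup_cochain p q X u v)"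
  shows "rel_cup p q X A B (cohomology_class p X {A} u) (cohomology_class q X {B} v)
       = cohomology_class (p + q) X {A \<union> B} w"
proof -
  interpret union: list_comparison I pt L LB X "{A \<union> B}" by (rule union)
  interpret pair: list_comparison I pt L LB X "{A, B}" by (rule pair)
  have "inj_on (restrict_to_sum (p + q) X A B) (carrier (rel_cohomology (p + q) X (A \<union> B)))"
  proof (rule inj_onI)
    fix y z assume "y \<in> carrier (rel_cohomology (p + q) X (A \<union> B))" "z \<in> carrier (rel_cohomology (p + q) X (A \<union> B))"
      and yz: "restrict_to_sum (p + q) X A B y = restrict_to_sum (p + q) X A B z"
    then obtain s t where s: "s \<in> cocycles (p + q) X {A \<union> B}" "y = cohomology_class (p + q) X {A \<union> B} s"
      and t: "t \<in> cocycles (p + q) X {A \<union> B}" "z = cohomology_class (p + q) X {A \<union> B} t"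
      by (auto simp: carrier_cohomology_group)
    have "(\<lambda>f. s f - t f) \<in> coboundaries (p + q) X {A, B}"
      using yz by (simp add: s t restrict_to_sum_class cohomology_class_eq_iff)
    then have "(\<lambda>f. s f - t f) \<in> coboundaries (p + q) X {A \<union> B}"
      using s t by (intro union.coboundary_if_res_coboundary pair.res_coboundaries cocycles_diff)
    then show "y = z"
      by (simp add: s t cohomology_class_eq_iff)
  qed
  moreover have "cup_to_sum p q X A B (cohomology_class p X {A} u) (cohomology_class q X {B} v)
      = restrict_to_sum (p + q) X A B (cohomology_class (p + q) X {A \<union> B} w)"
    unfolding cup_to_sum_class [OF u v] restrict_to_sum_class [OF w]
  proof (rule pair.res_eq_imp_class_eq)
    show "w \<in> cocycles (p + q) X {A, B}"
      using w cocycles_sum_subset by blast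
  qed (use u v eq in \<open>simp_all add: cup_cochain_cocycle\<close>)
  ultimately show ?thesis
    using w by (simp add: rel_cup_def the_inv_into_f_f)
qed

text \<open>Reduces the comparison to absolute statements for \<open>S\<close>, \<open>A\<close>,
  \<open>B\<close> and \<open>A \<inter> B\<close>, once the affine simplices inside
  \<open>A\<close> and \<open>B\<close> are identified with \<open>LA\<close> and
  \<open>LB\<close>.\<close>

lemma list_comparison_pair:
  fixes I :: "'i set" and pt :: "'v \<Rightarrow> 'i \<Rightarrow> real"
  defines "T \<equiv> affine_family I pt"
  defines "C \<equiv> \<lambda>A p. singular_simplex_set p (subtopology (powertop_real I) A)"
  assumes down: "\<And>\<tau> \<rho>. \<tau> \<in> L \<Longrightarrow> \<rho> \<subseteq> \<tau> \<Longrightarrow> \<rho> \<in> L"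
    and inj: "\<And>p. inj_on (affine_simplex I pt p) {xs. length xs = Suc p \<and> set xs \<in> L}"
    and sub: "LA \<subseteq> L" "LB \<subseteq> L" "A \<subseteq> S" "B \<subseteq> S"
    and in_S: "\<And>p. T L p \<subseteq> C S p"
    and in_A: "\<And>p xs. length xs = Suc p \<Longrightarrow> set xs \<in> L \<Longrightarrow> affine_simplex I pt p xs \<in> C A p \<longleftrightarrow> set xs \<in> LA"
    and in_B: "\<And>p xs. length xs = Suc p \<Longrightarrow> set xs \<in> L \<Longrightarrow> affine_simplex I pt p xs \<in> C B p \<longleftrightarrow> set xs \<in> LB"
    and acyc: "rel_acyclic (C S) (T L)" "rel_acyclic (C A) (T LA)" "rel_acyclic (C B) (T LB)"
      "rel_acyclic (C (A \<inter> B)) (T (LA \<inter> LB))"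
  shows "list_comparison I pt L (LA \<union> LB) (subtopology (powertop_real I) S) {A, B}"
proof
  have st: "subtopology (subtopology (powertop_real I) S) A = subtopology (powertop_real I) A"
    "subtopology (subtopology (powertop_real I) S) B = subtopology (powertop_real I) B"
    using sub by (auto simp: subtopology_subtopology Int_absorb1)
  show "\<rho> \<in> L" if "\<tau> \<in> L" "\<rho> \<subseteq> \<tau>" for \<tau> \<rho>
    using down that .
  show "inj_on (affine_simplex I pt p) {xs. length xs = Suc p \<and> set xs \<in> L}" for p
    by (rule inj)
  show "singular_simplex p (subtopology (powertop_real I) S) (affine_simplex I pt p xs)"
    if "length xs = Suc p" "set xs \<in> L" for p xs
    using in_S [of p] that by (auto simp: T_def C_def affine_family_def)
  show "(\<exists>A\<in>{A, B}. singular_simplex p (subtopology (subtopology (powertop_real I) S) A) (affine_simplex I pt p xs))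
      \<longleftrightarrow> set xs \<in> LA \<union> LB"
    if "length xs = Suc p" "set xs \<in> L" for p xs
    using in_A [OF that] in_B [OF that] by (simp add: st C_def)
  have CAB: "(\<lambda>p. C A p \<inter> C B p) = C (A \<inter> B)"
    by (auto simp: C_def singular_simplex_subtopology)
  have TA: "(\<lambda>p. C A p \<inter> T L p) = T LA"
    using in_A sub unfolding T_def affine_family_def by (intro ext) blast
  have TB: "(\<lambda>p. C B p \<inter> T L p) = T LB"
    using in_B sub unfolding T_def affine_family_def by (intro ext) blast
  have TAB: "(\<lambda>p. C A p \<inter> C B p \<inter> T L p) = T (LA \<inter> LB)"
  proof -
    have "C A p \<inter> C B p \<inter> T L p = T (LA \<inter> LB) p" for p
    proof
      show "C A p \<inter> C B p \<inter> T L p \<subseteq> T (LA \<inter> LB) p"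
        using in_A in_B unfolding T_def affine_family_def by blast
      have "T (LA \<inter> LB) p \<subseteq> T LA p" "T (LA \<inter> LB) p \<subseteq> T LB p"
        by (auto simp: T_def affine_family_def)
      then show "T (LA \<inter> LB) p \<subseteq> C A p \<inter> C B p \<inter> T L p"
        using fun_cong [OF TA, of p] fun_cong [OF TB, of p] by blast
    qed
    then show ?thesis by auto
  qed
  have "rel_acyclic (C S) (\<lambda>p. T L p \<union> (C A p \<union> C B p))"
  proof (rule rel_acyclic_pair)
    show "rel_acyclic (C S) (T L)" "rel_acyclic (C A) (\<lambda>p. C A p \<inter> T L p)"
      "rel_acyclic (C B) (\<lambda>p. C B p \<inter> T L p)"
      "rel_acyclic (\<lambda>p. C A p \<inter> C B p) (\<lambda>p. C A p \<inter> C B p \<inter> T L p)"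
      unfolding TAB TA TB CAB by (rule acyc)+
    show "face_closed (T L)" "face_closed (C A)" "face_closed (C B)"
      using down by (auto simp: T_def C_def intro!: face_closed_affine_family face_closed_singular)
    show "T L p \<subseteq> C S p" "C A p \<subseteq> C S p" "C B p \<subseteq> C S p" for p
      using in_S sub singular_simplex_mono [of p "powertop_real I" A _ S] singular_simplex_mono [of p "powertop_real I" B _ S]
      by (auto simp: C_def)
    show "C S p \<subseteq> singular_simplex_set p (powertop_real I)" for p
      by (auto simp: C_def singular_simplex_subtopology)
  qed
  moreover have "(\<lambda>p. T L p \<union> (C A p \<union> C B p)) = (\<lambda>p. affine_family I pt L p \<union>
      {f. \<exists>A\<in>{A, B}. singular_simplex p (subtopology (subtopology (powertop_real I) S) A) f})"
    by (auto simp: T_def C_def st)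
  ultimately show "rel_acyclic (\<lambda>p. singular_simplex_set p (subtopology (powertop_real I) S))
      (\<lambda>p. affine_family I pt L p \<union>
        {f. \<exists>A\<in>{A, B}. singular_simplex p (subtopology (subtopology (powertop_real I) S) A) f})"
    by (simp add: C_def)
qed

section \<open>The two spaces as star covers\<close>

text \<open>In contrast to the barycentric subdivision, the empty simplex may be a member. It plays
  the apex of the cone, so chains of \<open>K\<close> are the simplices of Y.\<close>

definition chain_complex :: "nat set set \<Rightarrow> nat set set set" where
  "chain_complex K = {c. c \<subseteq> K \<and> chain\<^sub>\<subseteq> c}"

lemma chain_complex_down:
  assumes "c \<in> chain_complex K" "d \<subseteq> c" shows "d \<in> chain_complex K"
  unfolding chain_complex_def chain_subset_def
proof (intro CollectI conjI ballI)
  fix \<sigma> \<tau> assume "\<sigma> \<in> d" "\<tau> \<in> d"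
  then have "\<sigma> \<in> c" "\<tau> \<in> c"
    using assms(2) by auto
  then show "\<sigma> \<subseteq> \<tau> \<or> \<tau> \<subseteq> \<sigma>"
    using assms(1) by (simp add: chain_complex_def chain_subset_def)
qed (use assms in \<open>auto simp: chain_complex_def\<close>)

lemma Union_finite_chain:
  assumes "finite c" "c \<noteq> {}" "chain\<^sub>\<subseteq> c" shows "\<Union>c \<in> c"
  using assms
proof (induction c rule: finite_ne_induct)
  case (insert \<sigma> c)
  then have "\<Union>c \<in> c"
    by (auto simp: chain_subset_def)
  then have "\<Union>c \<subseteq> \<sigma> \<or> \<sigma> \<subseteq> \<Union>c"
    using insert.prems unfolding chain_subset_def by blast
  then have "\<Union>(insert \<sigma> c) = \<sigma> \<or> \<Union>(insert \<sigma> c) = \<Union>c"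
    by auto
  then show ?case
    using \<open>\<Union>c \<in> c\<close> by auto
qed simp

subsection \<open>The cone on the barycentric subdivision\<close>

definition vertex_of :: "nat set \<Rightarrow> nat set option" where
  "vertex_of \<sigma> = (if \<sigma> = {} then None else Some \<sigma>)"

definition unit_at :: "nat set \<Rightarrow> nat set option \<Rightarrow> real" where
  "unit_at \<sigma> = (\<lambda>i. if i = vertex_of \<sigma> then 1 else 0)"

lemma inj_vertex_of: "inj vertex_of"
  by (auto simp: inj_def vertex_of_def split: if_splits)

lemma vertex_of_eq [simp]: "vertex_of \<sigma> = vertex_of \<tau> \<longleftrightarrow> \<sigma> = \<tau>"
  using inj_vertex_of by (auto simp: inj_def)

text \<open>Formed for any set of chains, so that Y, unions of panels and their intersections are
  instances of one construction.\<close>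

definition Y_points :: "nat set set set \<Rightarrow> (nat set option \<Rightarrow> real) set" where
  "Y_points B = realization ((`) vertex_of ` B)"

lemma Y_pointsE:
  assumes "t \<in> Y_points B"
  obtains c where "c \<in> B" "\<And>i. 0 \<le> t i" "\<And>i. t i \<noteq> 0 \<longleftrightarrow> i \<in> vertex_of ` c" "(\<Sum>\<sigma>\<in>c. t (vertex_of \<sigma>)) = 1"
proof -
  obtain c where c: "c \<in> B" "{i. t i \<noteq> 0} = vertex_of ` c"
    using assms by (auto simp: Y_points_def realization_def)
  have "inj_on vertex_of c"
    using inj_vertex_of inj_on_subset by blast
  then have "(\<Sum>\<sigma>\<in>c. t (vertex_of \<sigma>)) = 1"
    using assms c(2) by (simp add: Y_points_def realization_def sum.reindex)
  then show thesis
    using that [OF c(1)] assms c(2) by (auto simp: Y_points_def realization_def)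
qed

lemma Y_pointsI:
  assumes down: "\<And>\<tau> \<rho>. \<tau> \<in> B \<Longrightarrow> \<rho> \<subseteq> \<tau> \<Longrightarrow> \<rho> \<in> B" and \<tau>: "\<tau> \<in> B" "finite \<tau>"
    and t: "\<And>i. 0 \<le> t i" "\<And>i. i \<notin> vertex_of ` \<tau> \<Longrightarrow> t i = 0" "(\<Sum>\<sigma>\<in>\<tau>. t (vertex_of \<sigma>)) = 1"
  shows "t \<in> Y_points B"
proof -
  define c where "c = {\<sigma> \<in> \<tau>. t (vertex_of \<sigma>) \<noteq> 0}"
  have c: "{i. t i \<noteq> 0} = vertex_of ` c"
  proof (rule Set.set_eqI)
    fix i show "i \<in> {i. t i \<noteq> 0} \<longleftrightarrow> i \<in> vertex_of ` c"
      using t(2) [of i] by (auto simp: c_def)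
  qed
  have "inj_on vertex_of c"
    using inj_vertex_of inj_on_subset by blast
  then have "sum t (vertex_of ` c) = (\<Sum>\<sigma>\<in>c. t (vertex_of \<sigma>))"
    by (simp add: sum.reindex)
  also have "\<dots> = 1"
    unfolding t(3) [symmetric] by (rule sum.mono_neutral_left) (use \<tau> in \<open>auto simp: c_def\<close>)
  finally have "sum t {i. t i \<noteq> 0} = 1"
    by (simp add: c)
  moreover have "c \<in> B"
    using down [OF \<tau>(1), of c] by (auto simp: c_def)
  ultimately show ?thesis
    using t(1) c unfolding Y_points_def realization_def by simp
qed

lemma Y_points_Int: "Y_points (B \<inter> B') = Y_points B \<inter> Y_points B'"
proof -
  have "(`) vertex_of ` (B \<inter> B') = (`) vertex_of ` B \<inter> (`) vertex_of ` B'"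
    using inj_vertex_of by (intro image_Int) (simp add: inj_image_eq_iff inj_def)
  then show ?thesis
    by (auto simp: Y_points_def realization_def)
qed

lemma Y_points_Union: "Y_points (\<Union>j\<in>J. B j) = (\<Union>j\<in>J. Y_points (B j))"
  by (auto simp: Y_points_def realization_def image_UN)

lemma sum_unit_at:
  assumes "finite V" "\<sigma> \<in> V"
  shows "(\<Sum>\<tau>\<in>V. w \<tau> * unit_at \<tau> (vertex_of \<sigma>)) = w \<sigma>"
  using assms by (simp add: unit_at_def if_distrib [of "\<lambda>c. _ * c"] cong: if_cong)

lemma sum_unit_at_0:
  assumes "i \<notin> vertex_of ` V" shows "(\<Sum>\<tau>\<in>V. w \<tau> * unit_at \<tau> i) = 0"
  using assms by (auto simp: unit_at_def intro!: sum.neutral)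

abbreviation Y_top :: "nat set set set \<Rightarrow> (nat set option \<Rightarrow> real) topology" where
  "Y_top B \<equiv> subtopology (powertop_real UNIV) (Y_points B)"

text \<open>With genuine barycentric coordinates, a simplex is its own carrier and any of its
  vertices can serve as cone point.\<close>

lemma Y_star_cover:
  assumes finite: "finite K" and B: "\<And>\<tau>. \<tau> \<in> B \<Longrightarrow> \<tau> \<subseteq> K"
    and down: "\<And>\<tau> \<rho>. \<tau> \<in> B \<Longrightarrow> \<rho> \<subseteq> \<tau> \<Longrightarrow> \<rho> \<in> B"
  shows "star_cover B (\<lambda>\<tau>. \<tau>) (\<lambda>\<tau>. SOME v. v \<in> \<tau>) UNIV (Y_points B) K unit_at (\<lambda>\<sigma> x. x (vertex_of \<sigma>))"
proof
  have apex: "(SOME v. v \<in> \<tau>) \<in> \<tau>" if "\<tau> \<noteq> {}" for \<tau> :: "nat set set"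
    using that some_in_eq by blast
  show "(SOME v. v \<in> \<tau>) \<in> \<tau>" if "\<tau> \<noteq> {}" for \<tau> :: "nat set set"
    by (rule apex [OF that])
  show "insert (SOME v. v \<in> \<tau>) \<rho> \<in> B" if "\<tau> \<in> B" "\<tau> \<noteq> {}" "\<rho> \<subseteq> \<tau>" for \<tau> \<rho>
    by (rule down [OF that(1)]) (use apex [OF that(2)] that(3) in blast)
  show "finite K" by (rule finite)
  have fin: "finite \<tau>" if "\<tau> \<in> B" for \<tau>
    using B [OF that] finite finite_subset by blast
  show "hull_of UNIV K unit_at \<tau> \<subseteq> Y_points B" if \<tau>: "\<tau> \<in> B" for \<tau>
  proof
    fix y assume "y \<in> hull_of UNIV K unit_at \<tau>"
    then obtain w where w: "w \<in> weights K \<tau>" "sum w K = 1" "y = (\<lambda>j. \<Sum>v\<in>K. w v * unit_at v j)"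
      by (auto simp: hull_of_def restrict_def)
    have y: "y (vertex_of \<sigma>) = w \<sigma>" if "\<sigma> \<in> K" for \<sigma>
      using sum_unit_at [OF finite that] w(3) by simp
    show "y \<in> Y_points B"
    proof (rule Y_pointsI [OF down \<tau> fin [OF \<tau>]])
      show "0 \<le> y i" for i
        unfolding w(3) using w(1) by (intro sum_nonneg) (auto simp: weights_def unit_at_def)
      show "y i = 0" if "i \<notin> vertex_of ` \<tau>" for i
      proof (cases "i \<in> vertex_of ` K")
        case True
        then show ?thesis using y w(1) that by (auto simp: weights_def)
      qed (simp add: w(3) sum_unit_at_0)
      have "(\<Sum>\<sigma>\<in>\<tau>. y (vertex_of \<sigma>)) = (\<Sum>\<sigma>\<in>\<tau>. w \<sigma>)"
        using y B [OF \<tau>] by (intro sum.cong) auto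
      also have "\<dots> = sum w K"
        by (rule sum.mono_neutral_left) (use finite B [OF \<tau>] w(1) in \<open>auto simp: weights_def\<close>)
      finally show "(\<Sum>\<sigma>\<in>\<tau>. y (vertex_of \<sigma>)) = 1"
        using w(2) by simp
    qed
  qed
  show "u = v" if "\<And>j. j \<in> UNIV \<Longrightarrow> unit_at u j = unit_at v j" for u v
    using that [of "vertex_of u"] by (simp add: unit_at_def split: if_splits)
  show "continuous_map (Y_top B) euclideanreal (\<lambda>x. x (vertex_of v))" for v
    by (intro continuous_map_from_subtopology continuous_map_product_projection) simp
  show "\<exists>v\<in>K. 0 < x (vertex_of v)" if "x \<in> Y_points B" for x
  proof -
    from that obtain c where c: "c \<in> B" "\<And>i. 0 \<le> x i" "\<And>i. x i \<noteq> 0 \<longleftrightarrow> i \<in> vertex_of ` c" "(\<Sum>\<sigma>\<in>c. x (vertex_of \<sigma>)) = 1"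
      by (rule Y_pointsE) (rule that)
    then have "c \<noteq> {}" by auto
    then obtain \<sigma> where "\<sigma> \<in> c" by blast
    then have "\<sigma> \<in> K" "x (vertex_of \<sigma>) \<noteq> 0"
      using B [OF c(1)] c(3) by blast+
    then show ?thesis
      using c(2) by (metis less_eq_real_def)
  qed
  \<comment> \<open>The support \<open>c\<close> of \<open>x\<close> contains every vertex whose
    star contains \<open>x\<close>, so joins with such vertices stay in the closed simplex of
    \<open>c\<close>.\<close>
  have star: "\<exists>c\<in>B. \<tau> \<subseteq> c \<and> (\<forall>i. x i \<noteq> 0 \<longleftrightarrow> i \<in> vertex_of ` c) \<and> (\<forall>i. 0 \<le> x i) \<and> (\<Sum>\<sigma>\<in>c. x (vertex_of \<sigma>)) = 1"
    if "x \<in> Y_points B" "\<And>v. v \<in> \<tau> \<Longrightarrow> 0 < x (vertex_of v)" for x \<tau>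
  proof -
    from that(1) obtain c where c: "c \<in> B" "\<And>i. 0 \<le> x i" "\<And>i. x i \<noteq> 0 \<longleftrightarrow> i \<in> vertex_of ` c" "(\<Sum>\<sigma>\<in>c. x (vertex_of \<sigma>)) = 1"
      by (rule Y_pointsE) (rule that)
    have "\<tau> \<subseteq> c"
    proof
      fix v assume "v \<in> \<tau>"
      then have "vertex_of v \<in> vertex_of ` c"
        using that(2) c(3) by (metis less_irrefl)
      then show "v \<in> c" by auto
    qed
    with c show ?thesis by blast
  qed
  show "\<tau> \<in> B" if "x \<in> Y_points B" "\<And>v. v \<in> \<tau> \<Longrightarrow> 0 < x (vertex_of v)" for x \<tau>
  proof -
    from star [OF that] obtain c where "c \<in> B" "\<tau> \<subseteq> c"
      by blast
    then show ?thesis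
      by (rule down)
  qed
  show "join_of UNIV K unit_at x \<tau> \<subseteq> Y_points B"
    if "x \<in> Y_points B" "\<And>v. v \<in> \<tau> \<Longrightarrow> 0 < x (vertex_of v)" for x \<tau>
  proof
    fix y assume "y \<in> join_of UNIV K unit_at x \<tau>"
    then obtain w where w: "w \<in> weights K \<tau>" "y = (\<lambda>j. (1 - sum w K) * x j + (\<Sum>v\<in>K. w v * unit_at v j))"
      by (auto simp: join_of_def restrict_def)
    from star [OF that] obtain c where c: "c \<in> B" "\<tau> \<subseteq> c" "\<And>i. x i \<noteq> 0 \<longleftrightarrow> i \<in> vertex_of ` c" "\<And>i. 0 \<le> x i" "(\<Sum>\<sigma>\<in>c. x (vertex_of \<sigma>)) = 1"
      by blast
    have y: "y (vertex_of \<sigma>) = (1 - sum w K) * x (vertex_of \<sigma>) + w \<sigma>" if "\<sigma> \<in> K" for \<sigma>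
      using sum_unit_at [OF finite that] w(2) by simp
    have w1: "sum w K \<le> 1" "\<And>v. 0 \<le> w v" "\<And>v. v \<notin> \<tau> \<Longrightarrow> w v = 0"
      using w(1) by (auto simp: weights_def)
    show "y \<in> Y_points B"
    proof (rule Y_pointsI [OF down c(1) fin [OF c(1)]])
      have "0 \<le> (\<Sum>v\<in>K. w v * unit_at v i)" for i
        using w1 by (intro sum_nonneg) (auto simp: unit_at_def)
      then show "0 \<le> y i" for i
        unfolding w(2) using w1 c(4) by simp
      show "y i = 0" if "i \<notin> vertex_of ` c" for i
      proof (cases "i \<in> vertex_of ` K")
        case True
        then obtain \<sigma> where "\<sigma> \<in> K" "i = vertex_of \<sigma>" by blast
        then show ?thesis using y [of \<sigma>] w1(3) [of \<sigma>] c(2) c(3) [of i] that by auto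
      next
        case False
        then show ?thesis using c(3) [of i] that by (simp add: w(2) sum_unit_at_0)
      qed
      have "(\<Sum>\<sigma>\<in>c. y (vertex_of \<sigma>)) = (\<Sum>\<sigma>\<in>c. (1 - sum w K) * x (vertex_of \<sigma>) + w \<sigma>)"
        using y B [OF c(1)] by (intro sum.cong) auto
      also have "\<dots> = (1 - sum w K) + sum w c"
        using c(5) by (simp add: sum.distrib flip: sum_distrib_left)
      also have "sum w c = sum w K"
        by (rule sum.mono_neutral_left) (use finite B [OF c(1)] w1(3) c(2) in auto)
      finally show "(\<Sum>\<sigma>\<in>c. y (vertex_of \<sigma>)) = 1" by simp
    qed
  qed
  show "v \<in> \<tau>" if "x \<in> hull_of UNIV K unit_at \<tau>" "v \<in> K" "0 < x (vertex_of v)" for \<tau> x v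
  proof -
    from that(1) obtain w where w: "w \<in> weights K \<tau>" "x = (\<lambda>j. \<Sum>v\<in>K. w v * unit_at v j)"
      by (auto simp: hull_of_def restrict_def)
    then have "x (vertex_of v) = w v"
      using sum_unit_at [OF finite that(2), of w] by simp
    then have "w v \<noteq> 0"
      using that(3) by simp
    then show ?thesis
      using w(1) by (auto simp: weights_def)
  qed
qed (use B down in auto)

lemma affine_in_Y_points_iff:
  assumes xs: "length xs = Suc p" "set xs \<subseteq> K" and finite: "finite K"
    and B: "\<And>\<tau>. \<tau> \<in> B \<Longrightarrow> \<tau> \<subseteq> K" and down: "\<And>\<tau> \<rho>. \<tau> \<in> B \<Longrightarrow> \<rho> \<subseteq> \<tau> \<Longrightarrow> \<rho> \<in> B"
  shows "singular_simplex p (Y_top B) (affine_simplex UNIV unit_at p xs)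
    \<longleftrightarrow> set xs \<in> B"
proof
  interpret star_cover B "\<lambda>\<tau>. \<tau>" "\<lambda>\<tau>. SOME v. v \<in> \<tau>" UNIV "Y_points B" K unit_at "\<lambda>\<sigma> x. x (vertex_of \<sigma>)"
    by (rule Y_star_cover [OF finite B down])
  show "singular_simplex p (Y_top B) (affine_simplex UNIV unit_at p xs)"
    if "set xs \<in> B"
    using aff_singular [of xs p] xs that by simp
next
  assume s: "singular_simplex p (Y_top B) (affine_simplex UNIV unit_at p xs)"
  \<comment> \<open>The barycentre: all positions have positive weight, so the support of its image
    is exactly the set of listed vertices and determines the chain.\<close>
  define b :: "nat \<Rightarrow> real" where "b i = (if i \<le> p then 1 / (real p + 1) else 0)" for i
  have b: "b \<in> standard_simplex p"
    by (auto simp: standard_simplex_def b_def field_simps)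
  define t where "t = affine_simplex UNIV unit_at p xs b"
  have t: "t j = (\<Sum>i\<le>p. b i * unit_at (xs ! i) j)" for j
    using b by (simp add: t_def affine_simplex_def)
  have "t j \<noteq> 0 \<longleftrightarrow> j \<in> vertex_of ` set xs" for j
  proof -
    have "t j = 0 \<longleftrightarrow> (\<forall>i\<in>{..p}. b i * unit_at (xs ! i) j = 0)"
      unfolding t by (rule sum_nonneg_eq_0_iff) (auto simp: b_def unit_at_def)
    also have "\<dots> \<longleftrightarrow> (\<forall>i\<le>p. j \<noteq> vertex_of (xs ! i))"
      by (auto simp: b_def unit_at_def)
    also have "\<dots> \<longleftrightarrow> j \<notin> vertex_of ` set xs"
    proof -
      have "set xs = (\<lambda>i. xs ! i) ` {..p}"
        using xs(1) by (auto simp: set_conv_nth less_Suc_eq_le)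
      then show ?thesis by auto
    qed
    finally show ?thesis by blast
  qed
  moreover have "t \<in> Y_points B"
    using s b by (auto simp: singular_simplex_subtopology t_def)
  then obtain c where "c \<in> B" "\<And>i. t i \<noteq> 0 \<longleftrightarrow> i \<in> vertex_of ` c"
    by (rule Y_pointsE) blast
  ultimately have "vertex_of ` set xs = vertex_of ` c" "c \<in> B"
    by auto
  then show "set xs \<in> B"
    using inj_vertex_of by (simp add: inj_image_eq_iff)
qed

lemma Y_list_comparison:
  assumes finite: "finite K" and LA: "LA \<subseteq> L" and LB: "LB \<subseteq> L"
    and L: "\<And>\<tau>. \<tau> \<in> L \<Longrightarrow> \<tau> \<subseteq> K"
    and closed: "\<And>\<tau> \<rho>. \<tau> \<in> L \<Longrightarrow> \<rho> \<subseteq> \<tau> \<Longrightarrow> \<rho> \<in> L"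
      "\<And>\<tau> \<rho>. \<tau> \<in> LA \<Longrightarrow> \<rho> \<subseteq> \<tau> \<Longrightarrow> \<rho> \<in> LA" "\<And>\<tau> \<rho>. \<tau> \<in> LB \<Longrightarrow> \<rho> \<subseteq> \<tau> \<Longrightarrow> \<rho> \<in> LB"
  shows "list_comparison UNIV unit_at L (LA \<union> LB) (Y_top L) {Y_points LA, Y_points LB}"
proof (rule list_comparison_pair)
  have acyc: "rel_acyclic (\<lambda>p. singular_simplex_set p (Y_top M)) (affine_family UNIV unit_at M)"
    if "M \<subseteq> L" "\<And>\<tau> \<rho>. \<tau> \<in> M \<Longrightarrow> \<rho> \<subseteq> \<tau> \<Longrightarrow> \<rho> \<in> M" for M
  proof -
    interpret star_cover M "\<lambda>\<tau>. \<tau>" "\<lambda>\<tau>. SOME v. v \<in> \<tau>" UNIV "Y_points M" K unit_at "\<lambda>\<sigma> x. x (vertex_of \<sigma>)"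
      by (rule Y_star_cover [OF finite]) (use that L in blast)+
    show ?thesis by (rule rel_acyclic_affine)
  qed
  show "rel_acyclic (\<lambda>p. singular_simplex_set p (Y_top L)) (affine_family UNIV unit_at L)"
    by (rule acyc) (use closed in auto)
  show "rel_acyclic (\<lambda>p. singular_simplex_set p (Y_top LA)) (affine_family UNIV unit_at LA)"
    by (rule acyc) (use closed LA in auto)
  show "rel_acyclic (\<lambda>p. singular_simplex_set p (Y_top LB)) (affine_family UNIV unit_at LB)"
    by (rule acyc) (use closed LB in auto)
  show "rel_acyclic (\<lambda>p. singular_simplex_set p (subtopology (powertop_real UNIV) (Y_points LA \<inter> Y_points LB)))
      (affine_family UNIV unit_at (LA \<inter> LB))"
    unfolding Y_points_Int [symmetric] by (rule acyc) (use closed LA in auto)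
  interpret star_cover L "\<lambda>\<tau>. \<tau>" "\<lambda>\<tau>. SOME v. v \<in> \<tau>" UNIV "Y_points L" K unit_at "\<lambda>\<sigma> x. x (vertex_of \<sigma>)"
    by (rule Y_star_cover [OF finite L closed(1)])
  show "inj_on (affine_simplex UNIV unit_at p) {xs. length xs = Suc p \<and> set xs \<in> L}" for p
    by (rule aff_inj)
  show "affine_family UNIV unit_at L p \<subseteq> singular_simplex_set p (Y_top L)" for p
    by (rule affine_family_singular)
  show "(affine_simplex UNIV unit_at p xs \<in> singular_simplex_set p (Y_top LA)) = (set xs \<in> LA)"
    if "length xs = Suc p" "set xs \<in> L" for p xs
    using affine_in_Y_points_iff [OF that(1) L [OF that(2)] finite, of LA] LA L closed(2) by blast
  show "(affine_simplex UNIV unit_at p xs \<in> singular_simplex_set p (Y_top LB)) = (set xs \<in> LB)"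
    if "length xs = Suc p" "set xs \<in> L" for p xs
    using affine_in_Y_points_iff [OF that(1) L [OF that(2)] finite, of LB] LB L closed(3) by blast
  have "realization M \<subseteq> realization M'" if "M \<subseteq> M'" for M M' :: "nat set option set set"
    using that by (auto simp: realization_def)
  then show "Y_points LA \<subseteq> Y_points L" "Y_points LB \<subseteq> Y_points L"
    unfolding Y_points_def using LA LB by (meson image_mono)+
qed (use LA LB closed in auto)

text \<open>The chains in the panels over \<open>J\<close>; there are none for
  \<open>J = {}\<close>, in accordance with the empty union.\<close>

definition panel_chains :: "nat set set \<Rightarrow> nat set \<Rightarrow> nat set set set" where
  "panel_chains K J = {c \<in> chain_complex K. \<exists>j\<in>J. \<forall>\<sigma>\<in>c. j \<in> \<sigma>}"

lemma panel_chains_down: "c \<in> panel_chains K J \<Longrightarrow> d \<subseteq> c \<Longrightarrow> d \<in> panel_chains K J"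
  using chain_complex_down unfolding panel_chains_def by blast

lemma panel_chains_Un: "panel_chains K (J \<union> J') = panel_chains K J \<union> panel_chains K J'"
  by (auto simp: panel_chains_def)

text \<open>Members of a chain in the panel of \<open>j\<close> contain \<open>j\<close>, so they
  are nonempty and the apex does not occur.\<close>

lemma union_over_panels:
  assumes "finite K" shows "union_over (P_panel K) J = Y_points (panel_chains K J)"
proof -
  have "cone_base (order_complex {\<tau> \<in> K. {j} \<subseteq> \<tau>}) = (`) vertex_of ` panel_chains K {j}" for j
  proof -
    have "order_complex {\<tau> \<in> K. {j} \<subseteq> \<tau>} = panel_chains K {j}"
      using assms finite_subset unfolding order_complex_def panel_chains_def chain_complex_def by blast
    moreover have "Some ` c = vertex_of ` c" if "c \<in> panel_chains K {j}" for c
      using that by (intro image_cong) (auto simp: panel_chains_def vertex_of_def)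
    ultimately show ?thesis
      unfolding cone_base_def by (auto intro!: image_cong)
  qed
  moreover have "panel_chains K J = (\<Union>j\<in>J. panel_chains K {j})"
    by (auto simp: panel_chains_def)
  ultimately show ?thesis
    by (simp add: union_over_def P_panel_def F_face_def Y_points_Union) (simp add: Y_points_def)
qed

lemma cone_vertices:
  assumes "finite K" "{} \<in> K"
  shows "cone_complex (barycentric_subdivision K) = (`) vertex_of ` chain_complex K"
proof
  show "cone_complex (barycentric_subdivision K) \<subseteq> (`) vertex_of ` chain_complex K"
  proof
    fix s assume "s \<in> cone_complex (barycentric_subdivision K)"
    then obtain c where c: "c \<subseteq> K - {{}}" "chain\<^sub>\<subseteq> c" "s = Some ` c \<or> s = insert None (Some ` c)"
      by (auto simp: cone_complex_def cone_base_def barycentric_subdivision_def order_complex_def)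
    have v: "vertex_of ` c = Some ` c"
      using c(1) by (intro image_cong) (auto simp: vertex_of_def)
    have "c \<in> chain_complex K" "insert {} c \<in> chain_complex K"
      using c assms by (auto simp: chain_complex_def chain_subset_def)
    moreover have "vertex_of ` insert {} c = insert None (Some ` c)"
      by (simp add: v) (simp add: vertex_of_def)
    ultimately show "s \<in> (`) vertex_of ` chain_complex K"
      using c(3) v by (metis image_eqI)
  qed
  show "(`) vertex_of ` chain_complex K \<subseteq> cone_complex (barycentric_subdivision K)"
  proof (rule image_subsetI)
    fix c assume c: "c \<in> chain_complex K"
    have "finite c"
      using c assms(1) finite_subset by (auto simp: chain_complex_def)
    then have d: "c - {{}} \<in> barycentric_subdivision K"
      using c by (auto simp: barycentric_subdivision_def order_complex_def chain_complex_def chain_subset_def)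
    have v: "vertex_of ` (c - {{}}) = Some ` (c - {{}})"
      by (intro image_cong) (auto simp: vertex_of_def)
    show "vertex_of ` c \<in> cone_complex (barycentric_subdivision K)"
    proof (cases "{} \<in> c")
      case True
      then have "vertex_of ` c = insert (vertex_of {}) (vertex_of ` (c - {{}}))"
        by auto
      then have "vertex_of ` c = insert None (Some ` (c - {{}}))"
        by (simp add: v) (simp add: vertex_of_def)
      then show ?thesis
        using d by (auto simp: cone_complex_def cone_base_def)
    next
      case False
      then have "vertex_of ` c = Some ` (c - {{}})"
        using v by simp
      then show ?thesis
        using d by (auto simp: cone_complex_def cone_base_def)
    qed
  qed
qed

lemma Y_space_eq:
  assumes "finite K" "{} \<in> K"
  shows "Y_space K = subtopology (powertop_real UNIV) (Y_points (chain_complex K))"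
  by (simp add: Y_space_def Y_points_def cone_vertices [OF assms])

subsection \<open>The real moment-angle complex\<close>

text \<open>
  A vertex \<open>(\<sigma>, N)\<close> stands for the point of the cube with zero set \<open>\<sigma>\<close> and set of negative
  coordinates \<open>N\<close>. The simplices are the lifts of a chain of \<open>K\<close> to the orthant given by a set \<open>N\<close>.
\<close>

definition cube_point :: "nat set \<times> nat set \<Rightarrow> nat \<Rightarrow> real" where
  "cube_point v j = (if j \<in> fst v then 0 else if j \<in> snd v then - 1 else 1)"

text \<open>Zero coordinates carry no sign, hence the difference; different \<open>N\<close> may
  give the same vertex.\<close>

definition lift_vertex :: "nat set \<Rightarrow> nat set \<Rightarrow> nat set \<times> nat set" where
  "lift_vertex N \<sigma> = (\<sigma>, N - \<sigma>)"

definition lifted_chains :: "nat \<Rightarrow> nat set set \<Rightarrow> (nat set \<times> nat set) set set" where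
  "lifted_chains m K = {lift_vertex N ` c | c N. c \<in> chain_complex K \<and> N \<subseteq> {1..m}}"

definition cube_vertices :: "nat \<Rightarrow> nat set set \<Rightarrow> (nat set \<times> nat set) set" where
  "cube_vertices m K = {(\<sigma>, N). \<sigma> \<in> K \<and> N \<subseteq> {1..m} - \<sigma>}"

definition cube_points :: "nat \<Rightarrow> nat set set \<Rightarrow> (nat \<Rightarrow> real) set" where
  "cube_points m K = (\<Union>\<sigma>\<in>K. \<Pi>\<^sub>E j\<in>{1..m}. if j \<in> \<sigma> then {-1..1} else {-1, 1})"

text \<open>For a lifted chain \<open>\<tau>\<close> this is the centre of the smallest face of the cube containing \<open>\<tau>\<close>.\<close>

definition cube_apex :: "(nat set \<times> nat set) set \<Rightarrow> nat set \<times> nat set" where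
  "cube_apex \<tau> = (\<Union>(fst ` \<tau>), \<Union>(snd ` \<tau>) - \<Union>(fst ` \<tau>))"

text \<open>All vertices in the face of the cube complex centred at \<open>cube_apex \<tau>\<close>.
  The zero set of the centre contains those of the other vertices, so the centre extends every chain
  in the face.\<close>

definition cube_face :: "nat \<Rightarrow> nat set set \<Rightarrow> (nat set \<times> nat set) set \<Rightarrow> (nat set \<times> nat set) set" where
  "cube_face m K \<tau> = {v \<in> cube_vertices m K. fst v \<subseteq> fst (cube_apex \<tau>) \<and> snd v - fst (cube_apex \<tau>) = snd (cube_apex \<tau>)}"

text \<open>Positive on the open star of \<open>v\<close>: coordinates outside the zero set have the
  prescribed sign and exceed in absolute value all those in the zero set. The middle factor matters
  when the zero set is all of \<open>{1..m}\<close> and the other products are empty.\<close>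

definition star_function :: "nat \<Rightarrow> nat set \<times> nat set \<Rightarrow> (nat \<Rightarrow> real) \<Rightarrow> real" where
  "star_function m v x =
     (\<Prod>j\<in>{1..m} - fst v. max 0 (cube_point v j * x j)) * (\<Prod>i\<in>fst v. max 0 (1 - \<bar>x i\<bar>))
     * (\<Prod>(i, j)\<in>fst v \<times> ({1..m} - fst v). max 0 (cube_point v j * x j - \<bar>x i\<bar>))"

lemma continuous_map_prod:
  assumes "finite A" "\<And>i. i \<in> A \<Longrightarrow> continuous_map X euclideanreal (f i)"
  shows "continuous_map X euclideanreal (\<lambda>x. \<Prod>i\<in>A. f i x)"
  using assms by (induction A rule: finite_induct) (auto intro: continuous_map_real_mult)

lemma prod_max_pos_iff:
  assumes "finite A" shows "0 < (\<Prod>i\<in>A. max 0 (f i :: real)) \<longleftrightarrow> (\<forall>i\<in>A. 0 < f i)"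
  using assms
proof (induction A rule: finite_induct)
  case (insert a A)
  have "0 \<le> (\<Prod>i\<in>A. max 0 (f i))"
    by (simp add: prod_nonneg)
  then show ?case
    using insert by (auto simp: zero_less_mult_iff)
qed simp

lemma star_function_pos_iff:
  assumes "finite (fst v)"
  shows "0 < star_function m v x \<longleftrightarrow> (\<forall>j\<in>{1..m} - fst v. 0 < cube_point v j * x j) \<and> (\<forall>i\<in>fst v. \<bar>x i\<bar> < 1)
     \<and> (\<forall>i\<in>fst v. \<forall>j\<in>{1..m} - fst v. \<bar>x i\<bar> < cube_point v j * x j)"
proof -
  have nonneg: "0 \<le> (\<Prod>i\<in>A. max 0 (f i :: real))" for A :: "'z set" and f
    by (simp add: prod_nonneg)
  have pos3: "0 < a * b * c \<longleftrightarrow> 0 < a \<and> 0 < b \<and> 0 < c" if "0 \<le> a" "0 \<le> b" "0 \<le> c" for a b c :: real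
    using that by (auto simp: zero_less_mult_iff)
  have "(\<Prod>(i, j)\<in>fst v \<times> ({1..m} - fst v). max 0 (cube_point v j * x j - \<bar>x i\<bar>))
      = (\<Prod>z\<in>fst v \<times> ({1..m} - fst v). max 0 (cube_point v (snd z) * x (snd z) - \<bar>x (fst z)\<bar>))"
    by (simp add: case_prod_unfold)
  then show ?thesis
    unfolding star_function_def using assms
    by (simp add: pos3 prod_nonneg prod_max_pos_iff)
qed

section \<open>The cube complex over a fixed simplicial complex\<close>

locale finite_complex =
  fixes m :: nat and K :: "nat set set"
  assumes complex: "simplicial_complex_on m K"
begin

abbreviation "cube_top \<equiv> subtopology (powertop_real {1..m})"

lemma K_sub: "\<sigma> \<in> K \<Longrightarrow> \<sigma> \<subseteq> {1..m}"
  and empty_K: "{} \<in> K"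
  and K_down: "\<sigma> \<in> K \<Longrightarrow> \<tau> \<subseteq> \<sigma> \<Longrightarrow> \<tau> \<in> K"
  using complex by (auto simp: simplicial_complex_on_def)

lemma finite_K: "finite K"
  by (rule finite_subset [of K "Pow {1..m}"]) (use K_sub in auto)

lemma finite_simplex: "\<sigma> \<in> K \<Longrightarrow> finite \<sigma>"
  using K_sub finite_subset by blast

lemma finite_chain: "c \<in> chain_complex K \<Longrightarrow> finite c"
  using finite_K finite_subset by (auto simp: chain_complex_def)

lemma Union_chain: "c \<in> chain_complex K \<Longrightarrow> c \<noteq> {} \<Longrightarrow> \<Union>c \<in> c \<and> \<Union>c \<in> K"
  using Union_finite_chain [of c] finite_chain [of c] by (auto simp: chain_complex_def)

lemma lifted_chainsE:
  assumes "\<tau> \<in> lifted_chains m K"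
  obtains c N where "c \<in> chain_complex K" "N \<subseteq> {1..m}" "\<tau> = lift_vertex N ` c"
  using assms by (auto simp: lifted_chains_def)

lemma cube_apex_lift:
  assumes "c \<noteq> {}" shows "cube_apex (lift_vertex N ` c) = (\<Union>c, N - \<Union>c)"
  using assms by (auto simp: cube_apex_def lift_vertex_def image_image)

lemma finite_cube_vertices: "finite (cube_vertices m K)"
proof (rule finite_subset)
  show "cube_vertices m K \<subseteq> K \<times> Pow {1..m}"
    by (auto simp: cube_vertices_def)
qed (simp add: finite_K)

lemma lift_in_cube_vertices: "\<sigma> \<in> K \<Longrightarrow> N \<subseteq> {1..m} \<Longrightarrow> lift_vertex N \<sigma> \<in> cube_vertices m K"
  by (auto simp: lift_vertex_def cube_vertices_def)

lemma lifted_chains_vertices: "\<tau> \<in> lifted_chains m K \<Longrightarrow> \<tau> \<subseteq> cube_vertices m K"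
  by (elim lifted_chainsE) (use lift_in_cube_vertices in \<open>auto simp: chain_complex_def\<close>)

lemma lifted_chains_down:
  assumes "\<tau> \<in> lifted_chains m K" "\<rho> \<subseteq> \<tau>" shows "\<rho> \<in> lifted_chains m K"
proof -
  obtain c N where c: "c \<in> chain_complex K" "N \<subseteq> {1..m}" "\<tau> = lift_vertex N ` c"
    by (rule lifted_chainsE [OF assms(1)])
  then obtain d where "d \<subseteq> c" "\<rho> = lift_vertex N ` d"
    using assms(2) by (auto simp: subset_image_iff)
  then show ?thesis
    using c(2) chain_complex_down [OF c(1) \<open>d \<subseteq> c\<close>] unfolding lifted_chains_def by blast
qed

text \<open>If all vertices of a lifted chain lie in the face of \<open>\<tau>\<close>, their zero
  sets lie below that of the centre and their signs agree with it outside. So the centre is a lift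
  by the same sign set and extends the chain at the top.\<close>

lemma cube_cone_carrier: "cone_carrier (lifted_chains m K) (cube_face m K) cube_apex"
proof
  show "\<rho> \<in> lifted_chains m K" if "\<tau> \<in> lifted_chains m K" "\<rho> \<subseteq> \<tau>" for \<tau> \<rho>
    by (rule lifted_chains_down [OF that])
  fix \<tau> assume \<tau>: "\<tau> \<in> lifted_chains m K"
  then obtain c N where c: "c \<in> chain_complex K" "N \<subseteq> {1..m}" "\<tau> = lift_vertex N ` c"
    by (rule lifted_chainsE)
  show "\<tau> \<subseteq> cube_face m K \<tau>" if "\<tau> \<noteq> {}"
  proof
    fix v assume v: "v \<in> \<tau>"
    then obtain \<sigma> where \<sigma>: "\<sigma> \<in> c" "v = (\<sigma>, N - \<sigma>)"
      using c(3) by (auto simp: lift_vertex_def)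
    then have "cube_apex \<tau> = (\<Union>c, N - \<Union>c)"
      unfolding c(3) by (intro cube_apex_lift) auto
    then show "v \<in> cube_face m K \<tau>"
      unfolding cube_face_def using lifted_chains_vertices [OF \<tau>] v \<sigma> by auto
  qed
  show "cube_face m K \<rho> \<subseteq> cube_face m K \<tau>" if "\<rho> \<subseteq> \<tau>" "\<rho> \<noteq> {}" for \<rho>
  proof -
    from that(1) obtain d where d: "d \<subseteq> c" "\<rho> = lift_vertex N ` d"
      unfolding c(3) subset_image_iff by blast
    have "d \<noteq> {}" "c \<noteq> {}" "\<Union>d \<subseteq> \<Union>c"
      using that d by auto
    have diff: "B - C = N - C" if "B - D = N - D" "D \<subseteq> C" for B C D :: "nat set"
      using that by blast
    have apex: "cube_apex \<rho> = (\<Union>d, N - \<Union>d)" "cube_apex \<tau> = (\<Union>c, N - \<Union>c)"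
      unfolding d(2) c(3) by (rule cube_apex_lift, fact)+
    show ?thesis
    proof
      fix v assume "v \<in> cube_face m K \<rho>"
      then have "v \<in> cube_vertices m K" "fst v \<subseteq> \<Union>d" "snd v - \<Union>d = N - \<Union>d"
        by (simp_all add: cube_face_def apex)
      then show "v \<in> cube_face m K \<tau>"
        using diff [of "snd v" "\<Union>d" "\<Union>c"] \<open>\<Union>d \<subseteq> \<Union>c\<close> by (simp add: cube_face_def apex)
    qed
  qed
  assume "\<tau> \<noteq> {}"
  then have "c \<noteq> {}"
    using c by auto
  then have apex: "cube_apex \<tau> = (\<Union>c, N - \<Union>c)" "\<Union>c \<in> K"
    using c Union_chain by (auto simp: cube_apex_lift)
  then show "cube_apex \<tau> \<in> cube_face m K \<tau>"
    using c(2) by (auto simp: cube_face_def cube_vertices_def)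
  show "insert (cube_apex \<tau>) \<rho> \<in> lifted_chains m K" if \<rho>: "\<rho> \<in> lifted_chains m K" "\<rho> \<subseteq> cube_face m K \<tau>" for \<rho>
  proof -
    obtain d N' where d: "d \<in> chain_complex K" "N' \<subseteq> {1..m}" "\<rho> = lift_vertex N' ` d"
      using \<rho>(1) by (rule lifted_chainsE)
    show ?thesis
    proof (cases "d = {}")
      case True
      \<comment> \<open>An empty \<open>\<rho>\<close> does not tie its sign set to
        \<open>\<tau>\<close>, so the centre is lifted by \<open>N\<close> instead.\<close>
      have "{\<Union>c} \<in> chain_complex K"
        using apex by (simp add: chain_complex_def chain_subset_def)
      moreover have "insert (cube_apex \<tau>) \<rho> = lift_vertex N ` {\<Union>c}"
        using True d apex by (simp add: lift_vertex_def)
      ultimately show ?thesis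
        using c(2) unfolding lifted_chains_def by blast
    next
      case False
      have sub: "\<sigma> \<subseteq> \<Union>c \<and> (N' - \<sigma>) - \<Union>c = N - \<Union>c" if "\<sigma> \<in> d" for \<sigma>
      proof -
        have "(\<sigma>, N' - \<sigma>) \<in> cube_face m K \<tau>"
          using \<rho>(2) that unfolding d(3) by (auto simp: lift_vertex_def)
        then show ?thesis
          by (simp add: cube_face_def apex)
      qed
      obtain \<sigma> where "\<sigma> \<in> d"
        using False by blast
      then have "N' - \<Union>c = N - \<Union>c"
        using sub [of \<sigma>] by blast
      then have "insert (cube_apex \<tau>) \<rho> = lift_vertex N' ` (insert (\<Union>c) d)"
        using d(3) apex by (simp add: lift_vertex_def)
      moreover have "insert (\<Union>c) d \<in> chain_complex K"
        using d(1) apex(2) sub by (simp add: chain_complex_def chain_subset_def)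
      ultimately show ?thesis
        using d(2) unfolding lifted_chains_def by blast
    qed
  qed
qed

lemma cube_pointsE:
  assumes "x \<in> cube_points m K"
  obtains \<sigma> where "\<sigma> \<in> K" "x \<in> extensional {1..m}" "\<And>j. j \<in> {1..m} \<Longrightarrow> \<bar>x j\<bar> \<le> 1" "\<And>j. j \<in> {1..m} - \<sigma> \<Longrightarrow> \<bar>x j\<bar> = 1"
proof -
  obtain \<sigma> where \<sigma>: "\<sigma> \<in> K" "x \<in> (\<Pi>\<^sub>E j\<in>{1..m}. if j \<in> \<sigma> then {-1..1} else {-1, 1})"
    using assms by (auto simp: cube_points_def)
  have x: "x j \<in> (if j \<in> \<sigma> then {-1..1} else {-1, 1})" if "j \<in> {1..m}" for j
    using \<sigma>(2) that by (rule PiE_mem)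
  show thesis
  proof (rule that [OF \<sigma>(1)])
    show "x \<in> extensional {1..m}"
      using \<sigma>(2) by (simp add: PiE_def)
    show "\<bar>x j\<bar> \<le> 1" if "j \<in> {1..m}" for j
      using x [OF that] by (auto split: if_splits)
    show "\<bar>x j\<bar> = 1" if "j \<in> {1..m} - \<sigma>" for j
      using x [of j] that by auto
  qed
qed

lemma cube_pointsI:
  assumes "\<sigma> \<in> K" "x \<in> extensional {1..m}" "\<And>j. j \<in> {1..m} \<Longrightarrow> \<bar>x j\<bar> \<le> 1" "\<And>j. j \<in> {1..m} - \<sigma> \<Longrightarrow> \<bar>x j\<bar> = 1"
  shows "x \<in> cube_points m K"
proof -
  have "x j \<in> (if j \<in> \<sigma> then {-1..1} else {-1, 1})" if "j \<in> {1..m}" for j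
  proof (cases "j \<in> \<sigma>")
    case True
    then show ?thesis using assms(3) [OF that] by (simp add: abs_le_iff)
  next
    case False
    then show ?thesis using assms(4) [of j] that by (simp add: abs_if split: if_splits)
  qed
  then have "x \<in> (\<Pi>\<^sub>E j\<in>{1..m}. if j \<in> \<sigma> then {-1..1} else {-1, 1})"
    using assms(2) by (intro PiE_I) (simp_all add: extensional_def)
  then show ?thesis
    using assms(1) unfolding cube_points_def by blast
qed

lemma sum_cube_point_bound:
  assumes "w \<in> weights V \<tau>" "finite V"
  shows "\<bar>\<Sum>v\<in>V. w v * cube_point v j\<bar> \<le> sum w V"
proof -
  have "\<bar>\<Sum>v\<in>V. w v * cube_point v j\<bar> \<le> (\<Sum>v\<in>V. \<bar>w v * cube_point v j\<bar>)"
    by (rule sum_abs)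
  also have "\<dots> \<le> sum w V"
    using assms by (intro sum_mono) (auto simp: weights_def cube_point_def)
  finally show ?thesis .
qed

lemma sum_cube_point_const:
  assumes "w \<in> weights V \<tau>" "\<And>v. v \<in> \<tau> \<Longrightarrow> cube_point v j = s"
  shows "(\<Sum>v\<in>V. w v * cube_point v j) = sum w V * s"
  unfolding sum_distrib_right
proof (rule sum.cong)
  show "w v * cube_point v j = w v * s" for v
    using assms by (cases "v \<in> \<tau>") (auto simp: weights_def simp del: split_paired_All)
qed simp

text \<open>The subdivision of the cube orders coordinates by absolute value: zero sets of vertices
  whose stars share a point are nested, and coordinates equal to 1 or -1 keep their value along
  joins.\<close>

lemma cube_star_cover:
  "star_cover (lifted_chains m K) (cube_face m K) cube_apex {1..m} (cube_points m K) (cube_vertices m K)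
     cube_point (star_function m)"
proof -
  interpret cone_carrier "lifted_chains m K" "cube_face m K" cube_apex
    by (rule cube_cone_carrier)
  have pos: "0 < star_function m (\<sigma>, N) x \<longleftrightarrow> (\<forall>j\<in>{1..m} - \<sigma>. 0 < cube_point (\<sigma>, N) j * x j) \<and> (\<forall>i\<in>\<sigma>. \<bar>x i\<bar> < 1)
     \<and> (\<forall>i\<in>\<sigma>. \<forall>j\<in>{1..m} - \<sigma>. \<bar>x i\<bar> < cube_point (\<sigma>, N) j * x j)" if "\<sigma> \<in> K" for \<sigma> N x
    using star_function_pos_iff [of "(\<sigma>, N)" m x] finite_simplex [OF that] by simp
  \<comment> \<open>Outside \<open>\<Union>c\<close> all vertices of the lifted chain have the same
    sign, so these coordinates are constant on the hull; \<open>\<Union>c\<close> is a member of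
    \<open>c\<close>, hence a simplex of \<open>K\<close>.\<close>
  have hull: "\<exists>c N. c \<in> chain_complex K \<and> c \<noteq> {} \<and> N \<subseteq> {1..m} \<and> \<tau> = lift_vertex N ` c \<and> y \<in> extensional {1..m}
      \<and> (\<forall>j\<in>{1..m}. \<bar>y j\<bar> \<le> 1) \<and> (\<forall>j\<in>{1..m} - \<Union>c. y j = (if j \<in> N then -1 else 1))"
    if \<tau>: "\<tau> \<in> lifted_chains m K" and y: "y \<in> hull_of {1..m} (cube_vertices m K) cube_point \<tau>" for \<tau> y
  proof -
    obtain c N where c: "c \<in> chain_complex K" "N \<subseteq> {1..m}" "\<tau> = lift_vertex N ` c"
      by (rule lifted_chainsE [OF \<tau>])
    obtain w where w: "w \<in> weights (cube_vertices m K) \<tau>" "sum w (cube_vertices m K) = 1"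
      "y = (\<lambda>j\<in>{1..m}. \<Sum>v\<in>cube_vertices m K. w v * cube_point v j)"
      using y unfolding hull_of_def by blast
    have "c \<noteq> {}"
    proof
      assume "c = {}"
      then have "sum w (cube_vertices m K) = 0"
        using w(1) c(3) by (intro sum.neutral) (auto simp: weights_def)
      then show False using w(2) by simp
    qed
    moreover have "\<bar>y j\<bar> \<le> 1" if "j \<in> {1..m}" for j
      using sum_cube_point_bound [OF w(1) finite_cube_vertices, of j] w(2) that by (simp add: w(3))
    moreover have "y j = (if j \<in> N then -1 else 1)" if "j \<in> {1..m} - \<Union>c" for j
    proof -
      have "cube_point v j = (if j \<in> N then -1 else 1)" if "v \<in> \<tau>" for v
        using that \<open>j \<in> {1..m} - \<Union>c\<close> by (auto simp: c(3) lift_vertex_def cube_point_def)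
      from sum_cube_point_const [OF w(1) this] show ?thesis
        using that w(2) by (simp add: w(3))
    qed
    moreover have "y \<in> extensional {1..m}"
      by (simp add: w(3))
    ultimately show ?thesis
      using c by blast
  qed
  show ?thesis
  proof
    show "cube_points m K \<subseteq> extensional {1..m}"
      by (auto elim: cube_pointsE)
    show "finite (cube_vertices m K)"
      by (rule finite_cube_vertices)
    show "\<tau> \<subseteq> cube_vertices m K" if "\<tau> \<in> lifted_chains m K" for \<tau>
      by (rule lifted_chains_vertices [OF that])
    show "hull_of {1..m} (cube_vertices m K) cube_point \<tau> \<subseteq> cube_points m K" if "\<tau> \<in> lifted_chains m K" for \<tau>
    proof
      fix y assume "y \<in> hull_of {1..m} (cube_vertices m K) cube_point \<tau>"
      from hull [OF that this] obtain c N where c: "c \<in> chain_complex K" "c \<noteq> {}"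
        and y: "y \<in> extensional {1..m}" "\<forall>j\<in>{1..m}. \<bar>y j\<bar> \<le> 1" "\<forall>j\<in>{1..m} - \<Union>c. y j = (if j \<in> N then -1 else 1)"
        by blast
      show "y \<in> cube_points m K"
      proof (rule cube_pointsI)
        show "\<Union>c \<in> K" using Union_chain [OF c] by blast
        show "\<bar>y j\<bar> = 1" if "j \<in> {1..m} - \<Union>c" for j
          using y(3) that by auto
      qed (use y in auto)
    qed
    show "u = v" if "u \<in> cube_vertices m K" "v \<in> cube_vertices m K" "\<And>j. j \<in> {1..m} \<Longrightarrow> cube_point u j = cube_point v j" for u v
    proof -
      have *: "fst v = {j \<in> {1..m}. cube_point v j = 0} \<and> snd v = {j \<in> {1..m}. cube_point v j = -1}"
        if "v \<in> cube_vertices m K" for v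
      proof -
        obtain \<sigma> N where v: "v = (\<sigma>, N)" "\<sigma> \<in> K" "N \<subseteq> {1..m} - \<sigma>"
          using \<open>v \<in> cube_vertices m K\<close> by (auto simp: cube_vertices_def)
        then show ?thesis
          using K_sub [OF v(2)] by (auto simp: cube_point_def subset_iff)
      qed
      show ?thesis
        using * [OF that(1)] * [OF that(2)] that(3) by (intro prod_eqI) auto
    qed
    show "continuous_map (cube_top (cube_points m K)) euclideanreal (star_function m v)"
      if "v \<in> cube_vertices m K" for v
    proof -
      have "fst v \<in> K"
        using that by (auto simp: cube_vertices_def)
      then have v: "fst v \<subseteq> {1..m}" "finite (fst v)"
        by (rule K_sub, rule finite_simplex)
      have x: "continuous_map (cube_top (cube_points m K)) euclideanreal (\<lambda>x. x j)"
        if "j \<in> {1..m}" for j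
        using that by (intro continuous_map_from_subtopology continuous_map_product_projection)
      show ?thesis
        unfolding star_function_def case_prod_unfold
        by (intro continuous_map_real_mult continuous_map_prod continuous_map_real_max continuous_map_diff
            continuous_map_real_mult_left continuous_map_real_abs x continuous_map_const [THEN iffD2] disjI2)
           (use v in auto)
    qed
    show "\<exists>v\<in>cube_vertices m K. 0 < star_function m v x" if "x \<in> cube_points m K" for x
    proof -
      from that obtain \<sigma> where \<sigma>: "\<sigma> \<in> K" "\<And>j. j \<in> {1..m} - \<sigma> \<Longrightarrow> \<bar>x j\<bar> = 1"
        by (rule cube_pointsE) blast
      \<comment> \<open>A point lies in the star of the vertex with its own zeros and signs.\<close>
      define \<rho> where "\<rho> = {j \<in> {1..m}. x j = 0}"
      have "\<rho> \<subseteq> \<sigma>"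
        using \<sigma>(2) by (force simp: \<rho>_def)
      then have \<rho>: "\<rho> \<in> K"
        by (rule K_down [OF \<sigma>(1)])
      let ?v = "(\<rho>, {j \<in> {1..m}. x j < 0})"
      have "?v \<in> cube_vertices m K"
        using \<rho> by (auto simp: cube_vertices_def \<rho>_def)
      moreover have "0 < star_function m ?v x"
        unfolding pos [OF \<rho>] by (auto simp: \<rho>_def cube_point_def)
      ultimately show ?thesis by blast
    qed
    show "\<tau> \<in> lifted_chains m K"
      if x: "x \<in> cube_points m K" and \<tau>: "\<tau> \<subseteq> cube_vertices m K" "\<And>v. v \<in> \<tau> \<Longrightarrow> 0 < star_function m v x" for x \<tau>
    proof -
      let ?N = "{j \<in> {1..m}. x j < 0}"
      have v: "\<sigma> \<in> K \<and> N = ?N - \<sigma>" if "(\<sigma>, N) \<in> \<tau>" for \<sigma> N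
      proof -
        have \<sigma>: "\<sigma> \<in> K" "N \<subseteq> {1..m} - \<sigma>"
          using \<tau>(1) that by (auto simp: cube_vertices_def)
        have "0 < cube_point (\<sigma>, N) j * x j" if "j \<in> {1..m} - \<sigma>" for j
          using \<tau>(2) [OF \<open>(\<sigma>, N) \<in> \<tau>\<close>] pos [OF \<sigma>(1)] that by blast
        then have "j \<in> N \<longleftrightarrow> x j < 0" if "j \<in> {1..m} - \<sigma>" for j
          using that by (fastforce simp: cube_point_def split: if_splits)
        then show ?thesis
          using \<sigma> by blast
      qed
      have eq: "\<tau> = lift_vertex ?N ` (fst ` \<tau>)"
        using v by (force simp: lift_vertex_def image_image)
      have "chain\<^sub>\<subseteq> (fst ` \<tau>)"
        unfolding chain_subset_def
      proof (intro ballI)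
        fix \<sigma> \<rho> assume "\<sigma> \<in> fst ` \<tau>" "\<rho> \<in> fst ` \<tau>"
        then obtain N N' where N: "(\<sigma>, N) \<in> \<tau>" "(\<rho>, N') \<in> \<tau>" by auto
        have K: "\<sigma> \<in> K" "\<rho> \<in> K" using v N by auto
        show "\<sigma> \<subseteq> \<rho> \<or> \<rho> \<subseteq> \<sigma>"
        \<comment> \<open>Incomparable zero sets would force both
          \<open>\<bar>x i\<bar> < \<bar>x j\<bar>\<close> and the reverse.\<close>
        proof (rule ccontr)
          assume "\<not> (\<sigma> \<subseteq> \<rho> \<or> \<rho> \<subseteq> \<sigma>)"
          then obtain i j where ij: "i \<in> \<sigma>" "i \<notin> \<rho>" "j \<in> \<rho>" "j \<notin> \<sigma>" by blast
          then have "i \<in> {1..m}" "j \<in> {1..m}" using K_sub K by blast+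
          then have "\<bar>x i\<bar> < cube_point (\<sigma>, N) j * x j" "\<bar>x j\<bar> < cube_point (\<rho>, N') i * x i"
            using \<tau>(2) [OF N(1)] \<tau>(2) [OF N(2)] pos K ij by blast+
          moreover have "cube_point v k * x k \<le> \<bar>x k\<bar>" for v k
            by (auto simp: cube_point_def)
          ultimately show False
            by (smt (verit))
        qed
      qed
      then have "fst ` \<tau> \<in> chain_complex K"
        using v by (auto simp: chain_complex_def)
      then show ?thesis
        using eq unfolding lifted_chains_def by blast
    qed
    show "join_of {1..m} (cube_vertices m K) cube_point x \<tau> \<subseteq> cube_points m K"
      if x: "x \<in> cube_points m K" and \<tau>: "\<tau> \<subseteq> cube_vertices m K" "\<And>v. v \<in> \<tau> \<Longrightarrow> 0 < star_function m v x" for x \<tau>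
    proof
      let ?V = "cube_vertices m K"
      fix y assume "y \<in> join_of {1..m} ?V cube_point x \<tau>"
      then obtain w where w: "w \<in> weights ?V \<tau>"
        and y: "y = (\<lambda>j\<in>{1..m}. (1 - sum w ?V) * x j + (\<Sum>v\<in>?V. w v * cube_point v j))"
        unfolding join_of_def by blast
      obtain \<sigma> where \<sigma>: "\<sigma> \<in> K" "\<And>j. j \<in> {1..m} \<Longrightarrow> \<bar>x j\<bar> \<le> 1" "\<And>j. j \<in> {1..m} - \<sigma> \<Longrightarrow> \<bar>x j\<bar> = 1"
        using x by (rule cube_pointsE) blast
      have w1: "sum w ?V \<le> 1"
        using w by (simp add: weights_def)
      show "y \<in> cube_points m K"
      proof (rule cube_pointsI [OF \<sigma>(1)])
        show "y \<in> extensional {1..m}" by (simp add: y)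
        show "\<bar>y j\<bar> \<le> 1" if "j \<in> {1..m}" for j
        proof -
          have "\<bar>y j\<bar> \<le> \<bar>(1 - sum w ?V) * x j\<bar> + \<bar>\<Sum>v\<in>?V. w v * cube_point v j\<bar>"
            using that by (simp add: y)
          also have "\<bar>(1 - sum w ?V) * x j\<bar> \<le> (1 - sum w ?V) * 1"
            using w1 \<sigma>(2) [OF that] by (simp add: abs_mult mult_left_le)
          also have "\<bar>\<Sum>v\<in>?V. w v * cube_point v j\<bar> \<le> sum w ?V"
            by (rule sum_cube_point_bound [OF w finite_cube_vertices])
          finally show ?thesis by simp
        qed
        show "\<bar>y j\<bar> = 1" if j: "j \<in> {1..m} - \<sigma>" for j
        proof -
          \<comment> \<open>A coordinate of absolute value 1 cannot belong to the zero set of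
            \<open>v\<close>, where values are below 1, and its sign is that of
            \<open>v\<close>.\<close>
          have "cube_point v j = x j" if "v \<in> \<tau>" for v
          proof -
            obtain \<rho> N where v: "v = (\<rho>, N)" "\<rho> \<in> K"
              using \<tau>(1) \<open>v \<in> \<tau>\<close> by (auto simp: cube_vertices_def)
            have p: "(\<forall>j\<in>{1..m} - \<rho>. 0 < cube_point v j * x j) \<and> (\<forall>i\<in>\<rho>. \<bar>x i\<bar> < 1)"
              using \<tau>(2) [OF that] pos [OF v(2)] v(1) by blast
            then have "j \<notin> \<rho>"
              using \<sigma>(3) [OF j] by auto
            then have "0 < cube_point v j * x j"
              using p j by blast
            then show ?thesis
              using \<sigma>(3) [OF j] by (auto simp: cube_point_def split: if_splits)
          qed
          from sum_cube_point_const [OF w this] have "y j = x j"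
            using j by (simp add: y algebra_simps)
          then show ?thesis
            using \<sigma>(3) [OF j] by simp
        qed
      qed
    qed
    show "v \<in> cube_face m K \<tau>"
      if \<tau>: "\<tau> \<in> lifted_chains m K" and x: "x \<in> hull_of {1..m} (cube_vertices m K) cube_point \<tau>"
        and v: "v \<in> cube_vertices m K" "0 < star_function m v x" for \<tau> x v
    proof -
      obtain c N where c: "c \<in> chain_complex K" "c \<noteq> {}" "N \<subseteq> {1..m}" "\<tau> = lift_vertex N ` c"
        and xj: "\<forall>j\<in>{1..m} - \<Union>c. x j = (if j \<in> N then -1 else 1)"
        using hull [OF \<tau> x] by blast
      obtain \<rho> N' where \<rho>: "v = (\<rho>, N')" "\<rho> \<in> K" "N' \<subseteq> {1..m} - \<rho>"
        using v(1) by (auto simp: cube_vertices_def)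
      have p: "\<forall>j\<in>{1..m} - \<rho>. 0 < cube_point v j * x j" "\<forall>i\<in>\<rho>. \<bar>x i\<bar> < 1"
        using v(2) pos [OF \<rho>(2)] \<rho>(1) by blast+
      \<comment> \<open>With the whole face as carrier, only the constant coordinates outside
        \<open>\<Union>c\<close> have to be compared.\<close>
      have "\<rho> \<subseteq> \<Union>c"
      proof
        fix i assume i: "i \<in> \<rho>"
        then have "\<bar>x i\<bar> < 1" "i \<in> {1..m}"
          using p(2) K_sub [OF \<rho>(2)] by auto
        then show "i \<in> \<Union>c"
          using xj by (metis DiffI abs_minus_cancel abs_one less_irrefl)
      qed
      moreover have "j \<in> N' \<longleftrightarrow> j \<in> N" if "j \<in> {1..m} - \<Union>c" for j
      proof -
        have "0 < cube_point v j * x j"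
          using p(1) that \<open>\<rho> \<subseteq> \<Union>c\<close> by blast
        moreover have "x j = (if j \<in> N then -1 else 1)"
          using xj that by blast
        ultimately show ?thesis
          using \<rho>(1) that \<open>\<rho> \<subseteq> \<Union>c\<close> by (auto simp: cube_point_def split: if_splits)
      qed
      then have "N' - \<Union>c = N - \<Union>c"
        using \<rho>(3) c(3) by blast
      ultimately show ?thesis
        using v(1) c \<rho>(1) by (simp add: cube_face_def cube_apex_lift)
    qed
  qed
qed

text \<open>The absolute case, treated as the pair of two empty subspaces to match the form of
  \<open>cohomology_ring\<close>.\<close>

lemma X_list_comparison:
  "list_comparison {1..m} cube_point (lifted_chains m K) {} (real_moment_angle m K) {{}}"
proof -
  interpret star_cover "lifted_chains m K" "cube_face m K" cube_apex "{1..m}" "cube_points m K" "cube_vertices m K"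
     cube_point "star_function m"
    by (rule cube_star_cover)
  have "list_comparison {1..m} cube_point (lifted_chains m K) ({} \<union> {})
     (cube_top (cube_points m K)) {{}, {}}"
  proof (rule list_comparison_pair)
    have empty: "singular_simplex_set p (cube_top {}) = {}" for p
      by (auto simp: singular_simplex_empty)
    have "affine_family {1..m} cube_point {} p = {}" for p
      by (simp add: affine_family_def)
    then have acyc: "rel_acyclic (\<lambda>p. singular_simplex_set p (cube_top {})) (affine_family {1..m} cube_point {})"
      unfolding rel_acyclic_def empty by (auto intro!: exI [of _ 0])
    show "rel_acyclic (\<lambda>p. singular_simplex_set p (cube_top {})) (affine_family {1..m} cube_point {})"
      "rel_acyclic (\<lambda>p. singular_simplex_set p (cube_top {})) (affine_family {1..m} cube_point {})"
      by (rule acyc)+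
    show "rel_acyclic (\<lambda>p. singular_simplex_set p (cube_top ({} \<inter> {}))) (affine_family {1..m} cube_point ({} \<inter> {}))"
      unfolding Int_empty_left by (rule acyc)
    have iff: "(affine_simplex {1..m} cube_point p xs \<in> singular_simplex_set p (cube_top {})) = (set xs \<in> {})" for p xs
      unfolding empty by simp
    show "(affine_simplex {1..m} cube_point p xs \<in> singular_simplex_set p (cube_top {})) = (set xs \<in> {})"
      if "length xs = Suc p" for p xs
      by (rule iff)
    show "(affine_simplex {1..m} cube_point p xs \<in> singular_simplex_set p (cube_top {})) = (set xs \<in> {})"
      if "length xs = Suc p" for p xs
      by (rule iff)
    show "inj_on (affine_simplex {1..m} cube_point p) {xs. length xs = Suc p \<and> set xs \<in> lifted_chains m K}" for p
      by (rule aff_inj)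
    show "affine_family {1..m} cube_point (lifted_chains m K) p \<subseteq> singular_simplex_set p (cube_top (cube_points m K))" for p
      by (rule affine_family_singular)
    show "rel_acyclic (\<lambda>p. singular_simplex_set p (cube_top (cube_points m K)))
       (affine_family {1..m} cube_point (lifted_chains m K))"
      by (rule rel_acyclic_affine)
  qed (use down in auto)
  then show ?thesis
    by (simp add: real_moment_angle_def cube_points_def)
qed

end

section \<open>Splitting the cochains of the real moment-angle complex\<close>

text \<open>Existence half of Moebius inversion on subsets; \<open>(-1) ^ (card J + card M)\<close>
  is the Moebius function.\<close>

lemma sum_subsets_of_alternating_sum:
  fixes F :: "'a set \<Rightarrow> int"
  assumes "finite S"
  shows "(\<Sum>J\<in>Pow S. \<Sum>M\<in>Pow J. (-1) ^ (card J + card M) * F M) = F S"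
proof -
  have sq: "((-1) ^ n :: int) * ((-1) ^ n * x) = x" for n x
    by (simp flip: mult.assoc power_add)
  have "F S = (\<Sum>J\<in>Pow S. (-1) ^ card J * (\<Sum>M\<in>Pow J. (-1) ^ card M * F M))"
    by (rule inclusion_exclusion_symmetric [OF _ assms]) simp
  then show ?thesis
    by (simp add: sum_distrib_left power_add mult.assoc)
qed

text \<open>Uniqueness half, by induction on proper subsets.\<close>

lemma subset_sums_vanish:
  fixes c :: "'a set \<Rightarrow> int"
  assumes "finite S" "\<And>M. M \<subseteq> S \<Longrightarrow> (\<Sum>J\<in>Pow M. c J) = 0" "J \<subseteq> S"
  shows "c J = 0"
proof -
  have "finite J"
    using assms finite_subset by blast
  then show ?thesis
    using assms(3)
  proof (induction J rule: finite_psubset_induct)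
    case (psubset J)
    have "(\<Sum>M\<in>Pow J. c M) = c J + (\<Sum>M\<in>Pow J - {J}. c M)"
      by (rule sum.remove) (use psubset in auto)
    moreover have "(\<Sum>M\<in>Pow J - {J}. c M) = 0"
      by (rule sum.neutral) (use psubset in auto)
    ultimately show ?case
      using assms(2) [OF psubset.prems] by simp
  qed
qed

lemma list_coboundary_in_cochains:
  assumes "c \<in> list_cochains p L B" "\<And>\<tau> \<rho>. \<tau> \<in> B \<Longrightarrow> \<rho> \<subseteq> \<tau> \<Longrightarrow> \<rho> \<in> B"
  shows "list_coboundary p L c \<in> list_cochains (Suc p) L B"
proof -
  have "c (drop_nth k xs) = 0" if "set xs \<in> B" for k xs
    using assms(1) assms(2) [OF that set_drop_nth] by (simp add: list_cochains_def)
  then show ?thesis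
    by (auto simp: list_cochains_def list_coboundary_def simp del: sum.atMost_Suc intro!: sum.neutral)
qed

section \<open>Pulling list cochains of Y back to the cube complex\<close>

context finite_complex
begin

abbreviation "LX \<equiv> lifted_chains m K"
abbreviation "LY \<equiv> chain_complex K"
abbreviation "X \<equiv> real_moment_angle m K"
abbreviation "Y \<equiv> Y_space K"
abbreviation "P J \<equiv> union_over (P_panel K) J"
abbreviation "resX \<equiv> on_lists {1..m} cube_point LX"
abbreviation "resY \<equiv> on_lists UNIV unit_at LY"
abbreviation "subsets \<equiv> Pow {1..m}"
abbreviation "CY p J \<equiv> list_cochains p LY (panel_chains K J)"
abbreviation "HX p \<equiv> rel_cohomology p X {}"
abbreviation "HY p J \<equiv> rel_cohomology p Y (P J)"
abbreviation "clsX p \<equiv> cohomology_class p X {{}}"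
abbreviation "clsY p J \<equiv> cohomology_class p Y {P J}"
abbreviation "RG \<equiv> R_group Y m (P_panel K)"

text \<open>Coordinates negative at some vertex. This is intrinsic to the list, whereas the sign set
  of a lift is determined only up to elements common to all zero sets.\<close>

definition negatives :: "(nat set \<times> nat set) list \<Rightarrow> nat set" where
  "negatives xs = \<Union>(snd ` set xs)"

text \<open>
  The pull-back along the folding map onto \<open>Y\<close>, cut down to the part of the cube where the coordinates
  in \<open>J\<close> are nonnegative. Vanishing on the panels over \<open>J\<close> makes it a cochain map.
\<close>

definition pull :: "nat set \<Rightarrow> nat set list_cochain \<Rightarrow> (nat set \<times> nat set) list_cochain" where
  "pull J c xs = (if set xs \<in> LX \<and> negatives xs \<inter> J = {} then c (map fst xs) else 0)"

lemma LX_listE: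
  assumes "set xs \<in> LX"
  obtains N ys where "N \<subseteq> {1..m}" "set ys \<in> LY" "xs = map (lift_vertex N) ys" "map fst xs = ys"
proof -
  obtain c N where c: "c \<in> chain_complex K" "N \<subseteq> {1..m}" "set xs = lift_vertex N ` c"
    by (rule lifted_chainsE [OF assms])
  have "lift_vertex N (fst v) = v" if "v \<in> set xs" for v
    using that c(3) by (auto simp: lift_vertex_def)
  then have "map (lift_vertex N) (map fst xs) = xs"
    by (simp add: map_idI)
  moreover have "set (map fst xs) = c"
    using c(3) by (auto simp: lift_vertex_def image_image)
  ultimately show thesis
    using that [of N "map fst xs"] c by simp
qed

lemma lift_list_in_LX: "set ys \<in> LY \<Longrightarrow> N \<subseteq> {1..m} \<Longrightarrow> set (map (lift_vertex N) ys) \<in> LX"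
  by (auto simp: lifted_chains_def)

lemma map_fst_lift [simp]: "map fst (map (lift_vertex N) ys) = ys"
  by (simp add: lift_vertex_def o_def)

lemma negatives_lift: "ys \<noteq> [] \<Longrightarrow> negatives (map (lift_vertex N) ys) = N - \<Inter>(set ys)"
  by (auto simp: negatives_def lift_vertex_def)

lemma set_map_fst_LY: "set xs \<in> LX \<Longrightarrow> fst ` set xs \<in> LY"
  by (elim LX_listE) (metis set_map)

lemma panelI:
  assumes "set ys \<in> LY" "j \<in> J" "\<And>\<sigma>. \<sigma> \<in> set ys \<Longrightarrow> j \<in> \<sigma>" shows "set ys \<in> panel_chains K J"
  using assms by (auto simp: panel_chains_def)

text \<open>If a face loses the negative coordinate \<open>j\<close>, then \<open>j\<close> is zero
  at each of its vertices, so the underlying chain lies in the panel of \<open>j\<close>. Cochains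
  vanishing on P_J cannot see such a face.\<close>

lemma in_panel_if_not_negative:
  assumes xs: "set xs \<in> LX" "j \<in> negatives xs" and zs: "set zs \<subseteq> set xs" "j \<notin> negatives zs" "j \<in> J"
  shows "set (map fst zs) \<in> panel_chains K J"
proof -
  obtain N ys where ys: "set ys \<in> LY" "xs = map (lift_vertex N) ys"
    using xs(1) by (rule LX_listE) (rule that)
  show ?thesis
  proof (rule panelI [OF _ zs(3)])
    have "fst ` set zs \<subseteq> fst ` set xs"
      using zs(1) by blast
    then show "set (map fst zs) \<in> LY"
      using chain_complex_down [OF set_map_fst_LY [OF xs(1)]] by simp
    fix \<sigma> assume "\<sigma> \<in> set (map fst zs)"
    then obtain M where M: "(\<sigma>, M) \<in> set zs" by auto
    then have "(\<sigma>, M) \<in> lift_vertex N ` set ys"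
      using zs(1) ys(2) by auto
    then have "M = N - \<sigma>" by (auto simp: lift_vertex_def)
    moreover have "j \<in> N"
      using xs(2) ys(2) by (auto simp: negatives_def lift_vertex_def)
    moreover have "j \<notin> M"
      using zs(2) M by (auto simp: negatives_def)
    ultimately show "j \<in> \<sigma>" by blast
  qed
qed

lemma negatives_mono: "set zs \<subseteq> set xs \<Longrightarrow> negatives zs \<subseteq> negatives xs"
  by (auto simp: negatives_def)

lemma pull_in_cochains: "c \<in> list_cochains p LY B \<Longrightarrow> pull J c \<in> list_cochains p LX {}"
  by (auto simp: list_cochains_def pull_def)

text \<open>The case to check is a list with a negative coordinate in \<open>J\<close>: each face
  either keeps it, and is cut off by \<open>pull\<close>, or loses it and lies in P_J, where
  \<open>c\<close> is zero.\<close>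

lemma pull_coboundary:
  assumes c: "c \<in> CY p J"
  shows "list_coboundary p LX (pull J c) = pull J (list_coboundary p LY c)"
proof
  fix xs
  show "list_coboundary p LX (pull J c) xs = pull J (list_coboundary p LY c) xs"
  proof (cases "length xs = Suc (Suc p) \<and> set xs \<in> LX")
    case True
    have LX: "set (drop_nth k xs) \<in> LX" for k
      by (rule lifted_chains_down [OF _ set_drop_nth]) (use True in simp)
    show ?thesis
    proof (cases "negatives xs \<inter> J = {}")
      case neg: True
      then have "negatives (drop_nth k xs) \<inter> J = {}" for k
        using negatives_mono [OF set_drop_nth [of k xs]] by blast
      then show ?thesis
        using True LX neg set_map_fst_LY [of xs]
        by (simp add: list_coboundary_def pull_def map_drop_nth del: sum.atMost_Suc)
    next
      case False
      then obtain j where j: "j \<in> negatives xs" "j \<in> J" by blast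
      have "pull J c (drop_nth k xs) = 0" for k
      proof (cases "negatives (drop_nth k xs) \<inter> J = {}")
        case True
        then have "set (map fst (drop_nth k xs)) \<in> panel_chains K J"
          using in_panel_if_not_negative [OF _ j(1) set_drop_nth [of k xs] _ j(2)] j \<open>length xs = Suc (Suc p) \<and> set xs \<in> LX\<close> by blast
        then show ?thesis
          using c by (simp add: pull_def list_cochains_def)
      qed (simp add: pull_def)
      then show ?thesis
        using False by (simp add: list_coboundary_def pull_def del: sum.atMost_Suc)
    qed
  qed (auto simp: list_coboundary_def pull_def)
qed

text \<open>Same dichotomy for the front segment with \<open>J\<close> and the back segment with
  \<open>J'\<close>: a negative coordinate in \<open>J \<union> J'\<close> kills one of the
  factors.\<close>

lemma pull_cup:
  assumes c: "c \<in> CY p J" and d: "d \<in> CY q J'"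
    and xs: "length xs = Suc (p + q)" "set xs \<in> LX"
  shows "pull J c (take (Suc p) xs) * pull J' d (drop p xs)
    = (if negatives xs \<inter> (J \<union> J') = {} then c (take (Suc p) (map fst xs)) * d (drop p (map fst xs)) else 0)"
proof -
  have sub: "set (take (Suc p) xs) \<subseteq> set xs" "set (drop p xs) \<subseteq> set xs"
    by (rule set_take_subset, rule set_drop_subset)
  have LX: "set (take (Suc p) xs) \<in> LX" "set (drop p xs) \<in> LX"
    by (rule lifted_chains_down [OF xs(2)], rule sub)+
  show ?thesis
  proof (cases "negatives xs \<inter> (J \<union> J') = {}")
    case True
    then have "negatives (take (Suc p) xs) \<inter> J = {}" "negatives (drop p xs) \<inter> J' = {}"
      using negatives_mono [OF sub(1)] negatives_mono [OF sub(2)] by blast+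
    then show ?thesis
      using True LX by (simp add: pull_def take_map drop_map)
  next
    case False
    then obtain j where j: "j \<in> negatives xs" "j \<in> J \<or> j \<in> J'" by blast
    have "pull J c (take (Suc p) xs) = 0" if "j \<in> J"
    proof (cases "j \<in> negatives (take (Suc p) xs)")
      case False
      then have "set (map fst (take (Suc p) xs)) \<in> panel_chains K J"
        by (rule in_panel_if_not_negative [OF xs(2) j(1) sub(1) _ that])
      then show ?thesis
        using c by (simp add: pull_def list_cochains_def)
    qed (use that in \<open>auto simp: pull_def\<close>)
    moreover have "pull J' d (drop p xs) = 0" if "j \<in> J'"
    proof (cases "j \<in> negatives (drop p xs)")
      case False
      then have "set (map fst (drop p xs)) \<in> panel_chains K J'"
        by (rule in_panel_if_not_negative [OF xs(2) j(1) sub(2) _ that])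
      then show ?thesis
        using d by (simp add: pull_def list_cochains_def)
    qed (use that in \<open>auto simp: pull_def\<close>)
    ultimately show ?thesis
      using False j(2) by auto
  qed
qed

text \<open>\<open>pull\<close> tests \<open>J\<close> against the visible part
  \<open>N - \<Inter>(set ys)\<close>, the right side against all of \<open>N\<close>. A set
  \<open>J\<close> passing only the first test meets \<open>\<Inter>(set ys)\<close>, so
  \<open>ys\<close> lies in P_J and \<open>c J ys\<close> is 0.\<close>

lemma sum_pull_lift:
  assumes c: "\<And>J. J \<in> subsets \<Longrightarrow> c J \<in> CY p J"
    and ys: "length ys = Suc p" "set ys \<in> LY" and N: "N \<subseteq> {1..m}"
  shows "(\<Sum>J\<in>subsets. pull J (c J) (map (lift_vertex N) ys)) = (\<Sum>J\<in>Pow ({1..m} - N). c J ys)"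
proof -
  let ?xs = "map (lift_vertex N) ys"
  have ne: "ys \<noteq> []" using ys by auto
  have pull: "pull J (c J) ?xs = (if (N - \<Inter>(set ys)) \<inter> J = {} then c J ys else 0)" for J
    unfolding pull_def map_fst_lift negatives_lift [OF ne] using lift_list_in_LX [OF ys(2) N] by simp
  have zero: "c J ys = 0" if J: "J \<in> subsets" and "J \<inter> \<Inter>(set ys) \<noteq> {}" for J
  proof -
    from that(2) obtain j where j: "j \<in> J" "j \<in> \<Inter>(set ys)"
      by blast
    have "set ys \<in> panel_chains K J"
      by (rule panelI [OF ys(2) j(1)]) (use j(2) in blast)
    then show ?thesis
      using c [OF J] by (simp add: list_cochains_def)
  qed
  have "(\<Sum>J\<in>Pow ({1..m} - N). c J ys) = (\<Sum>J\<in>subsets. pull J (c J) ?xs)"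
  proof (rule sum.mono_neutral_cong_left)
    show "\<forall>J\<in>subsets - Pow ({1..m} - N). pull J (c J) ?xs = 0"
    proof
      fix J assume J: "J \<in> subsets - Pow ({1..m} - N)"
      show "pull J (c J) ?xs = 0"
      proof (cases "(N - \<Inter>(set ys)) \<inter> J = {}")
        case True
        then have "J \<inter> \<Inter>(set ys) \<noteq> {}"
          using J by blast
        then show ?thesis
          using zero J pull by simp
      qed (simp add: pull)
    qed
    show "c J ys = pull J (c J) ?xs" if "J \<in> Pow ({1..m} - N)" for J
    proof -
      have "(N - \<Inter>(set ys)) \<inter> J = {}"
        using that by blast
      then show ?thesis
        by (simp add: pull)
    qed
  qed auto
  then show ?thesis by simp
qed

lemma split_cochain:
  assumes a: "a \<in> list_cochains p LX {}"
  obtains c where "\<And>J. J \<in> subsets \<Longrightarrow> c J \<in> CY p J"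
    "a = (\<lambda>xs. \<Sum>J\<in>subsets. pull J (c J) xs)"
proof -
  \<comment> \<open>\<open>M\<close> is the set of coordinates not made negative, so that
    \<open>sum_pull_lift\<close> becomes a sum over the subsets of \<open>M\<close>.\<close>
  define F where "F ys M = a (map (lift_vertex ({1..m} - M)) ys)" for ys M
  define c where "c J ys = (if length ys = Suc p \<and> set ys \<in> LY \<and> set ys \<notin> panel_chains K J
     then \<Sum>M\<in>Pow J. (-1) ^ (card J + card M) * F ys M else 0)" for J ys
  have c: "c J \<in> CY p J" for J
    by (simp add: c_def list_cochains_def)
  have "a xs = (\<Sum>J\<in>subsets. pull J (c J) xs)" for xs
  proof (cases "length xs = Suc p \<and> set xs \<in> LX")
    case True
    then obtain N ys where ys: "N \<subseteq> {1..m}" "set ys \<in> LY" "xs = map (lift_vertex N) ys"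
      using LX_listE [of xs] by metis
    then have len: "length ys = Suc p" using True by simp
    let ?Z = "\<Inter>(set ys)"
    have Z: "?Z \<subseteq> {1..m}"
    proof -
      obtain \<sigma> where "\<sigma> \<in> set ys" using len by (cases ys) auto
      then show ?thesis
        using ys(2) K_sub [of \<sigma>] by (auto simp: chain_complex_def)
    qed
    \<comment> \<open>Adding the common zeros does not change the lift, and every \<open>J\<close>
      in the complement now avoids them. Hence \<open>ys\<close> is outside the panels over
      \<open>J\<close> and the alternating formula for \<open>c J\<close> applies.\<close>
    define N' where "N' = N \<union> ?Z"
    have N': "N' \<subseteq> {1..m}" using ys(1) Z by (simp add: N'_def)
    have xs: "xs = map (lift_vertex N') ys"
      unfolding ys(3) by (rule map_cong) (auto simp: lift_vertex_def N'_def)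
    let ?M = "{1..m} - N'"
    have "c J ys = (\<Sum>M\<in>Pow J. (-1) ^ (card J + card M) * F ys M)" if "J \<in> Pow ?M" for J
    proof -
      have "J \<inter> ?Z = {}" using that by (auto simp: N'_def)
      then have "set ys \<notin> panel_chains K J" by (auto simp: panel_chains_def)
      then show ?thesis using len ys(2) by (simp add: c_def)
    qed
    then have "(\<Sum>J\<in>Pow ?M. c J ys) = (\<Sum>J\<in>Pow ?M. \<Sum>M\<in>Pow J. (-1) ^ (card J + card M) * F ys M)"
      by (rule sum.cong [OF refl])
    also have "\<dots> = F ys ?M"
      by (rule sum_subsets_of_alternating_sum) simp
    also have "\<dots> = a xs"
      using N' by (simp add: F_def xs double_diff)
    finally show ?thesis
      using sum_pull_lift [of c, OF c len ys(2) N'] by (simp add: xs)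
  next
    case False
    then have "pull J (c J) xs = 0" for J
      by (auto simp: pull_def c_def)
    moreover have "a xs = 0"
      using a False by (simp add: list_cochains_def)
    ultimately show ?thesis by simp
  qed
  then show thesis
    using that c by blast
qed

text \<open>Evaluation at the lifts of \<open>ys\<close> to all orthants gives all subset sums of
  \<open>c J ys\<close>.\<close>

lemma split_unique:
  assumes c: "\<And>J. J \<in> subsets \<Longrightarrow> c J \<in> CY p J"
    and zero: "(\<lambda>xs. \<Sum>J\<in>subsets. pull J (c J) xs) = (\<lambda>_. 0)" and J: "J \<in> subsets"
  shows "c J = (\<lambda>_. 0)"
proof
  fix ys
  show "c J ys = 0"
  proof (cases "length ys = Suc p \<and> set ys \<in> LY")
    case True
    show ?thesis
    proof (rule subset_sums_vanish [of "{1..m}" "\<lambda>J. c J ys"])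
      fix M :: "nat set" assume "M \<subseteq> {1..m}"
      then show "(\<Sum>J\<in>Pow M. c J ys) = 0"
        using sum_pull_lift [of c p ys "{1..m} - M", OF c] True fun_cong [OF zero, of "map (lift_vertex ({1..m} - M)) ys"]
        by (simp add: double_diff)
    qed (use J in auto)
  qed (use c [OF J] in \<open>auto simp: list_cochains_def\<close>)
qed

end

section \<open>Graded rings\<close>

lemma iso_one:
  assumes "group G" "group H" "h \<in> iso G H" shows "h \<one>\<^bsub>G\<^esub> = \<one>\<^bsub>H\<^esub>"
  using hom_one [of h G H] assms by (auto simp: iso_def)

lemma iso_finprod:
  assumes G: "comm_group G" and H: "comm_group H" and h: "h \<in> iso G H" and f: "\<And>i. i \<in> A \<Longrightarrow> f i \<in> carrier G"
  shows "h (finprod G f A) = finprod H (\<lambda>i. h (f i)) A"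
proof -
  interpret G: comm_group G by (rule G)
  interpret H: comm_group H by (rule H)
  have hom: "h \<in> hom G H"
    using h by (simp add: iso_def)
  have in_H: "h x \<in> carrier H" if "x \<in> carrier G" for x
    using hom that by (auto simp: hom_def)
  show ?thesis
    using f
  proof (induction A rule: infinite_finite_induct)
    case (insert i A)
    then show ?case
      using hom_mult [OF hom, of "f i" "finprod G f A"] in_H by (simp add: Pi_iff)
  qed (use iso_one [OF G.is_group H.is_group h] in \<open>auto simp: finprod_def\<close>)
qed

text \<open>Degreewise isomorphisms match neutral elements, hence preserve finite support, and they
  commute with the finite sums in the product.\<close>

lemma graded_ring_isomorphicI:
  assumes G: "\<And>p. comm_group (G p)" and H: "\<And>p. comm_group (H p)"
    and h: "\<And>p. h p \<in> iso (G p) (H p)"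
    and mult_closed: "\<And>p q a b. a \<in> carrier (G p) \<Longrightarrow> b \<in> carrier (G q) \<Longrightarrow> \<mu> p q a b \<in> carrier (G (p + q))"
    and mult: "\<And>p q a b. a \<in> carrier (G p) \<Longrightarrow> b \<in> carrier (G q) \<Longrightarrow> h (p + q) (\<mu> p q a b) = \<nu> p q (h p a) (h q b)"
    and unit: "h 0 e = e'"
  shows "graded_ring_isomorphic (graded_ring G \<mu> e) (graded_ring H \<nu> e')"
proof -
  define \<Phi> where "\<Phi> x = (\<lambda>p. h p (x p))" for x
  note groups = comm_group.axioms(2) [OF G] comm_group.axioms(2) [OF H]
  have one: "h p \<one>\<^bsub>G p\<^esub> = \<one>\<^bsub>H p\<^esub>" for p
    by (rule iso_one [OF groups h])
  have bij: "bij_betw (h p) (carrier (G p)) (carrier (H p))" for p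
    using h by (simp add: iso_def)
  then have in_H: "h p a \<in> carrier (H p)" if "a \<in> carrier (G p)" for p a
    using that by (auto simp: bij_betw_def)
  have one_iff: "h p a = \<one>\<^bsub>H p\<^esub> \<longleftrightarrow> a = \<one>\<^bsub>G p\<^esub>" if "a \<in> carrier (G p)" for p a
    using bij_betw_imp_inj_on [OF bij [of p]] one [of p] that group.subgroup_self [OF groups(1)]
    by (metis inj_on_eq_iff group.is_monoid groups(1) monoid.one_closed)
  let ?R = "graded_ring G \<mu> e" and ?S = "graded_ring H \<nu> e'"
  have carR: "carrier ?R = {x. (\<forall>p. x p \<in> carrier (G p)) \<and> finite {p. x p \<noteq> \<one>\<^bsub>G p\<^esub>}}"
    by (auto simp: graded_ring_def carrier_sum_group groups PiE_UNIV_domain)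
  have carS: "carrier ?S = {x. (\<forall>p. x p \<in> carrier (H p)) \<and> finite {p. x p \<noteq> \<one>\<^bsub>H p\<^esub>}}"
    by (auto simp: graded_ring_def carrier_sum_group groups PiE_UNIV_domain)
  have zeroR: "\<zero>\<^bsub>?R\<^esub> = (\<lambda>p. \<one>\<^bsub>G p\<^esub>)" and zeroS: "\<zero>\<^bsub>?S\<^esub> = (\<lambda>p. \<one>\<^bsub>H p\<^esub>)"
    by (simp_all add: graded_ring_def restrict_def)
  have \<Phi>_car: "\<Phi> x \<in> carrier ?S" if "x \<in> carrier ?R" for x
    using that by (simp add: carR carS \<Phi>_def in_H one_iff)
  have \<Phi>_inj: "inj_on \<Phi> (carrier ?R)"
  proof (rule inj_onI, rule ext)
    fix x y p assume xy: "x \<in> carrier ?R" "y \<in> carrier ?R" "\<Phi> x = \<Phi> y"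
    then have "h p (x p) = h p (y p)" by (auto simp: \<Phi>_def dest: fun_cong [of _ _ p])
    then show "x p = y p"
      using xy bij_betw_imp_inj_on [OF bij [of p]] by (simp add: carR inj_on_eq_iff)
  qed
  have \<Phi>_surj: "\<exists>x\<in>carrier ?R. \<Phi> x = y" if y: "y \<in> carrier ?S" for y
  proof -
    define x where "x p = inv_into (carrier (G p)) (h p) (y p)" for p
    have yp: "y p \<in> h p ` carrier (G p)" for p
      using y bij [of p] by (simp add: carS bij_betw_def)
    have x: "x p \<in> carrier (G p)" "h p (x p) = y p" for p
      using inv_into_into [OF yp [of p]] f_inv_into_f [OF yp [of p]] by (auto simp: x_def)
    have "x p \<noteq> \<one>\<^bsub>G p\<^esub> \<longleftrightarrow> y p \<noteq> \<one>\<^bsub>H p\<^esub>" for p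
      using one_iff [OF x(1) [of p]] x(2) by simp
    then have "x \<in> carrier ?R"
      using y x by (simp add: carR carS)
    moreover have "\<Phi> x = y"
      using x by (simp add: \<Phi>_def)
    ultimately show ?thesis by blast
  qed
  have "\<Phi> \<in> ring_hom ?R ?S"
  proof (rule ring_hom_memI)
    show "\<Phi> x \<in> carrier ?S" if "x \<in> carrier ?R" for x
      by (rule \<Phi>_car [OF that])
    show "\<Phi> (x \<oplus>\<^bsub>?R\<^esub> y) = \<Phi> x \<oplus>\<^bsub>?S\<^esub> \<Phi> y" if "x \<in> carrier ?R" "y \<in> carrier ?R" for x y
    proof -
      have "h p (x p \<otimes>\<^bsub>G p\<^esub> y p) = h p (x p) \<otimes>\<^bsub>H p\<^esub> h p (y p)" for p
        using h [of p] that by (auto simp: carR iso_def intro: hom_mult)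
      then show ?thesis
        by (simp add: graded_ring_def \<Phi>_def fun_eq_iff)
    qed
    show "\<Phi> \<one>\<^bsub>?R\<^esub> = \<one>\<^bsub>?S\<^esub>"
      by (auto simp: graded_ring_def \<Phi>_def unit one fun_eq_iff)
    show "\<Phi> (x \<otimes>\<^bsub>?R\<^esub> y) = \<Phi> x \<otimes>\<^bsub>?S\<^esub> \<Phi> y" if x: "x \<in> carrier ?R" and y: "y \<in> carrier ?R" for x y
    proof
      fix n
      have mem: "\<mu> p (n - p) (x p) (y (n - p)) \<in> carrier (G n)" if "p \<in> {..n}" for p
        using mult_closed [of "x p" p "y (n - p)" "n - p"] x y that by (simp add: carR)
      have eq: "h n (\<mu> p (n - p) (x p) (y (n - p))) = \<nu> p (n - p) (h p (x p)) (h (n - p) (y (n - p)))" if "p \<in> {..n}" for p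
        using mult [of "x p" p "y (n - p)" "n - p"] x y that by (simp add: carR)
      have "\<Phi> (x \<otimes>\<^bsub>?R\<^esub> y) n = h n (finprod (G n) (\<lambda>p. \<mu> p (n - p) (x p) (y (n - p))) {..n})"
        by (simp add: graded_ring_def \<Phi>_def)
      also have "\<dots> = finprod (H n) (\<lambda>p. h n (\<mu> p (n - p) (x p) (y (n - p)))) {..n}"
        by (rule iso_finprod [OF G H h mem])
      also have "\<dots> = finprod (H n) (\<lambda>p. \<nu> p (n - p) (h p (x p)) (h (n - p) (y (n - p)))) {..n}"
      proof (rule comm_monoid.finprod_cong')
        show "comm_monoid (H n)"
          using H comm_group.axioms(1) by blast
        \<comment> \<open>Closure of the products in the target is inherited from the source through
          \<open>h\<close>.\<close>
        show "(\<lambda>p. \<nu> p (n - p) (h p (x p)) (h (n - p) (y (n - p)))) \<in> {..n} \<rightarrow> carrier (H n)"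
        proof
          fix p assume p: "p \<in> {..n}"
          show "\<nu> p (n - p) (h p (x p)) (h (n - p) (y (n - p))) \<in> carrier (H n)"
            unfolding eq [OF p, symmetric] by (rule in_H [OF mem [OF p]])
        qed
      qed (use eq in auto)
      also have "\<dots> = (\<Phi> x \<otimes>\<^bsub>?S\<^esub> \<Phi> y) n"
        by (simp add: graded_ring_def \<Phi>_def)
      finally show "\<Phi> (x \<otimes>\<^bsub>?R\<^esub> y) n = (\<Phi> x \<otimes>\<^bsub>?S\<^esub> \<Phi> y) n" .
    qed
  qed
  moreover have "bij_betw \<Phi> (carrier ?R) (carrier ?S)"
    unfolding bij_betw_def
  proof
    show "\<Phi> ` carrier ?R = carrier ?S"
    proof
      show "carrier ?S \<subseteq> \<Phi> ` carrier ?R"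
        using \<Phi>_surj by (metis image_eqI subsetI)
    qed (use \<Phi>_car in blast)
  qed (rule \<Phi>_inj)
  ultimately have "\<Phi> \<in> ring_iso ?R ?S"
    by (simp add: ring_iso_def)
  moreover have "\<Phi> ` homogeneous ?R p = homogeneous ?S p" for p
  proof
    show "\<Phi> ` homogeneous ?R p \<subseteq> homogeneous ?S p"
    proof (rule image_subsetI)
      fix x assume "x \<in> homogeneous ?R p"
      then have "x \<in> carrier ?R" "\<forall>q. q \<noteq> p \<longrightarrow> x q = \<one>\<^bsub>G q\<^esub>"
        by (auto simp: homogeneous_def zeroR)
      then show "\<Phi> x \<in> homogeneous ?S p"
        using \<Phi>_car by (simp add: homogeneous_def zeroS \<Phi>_def one)
    qed
    show "homogeneous ?S p \<subseteq> \<Phi> ` homogeneous ?R p"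
    proof
      fix y assume "y \<in> homogeneous ?S p"
      then have y: "y \<in> carrier ?S" "\<forall>q. q \<noteq> p \<longrightarrow> y q = \<one>\<^bsub>H q\<^esub>"
        by (auto simp: homogeneous_def zeroS)
      then obtain x where x: "x \<in> carrier ?R" "\<Phi> x = y"
        using \<Phi>_surj by blast
      have "x q = \<one>\<^bsub>G q\<^esub>" if "q \<noteq> p" for q
      proof -
        have "h q (x q) = \<one>\<^bsub>H q\<^esub>"
          using x(2) y(2) that by (auto simp: \<Phi>_def)
        then show ?thesis
          using one_iff [of "x q" q] x(1) by (simp add: carR)
      qed
      then have "x \<in> homogeneous ?R p"
        using x(1) by (simp add: homogeneous_def zeroR)
      then show "y \<in> \<Phi> ` homogeneous ?R p"
        using x(2) by blast
    qed
  qed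
  ultimately show ?thesis
    unfolding graded_ring_isomorphic_def by blast
qed

section \<open>The ring isomorphism\<close>

context finite_complex
begin

lemma panels: "P J = Y_points (panel_chains K J)"
  by (rule union_over_panels [OF finite_K])

lemma P_Un: "P (J \<union> J') = P J \<union> P J'"
  by (auto simp: union_over_def)

lemma Y_comparison: "list_comparison UNIV unit_at LY (panel_chains K J \<union> panel_chains K J') Y {P J, P J'}"
  unfolding panels Y_space_eq [OF finite_K empty_K]
proof (rule Y_list_comparison [OF finite_K])
  show "\<tau> \<subseteq> K" if "\<tau> \<in> LY" for \<tau>
    using that by (simp add: chain_complex_def)
  show "\<rho> \<in> LY" if "\<tau> \<in> LY" "\<rho> \<subseteq> \<tau>" for \<tau> \<rho>
    by (rule chain_complex_down [OF that])
  show "\<rho> \<in> panel_chains K J" if "\<tau> \<in> panel_chains K J" "\<rho> \<subseteq> \<tau>" for \<tau> \<rho>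
    by (rule panel_chains_down [OF that])
  show "\<rho> \<in> panel_chains K J'" if "\<tau> \<in> panel_chains K J'" "\<rho> \<subseteq> \<tau>" for \<tau> \<rho>
    by (rule panel_chains_down [OF that])
qed (auto simp: panel_chains_def)

lemma Y_comparison_single: "list_comparison UNIV unit_at LY (panel_chains K J) Y {P J}"
  using Y_comparison [of J J] by simp

lemmas Y_lift = list_comparison.cocycle_lift [OF Y_comparison_single]
  and Y_coboundary = list_comparison.coboundary_if_res_coboundary [OF Y_comparison_single]
  and Y_res_coboundaries = list_comparison.res_coboundaries [OF Y_comparison_single]
  and Y_res_cochains = list_comparison.res_in_cochains [OF Y_comparison_single]
  and Y_res_coboundary = list_comparison.res_coboundary [OF Y_comparison_single]
  and Y_res_cup = list_comparison.res_cup [OF Y_comparison_single]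

lemmas X_lift = list_comparison.cocycle_lift [OF X_list_comparison]
  and X_coboundary = list_comparison.coboundary_if_res_coboundary [OF X_list_comparison]
  and X_res_coboundaries = list_comparison.res_coboundaries [OF X_list_comparison]
  and X_res_cochains = list_comparison.res_in_cochains [OF X_list_comparison]
  and X_res_coboundary = list_comparison.res_coboundary [OF X_list_comparison]
  and X_res_cup = list_comparison.res_cup [OF X_list_comparison]

text \<open>A relation rather than a map, because list cochains determine singular cocycles only up
  to coboundaries; it becomes a bijection on classes.\<close>

definition corresponds :: "nat \<Rightarrow> (nat \<Rightarrow> real) cochain \<Rightarrow> (nat set \<Rightarrow> (nat set option \<Rightarrow> real) cochain) \<Rightarrow> bool" where
  "corresponds p x u \<longleftrightarrow> x \<in> cocycles p X {{}} \<and> (\<forall>J\<in>subsets. u J \<in> cocycles p Y {P J})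
     \<and> resX p x = (\<lambda>xs. \<Sum>J\<in>subsets. pull J (resY p (u J)) xs)"

lemma pull_diff: "pull J (\<lambda>ys. c ys - d ys) xs = pull J c xs - pull J d xs"
  and pull_add: "pull J (\<lambda>ys. c ys + d ys) xs = pull J c xs + pull J d xs"
  and pull_zero: "pull J (\<lambda>_. 0) xs = 0"
  by (auto simp: pull_def)

lemma pull_sum: "pull J (\<lambda>ys. \<Sum>i\<in>A. c i ys) xs = (\<Sum>i\<in>A. pull J (c i) xs)"
proof (cases "set xs \<in> LX \<and> negatives xs \<inter> J = {}")
  case False
  then have "pull J d xs = 0" for d
    by (auto simp: pull_def)
  then show ?thesis by simp
qed (simp add: pull_def)

lemma resY_cocycle:
  assumes "u \<in> cocycles p Y {P J}"
  shows "resY p u \<in> CY p J" "list_coboundary p LY (resY p u) = (\<lambda>_. 0)"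
  using assms Y_res_cochains [of u p J] Y_res_coboundary [of p u] by (auto simp: cocycles_def on_lists_zero)

lemma resX_cocycle:
  assumes "x \<in> cocycles p X {{}}"
  shows "resX p x \<in> list_cochains p LX {}" "list_coboundary p LX (resX p x) = (\<lambda>_. 0)"
  using assms X_res_cochains [of x p] X_res_coboundary [of p x] by (auto simp: cocycles_def on_lists_zero)

lemma coboundary_sum_pull:
  assumes "\<And>J. J \<in> subsets \<Longrightarrow> c J \<in> CY p J"
  shows "list_coboundary p LX (\<lambda>xs. \<Sum>J\<in>subsets. pull J (c J) xs)
       = (\<lambda>xs. \<Sum>J\<in>subsets. pull J (list_coboundary p LY (c J)) xs)"
  unfolding list_coboundary_sum using pull_coboundary [OF assms] by simp

lemma split_unique_diff:
  assumes "\<And>J. J \<in> subsets \<Longrightarrow> c J \<in> CY p J"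
    and "\<And>J. J \<in> subsets \<Longrightarrow> d J \<in> CY p J"
    and eq: "(\<lambda>xs. \<Sum>J\<in>subsets. pull J (c J) xs) = (\<lambda>xs. \<Sum>J\<in>subsets. pull J (d J) xs)" and J: "J \<in> subsets"
  shows "c J = d J"
proof -
  have "(\<lambda>ys. c J ys - d J ys) = (\<lambda>_. 0)"
  proof (rule split_unique [where c = "\<lambda>J ys. c J ys - d J ys", OF _ _ J])
    show "(\<lambda>ys. c J ys - d J ys) \<in> CY p J" if "J \<in> subsets" for J
      using assms(1,2) [OF that] by (simp add: list_cochains_def)
    show "(\<lambda>xs. \<Sum>J\<in>subsets. pull J (\<lambda>ys. c J ys - d J ys) xs) = (\<lambda>_. 0)"
      using fun_cong [OF eq] by (simp add: pull_diff sum_subtractf)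
  qed
  then show ?thesis
    by (auto simp: fun_eq_iff)
qed

lemma corresponds_from_family:
  assumes u: "\<And>J. J \<in> subsets \<Longrightarrow> u J \<in> cocycles p Y {P J}"
  obtains x where "corresponds p x u"
proof -
  let ?a = "\<lambda>xs. \<Sum>J\<in>subsets. pull J (resY p (u J)) xs"
  have "?a \<in> list_cochains p LX {}"
    using pull_in_cochains [OF resY_cocycle(1) [OF u]] by (auto simp: list_cochains_def intro!: sum.neutral)
  moreover have "list_coboundary p LX ?a = (\<lambda>_. 0)"
    by (subst coboundary_sum_pull [OF resY_cocycle(1) [OF u]]) (simp_all add: resY_cocycle(2) [OF u] pull_zero)
  ultimately obtain x where "x \<in> cocycles p X {{}}" "resX p x = ?a"
    by (rule X_lift)
  then show thesis
    using that u by (simp add: corresponds_def)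
qed

text \<open>The components of a split cocycle are cocycles: their coboundaries split the zero
  cochain in the next degree, where splitting is unique.\<close>

lemma corresponds_to_family:
  assumes x: "x \<in> cocycles p X {{}}"
  obtains u where "corresponds p x u"
proof -
  obtain c where c: "\<And>J. J \<in> subsets \<Longrightarrow> c J \<in> CY p J"
    "resX p x = (\<lambda>xs. \<Sum>J\<in>subsets. pull J (c J) xs)"
    by (rule split_cochain [OF resX_cocycle(1) [OF x]]) (rule that)
  have "list_coboundary p LY (c J) = (\<lambda>_. 0)" if J: "J \<in> subsets" for J
  proof (rule split_unique [where c = "\<lambda>J. list_coboundary p LY (c J)", OF _ _ J])
    show "list_coboundary p LY (c J) \<in> CY (Suc p) J" if "J \<in> subsets" for J
      by (rule list_coboundary_in_cochains [OF c(1) [OF that] panel_chains_down])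
    show "(\<lambda>xs. \<Sum>J\<in>subsets. pull J (list_coboundary p LY (c J)) xs) = (\<lambda>_. 0)"
      using resX_cocycle(2) [OF x] coboundary_sum_pull [of c p] c by simp
  qed
  then have "\<exists>u. u \<in> cocycles p Y {P J} \<and> resY p u = c J" if "J \<in> subsets" for J
    using Y_lift [OF c(1) [OF that]] that by metis
  then obtain u where "\<And>J. J \<in> subsets \<Longrightarrow> u J \<in> cocycles p Y {P J} \<and> resY p (u J) = c J"
    by metis
  then have "corresponds p x u"
    using x c(2) by (simp add: corresponds_def)
  then show thesis
    by (rule that)
qed

lemma corresponds_diff:
  assumes "corresponds p x u" "corresponds p y v"
  shows "corresponds p (\<lambda>f. x f - y f) (\<lambda>J f. u J f - v J f)"
  using assms
  by (simp add: corresponds_def cocycles_diff on_lists_diff pull_diff sum_subtractf)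

lemma corresponds_add:
  assumes "corresponds p x u" "corresponds p y v"
  shows "corresponds p (\<lambda>f. x f + y f) (\<lambda>J f. u J f + v J f)"
  using assms
  by (simp add: corresponds_def cocycles_add on_lists_add pull_add sum.distrib)

text \<open>Applied to differences, the forward direction makes the induced map on classes well
  defined and the backward direction makes it injective.\<close>

lemma corresponds_coboundaries_iff:
  assumes xu: "corresponds p x u"
  shows "x \<in> coboundaries p X {{}} \<longleftrightarrow> (\<forall>J\<in>subsets. u J \<in> coboundaries p Y {P J})"
proof -
  have x: "x \<in> cocycles p X {{}}" and u: "\<And>J. J \<in> subsets \<Longrightarrow> u J \<in> cocycles p Y {P J}"
    and res: "resX p x = (\<lambda>xs. \<Sum>J\<in>subsets. pull J (resY p (u J)) xs)"
    using xu by (auto simp: corresponds_def)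
  have "resX p x \<in> list_coboundaries p LX {} \<longleftrightarrow> (\<forall>J\<in>subsets. resY p (u J) \<in> list_coboundaries p LY (panel_chains K J))"
  proof (cases p)
    case 0
    have "resX p x = (\<lambda>_. 0) \<longleftrightarrow> (\<forall>J\<in>subsets. resY p (u J) = (\<lambda>_. 0))"
    proof
      assume "resX p x = (\<lambda>_. 0)"
      then have zero: "(\<lambda>xs. \<Sum>J\<in>subsets. pull J (resY p (u J)) xs) = (\<lambda>_. 0)"
        unfolding res .
      show "\<forall>J\<in>subsets. resY p (u J) = (\<lambda>_. 0)"
      proof
        fix J assume "J \<in> subsets"
        from split_unique [where c = "\<lambda>J. resY p (u J)", OF resY_cocycle(1) [OF u] zero this]
        show "resY p (u J) = (\<lambda>_. 0)" .
      qed
    next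
      assume "\<forall>J\<in>subsets. resY p (u J) = (\<lambda>_. 0)"
      then show "resX p x = (\<lambda>_. 0)"
        unfolding res by (simp add: pull_zero)
    qed
    then show ?thesis
      by (simp add: list_coboundaries_def 0)
  next
    case (Suc q)
    show ?thesis
    proof
      assume "resX p x \<in> list_coboundaries p LX {}"
      then obtain a where a: "a \<in> list_cochains q LX {}" "resX p x = list_coboundary q LX a"
        by (auto simp: list_coboundaries_def Suc)
      obtain c where c: "\<And>J. J \<in> subsets \<Longrightarrow> c J \<in> CY q J"
        "a = (\<lambda>xs. \<Sum>J\<in>subsets. pull J (c J) xs)"
        by (rule split_cochain [OF a(1)]) (rule that)
      have eq: "(\<lambda>xs. \<Sum>J\<in>subsets. pull J (resY p (u J)) xs) = (\<lambda>xs. \<Sum>J\<in>subsets. pull J (list_coboundary q LY (c J)) xs)"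
        using a(2) coboundary_sum_pull [of c q, OF c(1)] unfolding res c(2) by simp
      show "\<forall>J\<in>subsets. resY p (u J) \<in> list_coboundaries p LY (panel_chains K J)"
      proof
        fix J assume J: "J \<in> subsets"
        have "resY p (u J) = list_coboundary q LY (c J)"
        proof (rule split_unique_diff [where c = "\<lambda>J. resY p (u J)" and d = "\<lambda>J. list_coboundary q LY (c J)", OF _ _ eq J])
          show "resY p (u J) \<in> CY p J" if "J \<in> subsets" for J
            by (rule resY_cocycle(1) [OF u [OF that]])
          show "list_coboundary q LY (c J) \<in> CY p J" if "J \<in> subsets" for J
            unfolding Suc by (rule list_coboundary_in_cochains [OF c(1) [OF that] panel_chains_down])
        qed
        then show "resY p (u J) \<in> list_coboundaries p LY (panel_chains K J)"
          using c(1) [OF J] by (simp add: list_coboundaries_def Suc)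
      qed
    next
      assume "\<forall>J\<in>subsets. resY p (u J) \<in> list_coboundaries p LY (panel_chains K J)"
      then have "\<exists>c. c \<in> CY q J \<and> resY p (u J) = list_coboundary q LY c" if "J \<in> subsets" for J
        using that by (auto simp: list_coboundaries_def Suc)
      then obtain c where c: "\<And>J. J \<in> subsets \<Longrightarrow> c J \<in> CY q J"
        "\<And>J. J \<in> subsets \<Longrightarrow> resY p (u J) = list_coboundary q LY (c J)"
        by metis
      let ?a = "\<lambda>xs. \<Sum>J\<in>subsets. pull J (c J) xs"
      have "?a \<in> list_cochains q LX {}"
        using pull_in_cochains [OF c(1)] by (auto simp: list_cochains_def intro!: sum.neutral)
      moreover have "resX p x = list_coboundary q LX ?a"
        unfolding res using c(2) by (subst coboundary_sum_pull [of c q, OF c(1)]) simp_all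
      ultimately show "resX p x \<in> list_coboundaries p LX {}"
        by (simp add: list_coboundaries_def Suc)
    qed
  qed
  moreover have "resX p x \<in> list_coboundaries p LX {} \<longleftrightarrow> x \<in> coboundaries p X {{}}"
    using X_coboundary [OF x] X_res_coboundaries [of x p] by blast
  moreover have "resY p (u J) \<in> list_coboundaries p LY (panel_chains K J) \<longleftrightarrow> u J \<in> coboundaries p Y {P J}" if "J \<in> subsets" for J
    using Y_coboundary [OF u [OF that]] Y_res_coboundaries [of "u J" p J] by blast
  ultimately show ?thesis
    by auto
qed

definition union_pairs :: "nat set \<Rightarrow> (nat set \<times> nat set) set" where
  "union_pairs L = {(J, J'). J \<subseteq> {1..m} \<and> J' \<subseteq> {1..m} \<and> J \<union> J' = L}"

text \<open>On lists, the product of the two sums expands over pairs (\<open>J\<close>,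
  \<open>J'\<close>) and is regrouped by their union. The lift \<open>w J J'\<close> of each summand
  represents the relative cup product by \<open>rel_cup_class\<close>. The third conclusion supplies
  the carrier condition for rewriting inside \<open>finprod\<close>.\<close>

lemma corresponds_cup:
  assumes xu: "corresponds p x u" and yv: "corresponds q y v"
  obtains w where "corresponds (p + q) (cup_cochain p q X x y) w"
    "\<And>L. L \<in> subsets \<Longrightarrow> clsY (p + q) L (w L)
       = finprod (HY (p + q) L) (\<lambda>(J, J'). rel_cup p q Y (P J) (P J')
           (clsY p J (u J)) (clsY q J' (v J'))) (union_pairs L)"
    "\<And>L J J'. (J, J') \<in> union_pairs L \<Longrightarrow> rel_cup p q Y (P J) (P J')
       (clsY p J (u J)) (clsY q J' (v J')) \<in> carrier (HY (p + q) L)"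
proof -
  have x: "x \<in> cocycles p X {{}}" and u: "\<And>J. J \<in> subsets \<Longrightarrow> u J \<in> cocycles p Y {P J}"
    and resx: "resX p x = (\<lambda>xs. \<Sum>J\<in>subsets. pull J (resY p (u J)) xs)"
    using xu by (auto simp: corresponds_def)
  have y: "y \<in> cocycles q X {{}}" and v: "\<And>J. J \<in> subsets \<Longrightarrow> v J \<in> cocycles q Y {P J}"
    and resy: "resX q y = (\<lambda>xs. \<Sum>J\<in>subsets. pull J (resY q (v J)) xs)"
    using yv by (auto simp: corresponds_def)
  have "\<exists>w. w \<in> cocycles (p + q) Y {P (J \<union> J')} \<and> resY (p + q) w = resY (p + q) (cup_cochain p q Y (u J) (v J'))"
    if J: "J \<in> subsets" "J' \<in> subsets" for J J'
  proof -
    interpret pair: list_comparison UNIV unit_at LY "panel_chains K J \<union> panel_chains K J'" Y "{P J, P J'}"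
      by (rule Y_comparison)
    have "cup_cochain p q Y (u J) (v J') \<in> cocycles (p + q) Y {P J, P J'}"
      by (rule cup_cochain_cocycle [OF u [OF J(1)] v [OF J(2)]])
    then have "resY (p + q) (cup_cochain p q Y (u J) (v J')) \<in> CY (p + q) (J \<union> J')"
      "list_coboundary (p + q) LY (resY (p + q) (cup_cochain p q Y (u J) (v J'))) = (\<lambda>_. 0)"
      using pair.res_in_cochains pair.res_coboundary [of "p + q" "cup_cochain p q Y (u J) (v J')", symmetric]
      by (auto simp: cocycles_def panel_chains_Un on_lists_zero)
    then show ?thesis
      by (rule Y_lift) blast
  qed
  then obtain w where w: "\<And>J J'. J \<in> subsets \<Longrightarrow> J' \<in> subsets \<Longrightarrow> w J J' \<in> cocycles (p + q) Y {P (J \<union> J')}"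
    and resw: "\<And>J J'. J \<in> subsets \<Longrightarrow> J' \<in> subsets \<Longrightarrow> resY (p + q) (w J J') = resY (p + q) (cup_cochain p q Y (u J) (v J'))"
    by metis
  \<comment> \<open>Adding cochain representatives corresponds to the \<open>finprod\<close> of
    classes in \<open>R_mult\<close>.\<close>
  define W where "W L f = (\<Sum>z\<in>union_pairs L. w (fst z) (snd z) f)" for L f
  have pairs: "fst z \<in> subsets \<and> snd z \<in> subsets \<and> fst z \<union> snd z = L" if "z \<in> union_pairs L" for z L
    using that by (auto simp: union_pairs_def)
  have wz: "w (fst z) (snd z) \<in> cocycles (p + q) Y {P L}" if "z \<in> union_pairs L" for z L
    using w [of "fst z" "snd z"] pairs [OF that] by auto
  have W: "finprod (HY (p + q) L) (\<lambda>z. clsY (p + q) L (w (fst z) (snd z))) (union_pairs L)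
       = clsY (p + q) L (W L) \<and> W L \<in> cocycles (p + q) Y {P L}" for L
    unfolding W_def by (rule finprod_cohomology_class [OF wz])
  show thesis
  proof (rule that)
    have pull_w: "pull J (resY p (u J)) (take (Suc p) xs) * pull J' (resY q (v J')) (drop p xs)
        = pull (J \<union> J') (resY (p + q) (w J J')) xs"
      if "J \<in> subsets" "J' \<in> subsets" and xs: "length xs = Suc (p + q)" "set xs \<in> LX" for J J' xs
      unfolding pull_cup [OF resY_cocycle(1) [OF u [OF that(1)]] resY_cocycle(1) [OF v [OF that(2)]] xs]
        resw [OF that(1,2)] Y_res_cup
      using xs set_map_fst_LY [OF xs(2)] by (simp add: pull_def)
    have "resX (p + q) (cup_cochain p q X x y) xs = (\<Sum>L\<in>subsets. pull L (resY (p + q) (W L)) xs)" for xs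
    proof (cases "length xs = Suc (p + q) \<and> set xs \<in> LX")
      case True
      let ?S = "subsets \<times> subsets"
      have "resX (p + q) (cup_cochain p q X x y) xs
          = (\<Sum>J\<in>subsets. \<Sum>J'\<in>subsets. pull J (resY p (u J)) (take (Suc p) xs) * pull J' (resY q (v J')) (drop p xs))"
        unfolding X_res_cup resx resy sum_product using True by simp
      also have "\<dots> = (\<Sum>z\<in>?S. pull (fst z \<union> snd z) (resY (p + q) (w (fst z) (snd z))) xs)"
        unfolding sum.cartesian_product by (rule sum.cong) (use pull_w True in auto)
      also have "\<dots> = (\<Sum>L\<in>subsets. \<Sum>z\<in>{z \<in> ?S. fst z \<union> snd z = L}. pull (fst z \<union> snd z) (resY (p + q) (w (fst z) (snd z))) xs)"
        by (rule sum.group [symmetric]) auto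
      also have "\<dots> = (\<Sum>L\<in>subsets. \<Sum>z\<in>union_pairs L. pull L (resY (p + q) (w (fst z) (snd z))) xs)"
        by (intro sum.cong) (auto simp: union_pairs_def)
      also have "\<dots> = (\<Sum>L\<in>subsets. pull L (resY (p + q) (W L)) xs)"
        unfolding W_def on_lists_sum pull_sum ..
      finally show ?thesis .
    next
      case False
      have "pull L (resY (p + q) (W L)) xs = 0" for L
        using False by (auto simp: pull_def on_lists_def)
      moreover have "resX (p + q) (cup_cochain p q X x y) xs = 0"
        using False by (auto simp: on_lists_def)
      ultimately show ?thesis by simp
    qed
    moreover have "cup_cochain p q X x y \<in> cocycles (p + q) X {{}}"
      using cup_cochain_cocycle [OF x y] by simp
    ultimately show "corresponds (p + q) (cup_cochain p q X x y) W"
      using W by (auto simp: corresponds_def)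
    have rc: "rel_cup p q Y (P J) (P J') (clsY p J (u J)) (clsY q J' (v J'))
        = clsY (p + q) L (w J J')" if "(J, J') \<in> union_pairs L" for J J' L
    proof -
      have J: "J \<in> subsets" "J' \<in> subsets" "J \<union> J' = L"
        using that by (auto simp: union_pairs_def)
      have PL: "P J \<union> P J' = P L"
        using P_Un [of J J'] J(3) by simp
      have LB: "panel_chains K J \<union> panel_chains K J' = panel_chains K L"
        using panel_chains_Un [of K J J'] J(3) by simp
      show ?thesis
        unfolding PL [symmetric]
      proof (rule rel_cup_class)
        show "list_comparison UNIV unit_at LY (panel_chains K L) Y {P J \<union> P J'}"
          unfolding PL by (rule Y_comparison_single)
        show "list_comparison UNIV unit_at LY (panel_chains K L) Y {P J, P J'}"
          unfolding LB [symmetric] by (rule Y_comparison)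
        show "u J \<in> cocycles p Y {P J}" "v J' \<in> cocycles q Y {P J'}"
          by (rule u [OF J(1)], rule v [OF J(2)])
        show "w J J' \<in> cocycles (p + q) Y {P J \<union> P J'}"
          using w [OF J(1,2)] by (simp add: P_Un)
        show "resY (p + q) (w J J') = resY (p + q) (cup_cochain p q Y (u J) (v J'))"
          by (rule resw [OF J(1,2)])
      qed
    qed
    show "rel_cup p q Y (P J) (P J') (clsY p J (u J)) (clsY q J' (v J'))
        \<in> carrier (HY (p + q) L)" if "(J, J') \<in> union_pairs L" for L J J'
      using rc [OF that] wz [OF that] by simp
    show "clsY (p + q) L (W L)
       = finprod (HY (p + q) L) (\<lambda>(J, J'). rel_cup p q Y (P J) (P J')
           (clsY p J (u J)) (clsY q J' (v J'))) (union_pairs L)"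
      if "L \<in> subsets" for L
    proof -
      interpret HL: comm_group "HY (p + q) L"
        by (rule comm_group_cohomology_group)
      have "finprod (HY (p + q) L) (\<lambda>(J, J'). rel_cup p q Y (P J) (P J')
           (clsY p J (u J)) (clsY q J' (v J'))) (union_pairs L)
        = finprod (HY (p + q) L) (\<lambda>z. clsY (p + q) L (w (fst z) (snd z))) (union_pairs L)"
      proof (rule HL.finprod_cong')
        show "(\<lambda>z. clsY (p + q) L (w (fst z) (snd z))) \<in> union_pairs L \<rightarrow> carrier (HY (p + q) L)"
          using wz by auto
      qed (use rc in auto)
      then show ?thesis
        using W by simp
    qed
  qed
qed

section \<open>Products, units and the isomorphism on classes\<close>

lemma rel_cup_X:
  assumes "x \<in> cocycles p X {{}}" "y \<in> cocycles q X {{}}"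
  shows "rel_cup p q X {} {} (clsX p x) (clsX q y)
       = clsX (p + q) (cup_cochain p q X x y)"
  using rel_cup_class [of "{1..m}" cube_point LX "{}" X "{}" "{}" x p y q "cup_cochain p q X x y"]
    X_list_comparison assms cup_cochain_cocycle [OF assms] by simp

lemma one_cocycle: "(\<lambda>f. if singular_simplex 0 Z f then 1 else 0) \<in> cocycles 0 Z {{}}"
proof -
  have "singular_simplex 0 Z (singular_face (Suc 0) k f)" if "singular_simplex (Suc 0) Z f" "k \<le> Suc 0" for k f
    by (rule singular_face_Suc [OF that])
  then show ?thesis
    by (auto simp: cocycles_def cochains_def coboundary_def singular_simplex_empty fun_eq_iff)
qed

text \<open>For \<open>J = {}\<close> nothing is cut off, so the unit of Y pulls back to the unit of
  the cube complex.\<close>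

lemma corresponds_one:
  "corresponds 0 (\<lambda>f. if singular_simplex 0 X f then 1 else 0)
     (\<lambda>J. if J = {} then (\<lambda>f. if singular_simplex 0 Y f then 1 else 0) else (\<lambda>_. 0))"
  (is "corresponds 0 ?x ?u")
  unfolding corresponds_def
proof (intro conjI ballI)
  have P0: "P {} = {}"
    by (simp add: union_over_def)
  show "?x \<in> cocycles 0 X {{}}"
    by (rule one_cocycle)
  show "?u J \<in> cocycles 0 Y {P J}" for J
    using one_cocycle [of Y] by (simp add: P0)
  show "resX 0 ?x = (\<lambda>xs. \<Sum>J\<in>subsets. pull J (resY 0 (?u J)) xs)"
  proof
    fix xs
    have "(\<Sum>J\<in>subsets. pull J (resY 0 (?u J)) xs) = (\<Sum>J\<in>{{}}. pull J (resY 0 (?u J)) xs)"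
      by (rule sum.mono_neutral_right) (auto simp: on_lists_zero pull_zero)
    also have "\<dots> = resX 0 ?x xs"
      using list_comparison.affine_singular [OF X_list_comparison, of xs 0] set_map_fst_LY [of xs]
        list_comparison.affine_singular [OF Y_comparison_single [of "{}"], of "map fst xs" 0]
      by (simp add: pull_def on_lists_def)
    finally show "resX 0 ?x xs = (\<Sum>J\<in>subsets. pull J (resY 0 (?u J)) xs)" ..
  qed
qed

text \<open>Both the representative and its family are chosen arbitrarily;
  \<open>family_of_class\<close> removes the dependence on the choice.\<close>

definition family_of :: "nat \<Rightarrow> (nat \<Rightarrow> real) cochain set \<Rightarrow> (nat set \<Rightarrow> (nat set option \<Rightarrow> real) cochain set)" where
  "family_of p z = (let u = (SOME u. \<exists>x\<in>z. corresponds p x u) in (\<lambda>J\<in>subsets. clsY p J (u J)))"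

lemma family_of_class:
  assumes xu: "corresponds p x u"
  shows "family_of p (clsX p x) = (\<lambda>J\<in>subsets. clsY p J (u J))"
proof -
  define v where "v = (SOME v. \<exists>y\<in>clsX p x. corresponds p y v)"
  have "\<exists>v. \<exists>y\<in>clsX p x. corresponds p y v"
    using xu self_mem_cohomology_class by blast
  then obtain y where y: "y \<in> clsX p x" "corresponds p y v"
    unfolding v_def by (rule someI_ex [THEN bexE]) blast
  have "(\<lambda>f. y f - x f) \<in> coboundaries p X {{}}"
    using y(1) by (simp add: cohomology_class_eq_set)
  then have "\<forall>J\<in>subsets. (\<lambda>f. v J f - u J f) \<in> coboundaries p Y {P J}"
    using corresponds_coboundaries_iff [OF corresponds_diff [OF y(2) xu]] by simp
  then show ?thesis
    by (auto simp: family_of_def v_def [symmetric] Let_def restrict_def fun_eq_iff cohomology_class_eq_iff)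
qed

lemma R_group_groups: "group (HY p J)"
  using comm_group_cohomology_group comm_group.axioms(2) by blast

lemma carrier_R_group: "carrier (RG p) = (\<Pi>\<^sub>E J\<in>subsets. carrier (HY p J))"
  unfolding R_group_def by (subst carrier_sum_group) (auto simp: R_group_groups)

lemma comm_group_R_group: "comm_group (RG p)"
proof (rule group.group_comm_groupI)
  show "group (RG p)"
    unfolding R_group_def by (rule sum_group) (rule R_group_groups)
  fix x y assume "x \<in> carrier (RG p)" "y \<in> carrier (RG p)"
  then have xy: "x J \<in> carrier (HY p J)" "y J \<in> carrier (HY p J)" if "J \<in> subsets" for J
    using that by (auto simp: carrier_R_group)
  have "x J \<otimes>\<^bsub>HY p J\<^esub> y J = y J \<otimes>\<^bsub>HY p J\<^esub> x J" if "J \<in> subsets" for J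
    using comm_monoid.m_comm [OF comm_group.axioms(1) [OF comm_group_cohomology_group] xy [OF that]] .
  then show "x \<otimes>\<^bsub>RG p\<^esub> y = y \<otimes>\<^bsub>RG p\<^esub> x"
    unfolding R_group_def mult_sum_group by (intro restrict_ext)
qed

lemma family_of_iso: "family_of p \<in> iso (HX p) (RG p)"
proof -
  have rep: "\<exists>x u. z = clsX p x \<and> corresponds p x u" if "z \<in> carrier (HX p)" for z
    using that corresponds_to_family unfolding carrier_cohomology_group by blast
  have mem: "family_of p z \<in> carrier (RG p)" if "z \<in> carrier (HX p)" for z
  proof -
    from rep [OF that] obtain x u where xu: "z = clsX p x" "corresponds p x u"
      by blast
    then show ?thesis
      by (simp add: family_of_class [OF xu(2)] carrier_R_group restrict_PiE_iff corresponds_def)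
  qed
  have "family_of p \<in> hom (HX p) (RG p)"
  proof (rule homI)
    fix y z assume "y \<in> carrier (HX p)" "z \<in> carrier (HX p)"
    then obtain s u t v where su: "y = clsX p s" "corresponds p s u"
      and tv: "z = clsX p t" "corresponds p t v"
      using rep by meson
    have "s \<in> cocycles p X {{}}" "t \<in> cocycles p X {{}}"
      using su tv by (auto simp: corresponds_def)
    then have "family_of p (y \<otimes>\<^bsub>HX p\<^esub> z) = (\<lambda>J\<in>subsets. clsY p J (\<lambda>f. u J f + v J f))"
      using family_of_class [OF corresponds_add [OF su(2) tv(2)]] by (simp add: su tv mult_cohomology_class)
    also have "\<dots> = family_of p y \<otimes>\<^bsub>RG p\<^esub> family_of p z"
      unfolding R_group_def mult_sum_group su(1) tv(1) family_of_class [OF su(2)] family_of_class [OF tv(2)]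
      by (rule restrict_ext) (use su(2) tv(2) in \<open>auto simp: corresponds_def mult_cohomology_class\<close>)
    finally show "family_of p (y \<otimes>\<^bsub>HX p\<^esub> z)
        = family_of p y \<otimes>\<^bsub>RG p\<^esub> family_of p z" .
  qed (rule mem)
  moreover have "inj_on (family_of p) (carrier (HX p))"
  proof (rule inj_onI)
    fix y z assume "y \<in> carrier (HX p)" "z \<in> carrier (HX p)"
      and eq: "family_of p y = family_of p z"
    then obtain s u t v where su: "y = clsX p s" "corresponds p s u"
      and tv: "z = clsX p t" "corresponds p t v"
      using rep by meson
    have "(\<lambda>f. u J f - v J f) \<in> coboundaries p Y {P J}" if "J \<in> subsets" for J
      using fun_cong [OF eq, of J] that
      by (simp add: su tv family_of_class [OF su(2)] family_of_class [OF tv(2)] cohomology_class_eq_iff)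
    then show "y = z"
      using corresponds_coboundaries_iff [OF corresponds_diff [OF su(2) tv(2)]]
      by (simp add: su tv cohomology_class_eq_iff)
  qed
  moreover have "carrier (RG p) \<subseteq> family_of p ` carrier (HX p)"
  proof
    fix Z assume Z: "Z \<in> carrier (RG p)"
    have "\<exists>u. u \<in> cocycles p Y {P J} \<and> Z J = clsY p J u" if "J \<in> subsets" for J
    proof -
      have "Z J \<in> carrier (HY p J)"
        using Z that unfolding carrier_R_group by (rule PiE_mem)
      then show ?thesis
        unfolding carrier_cohomology_group by blast
    qed
    then obtain u where u: "\<And>J. J \<in> subsets \<Longrightarrow> u J \<in> cocycles p Y {P J}"
      "\<And>J. J \<in> subsets \<Longrightarrow> Z J = clsY p J (u J)"
      by metis
    obtain x where x: "corresponds p x u"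
      using corresponds_from_family [OF u(1)] by blast
    have "Z \<in> extensional subsets"
      using Z by (simp add: carrier_R_group PiE_def)
    then have "Z = family_of p (clsX p x)"
      unfolding family_of_class [OF x] by (rule extensionalityI) (use u(2) in auto)
    moreover have "clsX p x \<in> carrier (HX p)"
      using x by (simp add: corresponds_def)
    ultimately show "Z \<in> family_of p ` carrier (HX p)"
      by blast
  qed
  ultimately show ?thesis
    using mem by (auto simp: iso_def bij_betw_def)
qed

lemma real_moment_angle_cohomology_ring:
  "graded_ring_isomorphic (cohomology_ring X) (R_ring Y m (P_panel K))"
  unfolding cohomology_ring_def R_ring_def
proof (rule graded_ring_isomorphicI)
  show "comm_group (HX p)" for p
    by (rule comm_group_cohomology_group)
  show "comm_group (RG p)" for p
    by (rule comm_group_R_group)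
  show "family_of p \<in> iso (HX p) (RG p)" for p
    by (rule family_of_iso)
  fix p q a b assume "a \<in> carrier (HX p)" "b \<in> carrier (HX q)"
  then obtain x y where x: "x \<in> cocycles p X {{}}" "a = clsX p x"
    and y: "y \<in> cocycles q X {{}}" "b = clsX q y"
    unfolding carrier_cohomology_group by blast
  show "rel_cup p q X {} {} a b \<in> carrier (HX (p + q))"
    using cup_cochain_cocycle [OF x(1) y(1)] by (simp add: x y rel_cup_X)
  obtain u where u: "corresponds p x u"
    using corresponds_to_family [OF x(1)] by blast
  obtain v where v: "corresponds q y v"
    using corresponds_to_family [OF y(1)] by blast
  obtain w where w: "corresponds (p + q) (cup_cochain p q X x y) w"
    "\<And>L. L \<in> subsets \<Longrightarrow> clsY (p + q) L (w L)
       = finprod (HY (p + q) L) (\<lambda>(J, J'). rel_cup p q Y (P J) (P J')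
           (clsY p J (u J)) (clsY q J' (v J'))) (union_pairs L)"
    and cup_carrier: "\<And>L J J'. (J, J') \<in> union_pairs L \<Longrightarrow> rel_cup p q Y (P J) (P J')
       (clsY p J (u J)) (clsY q J' (v J')) \<in> carrier (HY (p + q) L)"
    by (rule corresponds_cup [OF u v]) (rule that)
  have "family_of (p + q) (rel_cup p q X {} {} a b) = (\<lambda>L\<in>subsets. clsY (p + q) L (w L))"
    using family_of_class [OF w(1)] by (simp add: x y rel_cup_X)
  also have "\<dots> = R_mult Y m (P_panel K) p q (family_of p a) (family_of q b)"
    unfolding R_mult_def
  proof (rule restrict_ext)
    fix L assume L: "L \<in> subsets"
    have a: "family_of p a J = clsY p J (u J)" and b: "family_of q b J = clsY q J (v J)"
      if "J \<subseteq> {1..m}" for J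
      using that family_of_class [OF u] family_of_class [OF v] by (simp_all add: x y)
    have eq: "(\<lambda>(J, J'). rel_cup p q Y (P J) (P J') (family_of p a J) (family_of q b J')) z
        = (\<lambda>(J, J'). rel_cup p q Y (P J) (P J') (clsY p J (u J)) (clsY q J' (v J'))) z"
      if "z \<in> union_pairs L" for z
      using that a b by (auto simp: union_pairs_def)
    show "clsY (p + q) L (w L) = finprod (HY (p + q) L)
        (\<lambda>(J, J'). rel_cup p q Y (P J) (P J') (family_of p a J) (family_of q b J'))
        {(J, J'). J \<subseteq> {1..m} \<and> J' \<subseteq> {1..m} \<and> J \<union> J' = L}"
    proof -
      interpret HL: comm_group "HY (p + q) L"
        by (rule comm_group_cohomology_group)
      show ?thesis
        unfolding w(2) [OF L] union_pairs_def [symmetric]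
        by (rule HL.finprod_cong') (use eq cup_carrier in auto)
    qed
  qed
  finally show "family_of (p + q) (rel_cup p q X {} {} a b) = R_mult Y m (P_panel K) p q (family_of p a) (family_of q b)" .
next
  have "family_of 0 (unit_class X) = (\<lambda>J\<in>subsets. clsY 0 J
      (if J = {} then (\<lambda>f. if singular_simplex 0 Y f then 1 else 0) else (\<lambda>_. 0)))"
    unfolding unit_class_def by (rule family_of_class [OF corresponds_one])
  also have "\<dots> = R_unit Y m (P_panel K)"
    unfolding R_unit_def unit_class_def by (rule restrict_ext) (auto simp: one_cohomology_group union_over_def)
  finally show "family_of 0 (unit_class X) = R_unit Y m (P_panel K)" .
qed

end

theorem proposition3p4:
  fixes m :: nat and K :: "nat set set"
  assumes "simplicial_complex_on m K"
    and "\<And>j. j \<in> {1..m} \<Longrightarrow> \<exists>\<sigma>\<in>K. j \<in> \<sigma>"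
  shows "graded_ring_isomorphic
           (cohomology_ring (real_moment_angle m K))
           (R_ring (Y_space K) m (P_panel K))"
proof -
  interpret finite_complex m K
    by unfold_locales (rule assms(1))
  show ?thesis
    by (rule real_moment_angle_cohomology_ring)
qed

end
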